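(* Let $(\mathcal F,\xi)\colon\mathcal C\to\mathcal D$ be a $\mathbb C$-linear monoidal equivalence of pseudo-unitary fusion categories over $\mathbb C$. Then $\mathcal F$ preserves the canonical pivotal structures.
   Context: Conventions. In a monoidal category the associativity isomorphism is $\Phi\colon (U\otimes V)\otimes W\to U\otimes (V\otimes W)$ and the unit object $I$ is strict: $V\otimes I=V=I\otimes V$. An object also denotes its identity morphism. A (left) dual of $V$ is $(V^\vee,\mathrm{ev}_V\colon V^\vee\otimes V\to I,\mathrm{db}_V\colon I\to V\otimes V^\vee)$ with $(V\otimes \mathrm{ev}_V)\Phi(\mathrm{db}_V\otimes V)=\mathrm{id}_V$ and $(\mathrm{ev}_V\otimes V^\vee)\Phi^{-1}(V^\vee\otimes\mathrm{db}_V)=\mathrm{id}_{V^\vee}$. A category is rigid if all left duals exist; a choice is fixed with $I^\vee=I$. Then $(-)^\vee$ is a contravariant functor, with $f^\vee$ for $f\colon V\to W$ determined by $\mathrm{ev}_V(f^\vee\otimes V)=\mathrm{ev}_W(W^\vee\otimes f)$, and $(-)^{\vee\vee}$ is canonically a monoidal functor. A pivotal structure is a monoidal natural isomorphism $j_V\colon V\to V^{\vee\vee}$. A fusion category is a semisimple $\mathbb C$-linear rigid monoidal category (abelian, finite-dimensional morphism spaces, bilinear tensor product, every object a finite direct sum of simple objects, simple meaning endomorphism ring $\mathbb C$, unit object simple) with finitely many isomorphism classes of simple objects; let $V_1,\dots,V_m$ be representatives. For $V\in\mathcal C$, write $[V][V_i]=\sum_jN_{i,j}[V_j]$ in the Grothendieck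 ring; $\operatorname{FPdim}(V)$ is the largest nonnegative real eigenvalue of the matrix $[N_{i,j}]$, and $\operatorname{FPdim}(\mathcal C)=\sum_i\operatorname{FPdim}(V_i)^2$. For $a\colon V\to V^{\vee\vee}$ put $\underline{\mathrm{tr}}(a)=\mathrm{ev}_{V^\vee}(a\otimes V^\vee)\mathrm{db}_V\in\mathrm{End}(I)=\mathbb C$. Every simple $V$ admits an isomorphism $a\colon V\to V^{\vee\vee}$, and $|V|^2=\underline{\mathrm{tr}}(a)\,\underline{\mathrm{tr}}((a^{-1})^\vee)$ is independent of $a$. The global dimension is $\dim(\mathcal C)=\sum_i|V_i|^2$. $\mathcal C$ is pseudo-unitary if $\dim(\mathcal C)=\operatorname{FPdim}(\mathcal C)$. By Etingof–Nikshych–Ostrik, a pseudo-unitary fusion category has a unique pivotal structure $j$, called canonical, with $\underline{\mathrm{tr}}(j_V)=\operatorname{FPdim}(V)$ for every simple $V$. A monoidal functor $(\mathcal F,\xi)$ has coherent natural isomorphisms $\xi\colon\mathcal F(V)\otimes\mathcal F(W)\to\mathcal F(V\otimes W)$ and $\mathcal F(I)=I$ with identity unit structure. Its duality transformation $\tilde\xi_X\colon\mathcal F(X^\vee)\to\mathcal F(X)^\vee$ is the isomorphism determined by $\mathrm{ev}_{\mathcal F(X)}(\tilde\xi_X\otimes\mathcal F(X))=\mathcal F(\mathrm{ev}_X)\xi$. $\mathcal F$ preserves pivotal structures $j$ if $\tilde\xi_{X^\vee}\mathcal F(j_X)=(\tilde\xi_X)^\vee j_{\mathcal F(X)}$ for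 all $X$. *)

theory Defs
  imports
    "Jordan_Normal_Form.VS_Connect"
    "Jordan_Normal_Form.Char_Poly"
    "HOL-Algebra.Free_Abelian_Groups"
begin

section \<open>Categories\<close>

text \<open>Categories are carrier-based, in the style of HOL-Algebra. Every arrow has one domain and one
  codomain; composition is in the usual order and is constrained for composable arrows only.\<close>

record ('o, 'm) cat =
  Obj :: "'o set"
  Arr :: "'m set"
  Dom :: "'m \<Rightarrow> 'o"
  Cod :: "'m \<Rightarrow> 'o"
  Ident :: "'o \<Rightarrow> 'm"
  Comp :: "'m \<Rightarrow> 'm \<Rightarrow> 'm" (infixl "\<cdot>\<index>" 65)

definition Hom :: "('o, 'm, 'x) cat_scheme \<Rightarrow> 'o \<Rightarrow> 'o \<Rightarrow> 'm set" where
  "Hom C X Y = {f \<in> Arr C. Dom C f = X \<and> Cod C f = Y}"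

locale category =
  fixes C :: "('o, 'm, 'x) cat_scheme" (structure)
  assumes Dom_closed: "f \<in> Arr C \<Longrightarrow> Dom C f \<in> Obj C"
    and Cod_closed: "f \<in> Arr C \<Longrightarrow> Cod C f \<in> Obj C"
    and Ident_Hom: "X \<in> Obj C \<Longrightarrow> Ident C X \<in> Hom C X X"
    and Comp_Hom: "f \<in> Hom C X Y \<Longrightarrow> g \<in> Hom C Y Z \<Longrightarrow> g \<cdot> f \<in> Hom C X Z"
    and Comp_Ident: "f \<in> Hom C X Y \<Longrightarrow> f \<cdot> Ident C X = f"
    and Ident_Comp: "f \<in> Hom C X Y \<Longrightarrow> Ident C Y \<cdot> f = f"
    and Comp_assoc: "f \<in> Hom C W X \<Longrightarrow> g \<in> Hom C X Y \<Longrightarrow> h \<in> Hom C Y Z \<Longrightarrow>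
      (h \<cdot> g) \<cdot> f = h \<cdot> (g \<cdot> f)"

definition mutually_inverse ::
    "('o, 'm, 'x) cat_scheme \<Rightarrow> 'o \<Rightarrow> 'o \<Rightarrow> 'm \<Rightarrow> 'm \<Rightarrow> bool" where
  "mutually_inverse C X Y f g \<longleftrightarrow> f \<in> Hom C X Y \<and> g \<in> Hom C Y X \<and>
     g \<cdot>\<^bsub>C\<^esub> f = Ident C X \<and> f \<cdot>\<^bsub>C\<^esub> g = Ident C Y"

definition Iso :: "('o, 'm, 'x) cat_scheme \<Rightarrow> 'o \<Rightarrow> 'o \<Rightarrow> 'm set" where
  "Iso C X Y = {f. \<exists>g. mutually_inverse C X Y f g}"

definition Inv :: "('o, 'm, 'x) cat_scheme \<Rightarrow> 'm \<Rightarrow> 'm" where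
  "Inv C f = (THE g. mutually_inverse C (Dom C f) (Cod C f) f g)"

definition is_mono :: "('o, 'm, 'x) cat_scheme \<Rightarrow> 'm \<Rightarrow> bool" where
  "is_mono C f \<longleftrightarrow> f \<in> Arr C \<and>
     (\<forall>W. \<forall>g\<in>Hom C W (Dom C f). \<forall>h\<in>Hom C W (Dom C f). f \<cdot>\<^bsub>C\<^esub> g = f \<cdot>\<^bsub>C\<^esub> h \<longrightarrow> g = h)"

definition is_epi :: "('o, 'm, 'x) cat_scheme \<Rightarrow> 'm \<Rightarrow> bool" where
  "is_epi C f \<longleftrightarrow> f \<in> Arr C \<and>
     (\<forall>W. \<forall>g\<in>Hom C (Cod C f) W. \<forall>h\<in>Hom C (Cod C f) W. g \<cdot>\<^bsub>C\<^esub> f = h \<cdot>\<^bsub>C\<^esub> f \<longrightarrow> g = h)"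

section \<open>Complex-linear and abelian categories\<close>

record ('o, 'm) linear_cat = "('o, 'm) cat" +
  ZeroArr :: "'o \<Rightarrow> 'o \<Rightarrow> 'm"
  AddArr :: "'m \<Rightarrow> 'm \<Rightarrow> 'm" (infixl "\<boxplus>\<index>" 60)
  Scale :: "complex \<Rightarrow> 'm \<Rightarrow> 'm" (infixr "\<star>\<index>" 70)

text \<open>The multiplicative fields are junk: they are only present because module records
  extend ring records, and the vector space axioms do not mention them.\<close>

definition Hom_space :: "('o, 'm, 'x) linear_cat_scheme \<Rightarrow> 'o \<Rightarrow> 'o \<Rightarrow> (complex, 'm) module" where
  "Hom_space C X Y = \<lparr>carrier = Hom C X Y, monoid.mult = undefined, one = undefined,
     ring.zero = ZeroArr C X Y, ring.add = AddArr C, module.smult = Scale C\<rparr>"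

locale linear_category = category C for C :: "('o, 'm, 'x) linear_cat_scheme" (structure) +
  assumes Hom_vectorspace: "X \<in> Obj C \<Longrightarrow> Y \<in> Obj C \<Longrightarrow> vectorspace class_ring (Hom_space C X Y)"
    and Comp_add_right: "f \<in> Hom C X Y \<Longrightarrow> f' \<in> Hom C X Y \<Longrightarrow> g \<in> Hom C Y Z \<Longrightarrow>
      g \<cdot> (f \<boxplus> f') = (g \<cdot> f) \<boxplus> (g \<cdot> f')"
    and Comp_add_left: "f \<in> Hom C X Y \<Longrightarrow> g \<in> Hom C Y Z \<Longrightarrow> g' \<in> Hom C Y Z \<Longrightarrow>
      (g \<boxplus> g') \<cdot> f = (g \<cdot> f) \<boxplus> (g' \<cdot> f)"
    and Comp_scale_right: "f \<in> Hom C X Y \<Longrightarrow> g \<in> Hom C Y Z \<Longrightarrow> g \<cdot> (c \<star> f) = c \<star> (g \<cdot> f)"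
    and Comp_scale_left: "f \<in> Hom C X Y \<Longrightarrow> g \<in> Hom C Y Z \<Longrightarrow> (c \<star> g) \<cdot> f = c \<star> (g \<cdot> f)"

definition is_zero_object :: "('o, 'm, 'x) cat_scheme \<Rightarrow> 'o \<Rightarrow> bool" where
  "is_zero_object C Z \<longleftrightarrow> Z \<in> Obj C \<and>
     (\<forall>X\<in>Obj C. (\<exists>!f. f \<in> Hom C Z X) \<and> (\<exists>!f. f \<in> Hom C X Z))"

text \<open>Finite direct sums (biproducts), given by inclusions and projections; the empty list gives the
  zero objects.\<close>

definition is_direct_sum :: "('o, 'm, 'x) linear_cat_scheme \<Rightarrow> 'o \<Rightarrow> 'o list \<Rightarrow> bool" where
  "is_direct_sum C V Xs \<longleftrightarrow> V \<in> Obj C \<and> set Xs \<subseteq> Obj C \<and>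
     (\<exists>\<iota> \<pi>. (\<forall>k<length Xs. \<iota> k \<in> Hom C (Xs ! k) V \<and> \<pi> k \<in> Hom C V (Xs ! k)) \<and>
       (\<forall>k<length Xs. \<forall>l<length Xs.
          \<pi> k \<cdot>\<^bsub>C\<^esub> \<iota> l = (if k = l then Ident C (Xs ! k) else ZeroArr C (Xs ! l) (Xs ! k))) \<and>
       finsum (Hom_space C V V) (\<lambda>k. \<iota> k \<cdot>\<^bsub>C\<^esub> \<pi> k) {..<length Xs} = Ident C V)"

definition is_kernel :: "('o, 'm, 'x) linear_cat_scheme \<Rightarrow> 'm \<Rightarrow> 'm \<Rightarrow> bool" where
  "is_kernel C f k \<longleftrightarrow> f \<in> Arr C \<and> k \<in> Arr C \<and> Cod C k = Dom C f \<and>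
     f \<cdot>\<^bsub>C\<^esub> k = ZeroArr C (Dom C k) (Cod C f) \<and>
     (\<forall>W. \<forall>h\<in>Hom C W (Dom C f). f \<cdot>\<^bsub>C\<^esub> h = ZeroArr C W (Cod C f) \<longrightarrow>
        (\<exists>!u. u \<in> Hom C W (Dom C k) \<and> k \<cdot>\<^bsub>C\<^esub> u = h))"

definition is_cokernel :: "('o, 'm, 'x) linear_cat_scheme \<Rightarrow> 'm \<Rightarrow> 'm \<Rightarrow> bool" where
  "is_cokernel C f q \<longleftrightarrow> f \<in> Arr C \<and> q \<in> Arr C \<and> Dom C q = Cod C f \<and>
     q \<cdot>\<^bsub>C\<^esub> f = ZeroArr C (Dom C f) (Cod C q) \<and>
     (\<forall>W. \<forall>h\<in>Hom C (Cod C f) W. h \<cdot>\<^bsub>C\<^esub> f = ZeroArr C (Dom C f) W \<longrightarrow>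
        (\<exists>!u. u \<in> Hom C (Cod C q) W \<and> u \<cdot>\<^bsub>C\<^esub> q = h))"

locale abelian_category = linear_category C for C :: "('o, 'm, 'x) linear_cat_scheme" (structure) +
  assumes zero_object: "\<exists>Z. is_zero_object C Z"
    and biproducts: "X \<in> Obj C \<Longrightarrow> Y \<in> Obj C \<Longrightarrow> \<exists>V. is_direct_sum C V [X, Y]"
    and kernels: "f \<in> Arr C \<Longrightarrow> \<exists>k. is_kernel C f k"
    and cokernels: "f \<in> Arr C \<Longrightarrow> \<exists>q. is_cokernel C f q"
    and mono_normal: "is_mono C f \<Longrightarrow> \<exists>g. is_kernel C g f"
    and epi_normal: "is_epi C f \<Longrightarrow> \<exists>g. is_cokernel C g f"

definition short_exact :: "('o, 'm, 'x) linear_cat_scheme \<Rightarrow> 'm \<Rightarrow> 'm \<Rightarrow> bool" where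
  "short_exact C f g \<longleftrightarrow> is_kernel C g f \<and> is_cokernel C f g"

section \<open>Rigid monoidal categories\<close>

text \<open>The tensor product of objects is written \<open>\<boxtimes>\<close>, that of arrows \<open>\<boxdot>\<close>.\<close>

record ('o, 'm) monoidal_cat = "('o, 'm) linear_cat" +
  TensorObj :: "'o \<Rightarrow> 'o \<Rightarrow> 'o" (infixl "\<boxtimes>\<index>" 75)
  TensorArr :: "'m \<Rightarrow> 'm \<Rightarrow> 'm" (infixl "\<boxdot>\<index>" 75)
  UnitObj :: 'o
  Assoc :: "'o \<Rightarrow> 'o \<Rightarrow> 'o \<Rightarrow> 'm"

locale monoidal_category = category C for C :: "('o, 'm, 'x) monoidal_cat_scheme" (structure) +
  assumes UnitObj_closed: "UnitObj C \<in> Obj C"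
    and TensorObj_closed: "V \<in> Obj C \<Longrightarrow> W \<in> Obj C \<Longrightarrow> V \<boxtimes> W \<in> Obj C"
    and TensorArr_Hom: "f \<in> Hom C V V' \<Longrightarrow> g \<in> Hom C W W' \<Longrightarrow> f \<boxdot> g \<in> Hom C (V \<boxtimes> W) (V' \<boxtimes> W')"
    and TensorArr_Ident: "V \<in> Obj C \<Longrightarrow> W \<in> Obj C \<Longrightarrow> Ident C V \<boxdot> Ident C W = Ident C (V \<boxtimes> W)"
    and TensorArr_Comp: "f \<in> Hom C V V' \<Longrightarrow> f' \<in> Hom C V' V'' \<Longrightarrow>
      g \<in> Hom C W W' \<Longrightarrow> g' \<in> Hom C W' W'' \<Longrightarrow> (f' \<cdot> f) \<boxdot> (g' \<cdot> g) = (f' \<boxdot> g') \<cdot> (f \<boxdot> g)"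
    and Assoc_Iso: "U \<in> Obj C \<Longrightarrow> V \<in> Obj C \<Longrightarrow> W \<in> Obj C \<Longrightarrow>
      Assoc C U V W \<in> Iso C ((U \<boxtimes> V) \<boxtimes> W) (U \<boxtimes> (V \<boxtimes> W))"
    and Assoc_natural: "f \<in> Hom C U U' \<Longrightarrow> g \<in> Hom C V V' \<Longrightarrow> h \<in> Hom C W W' \<Longrightarrow>
      Assoc C U' V' W' \<cdot> ((f \<boxdot> g) \<boxdot> h) = (f \<boxdot> (g \<boxdot> h)) \<cdot> Assoc C U V W"
    and pentagon: "U \<in> Obj C \<Longrightarrow> V \<in> Obj C \<Longrightarrow> W \<in> Obj C \<Longrightarrow> X \<in> Obj C \<Longrightarrow>
      Assoc C U V (W \<boxtimes> X) \<cdot> Assoc C (U \<boxtimes> V) W X =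
      (Ident C U \<boxdot> Assoc C V W X) \<cdot> Assoc C U (V \<boxtimes> W) X \<cdot> (Assoc C U V W \<boxdot> Ident C X)"
    and right_unit_strict: "V \<in> Obj C \<Longrightarrow> V \<boxtimes> UnitObj C = V"
    and left_unit_strict: "V \<in> Obj C \<Longrightarrow> UnitObj C \<boxtimes> V = V"
    and right_unit_strict_Arr: "f \<in> Arr C \<Longrightarrow> f \<boxdot> Ident C (UnitObj C) = f"
    and left_unit_strict_Arr: "f \<in> Arr C \<Longrightarrow> Ident C (UnitObj C) \<boxdot> f = f"
    and triangle: "V \<in> Obj C \<Longrightarrow> W \<in> Obj C \<Longrightarrow> Assoc C V (UnitObj C) W = Ident C (V \<boxtimes> W)"

definition is_left_dual ::
    "('o, 'm, 'x) monoidal_cat_scheme \<Rightarrow> 'o \<Rightarrow> 'o \<Rightarrow> 'm \<Rightarrow> 'm \<Rightarrow> bool" where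
  "is_left_dual C V V' ev db \<longleftrightarrow> V \<in> Obj C \<and> V' \<in> Obj C \<and>
     ev \<in> Hom C (V' \<boxtimes>\<^bsub>C\<^esub> V) (UnitObj C) \<and> db \<in> Hom C (UnitObj C) (V \<boxtimes>\<^bsub>C\<^esub> V') \<and>
     (Ident C V \<boxdot>\<^bsub>C\<^esub> ev) \<cdot>\<^bsub>C\<^esub> Assoc C V V' V \<cdot>\<^bsub>C\<^esub> (db \<boxdot>\<^bsub>C\<^esub> Ident C V) = Ident C V \<and>
     (ev \<boxdot>\<^bsub>C\<^esub> Ident C V') \<cdot>\<^bsub>C\<^esub> Inv C (Assoc C V' V V') \<cdot>\<^bsub>C\<^esub> (Ident C V' \<boxdot>\<^bsub>C\<^esub> db) = Ident C V'"

record ('o, 'm) rigid_cat = "('o, 'm) monoidal_cat" +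
  Dual :: "'o \<Rightarrow> 'o"
  Ev :: "'o \<Rightarrow> 'm"
  Db :: "'o \<Rightarrow> 'm"

locale rigid_category = monoidal_category C for C :: "('o, 'm, 'x) rigid_cat_scheme" (structure) +
  assumes left_dual: "V \<in> Obj C \<Longrightarrow> is_left_dual C V (Dual C V) (Ev C V) (Db C V)"
    and Dual_UnitObj: "Dual C (UnitObj C) = UnitObj C"

definition DualArr :: "('o, 'm, 'x) rigid_cat_scheme \<Rightarrow> 'm \<Rightarrow> 'm" where
  "DualArr C f = (THE g. g \<in> Hom C (Dual C (Cod C f)) (Dual C (Dom C f)) \<and>
     Ev C (Dom C f) \<cdot>\<^bsub>C\<^esub> (g \<boxdot>\<^bsub>C\<^esub> Ident C (Dom C f)) =
     Ev C (Cod C f) \<cdot>\<^bsub>C\<^esub> (Ident C (Dual C (Cod C f)) \<boxdot>\<^bsub>C\<^esub> f))"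

text \<open>The canonical isomorphism from the tensor product of the dual of \<^term>\<open>W\<close> and the dual of
  \<^term>\<open>V\<close> to the dual of the tensor product of \<^term>\<open>V\<close> and \<^term>\<open>W\<close>, determined by nested
  evaluation.\<close>

definition DualTensor :: "('o, 'm, 'x) rigid_cat_scheme \<Rightarrow> 'o \<Rightarrow> 'o \<Rightarrow> 'm" where
  "DualTensor C V W =
     (THE z. z \<in> Hom C (Dual C W \<boxtimes>\<^bsub>C\<^esub> Dual C V) (Dual C (V \<boxtimes>\<^bsub>C\<^esub> W)) \<and>
        Ev C (V \<boxtimes>\<^bsub>C\<^esub> W) \<cdot>\<^bsub>C\<^esub> (z \<boxdot>\<^bsub>C\<^esub> Ident C (V \<boxtimes>\<^bsub>C\<^esub> W)) =
        Ev C W \<cdot>\<^bsub>C\<^esub> (Ident C (Dual C W) \<boxdot>\<^bsub>C\<^esub>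
            ((Ev C V \<boxdot>\<^bsub>C\<^esub> Ident C W) \<cdot>\<^bsub>C\<^esub> Inv C (Assoc C (Dual C V) V W)))
          \<cdot>\<^bsub>C\<^esub> Assoc C (Dual C W) (Dual C V) (V \<boxtimes>\<^bsub>C\<^esub> W))"

text \<open>The monoidal structure of the double dual functor, with components
  \<open>V\<^sup>\<or>\<^sup>\<or> \<boxtimes> W\<^sup>\<or>\<^sup>\<or> \<rightarrow> (W\<^sup>\<or> \<boxtimes> V\<^sup>\<or>)\<^sup>\<or> \<rightarrow> (V \<boxtimes> W)\<^sup>\<or>\<^sup>\<or>\<close>.\<close>

definition DoubleDualTensor :: "('o, 'm, 'x) rigid_cat_scheme \<Rightarrow> 'o \<Rightarrow> 'o \<Rightarrow> 'm" where
  "DoubleDualTensor C V W =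
     DualArr C (Inv C (DualTensor C V W)) \<cdot>\<^bsub>C\<^esub> DualTensor C (Dual C W) (Dual C V)"

definition is_pivotal_structure :: "('o, 'm, 'x) rigid_cat_scheme \<Rightarrow> ('o \<Rightarrow> 'm) \<Rightarrow> bool" where
  "is_pivotal_structure C j \<longleftrightarrow>
     (\<forall>V\<in>Obj C. j V \<in> Iso C V (Dual C (Dual C V))) \<and>
     (\<forall>V W. \<forall>f\<in>Hom C V W. j W \<cdot>\<^bsub>C\<^esub> f = DualArr C (DualArr C f) \<cdot>\<^bsub>C\<^esub> j V) \<and>
     (\<forall>V\<in>Obj C. \<forall>W\<in>Obj C. j (V \<boxtimes>\<^bsub>C\<^esub> W) = DoubleDualTensor C V W \<cdot>\<^bsub>C\<^esub> (j V \<boxdot>\<^bsub>C\<^esub> j W)) \<and>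
     j (UnitObj C) = Ident C (UnitObj C)"

section \<open>Fusion categories\<close>

text \<open>Simple objects are those with endomorphism ring the complex numbers. This excludes the zero
  objects, since the scalar multiples of the identity are required to be distinct.\<close>

definition is_simple :: "('o, 'm, 'x) linear_cat_scheme \<Rightarrow> 'o \<Rightarrow> bool" where
  "is_simple C V \<longleftrightarrow> V \<in> Obj C \<and> bij_betw (\<lambda>c. c \<star>\<^bsub>C\<^esub> Ident C V) UNIV (Hom C V V)"

definition is_simple_reps :: "('o, 'm, 'x) linear_cat_scheme \<Rightarrow> 'o list \<Rightarrow> bool" where
  "is_simple_reps C Vs \<longleftrightarrow> (\<forall>V\<in>set Vs. is_simple C V) \<and>
     (\<forall>i<length Vs. \<forall>j<length Vs. i \<noteq> j \<longrightarrow> Iso C (Vs ! i) (Vs ! j) = {}) \<and>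
     (\<forall>V. is_simple C V \<longrightarrow> (\<exists>W\<in>set Vs. Iso C V W \<noteq> {}))"

text \<open>An object with endomorphism ring the complex numbers may have proper subobjects in a general
  abelian category, so that being a sum of such objects does not express semisimplicity. The
  assumption that monomorphisms split does.\<close>

locale fusion_category = abelian_category C + rigid_category C
  for C :: "('o, 'm, 'x) rigid_cat_scheme" (structure) +
  assumes Hom_fin_dim: "X \<in> Obj C \<Longrightarrow> Y \<in> Obj C \<Longrightarrow> vectorspace.fin_dim class_ring (Hom_space C X Y)"
    and Tensor_add_left: "f \<in> Hom C V V' \<Longrightarrow> f' \<in> Hom C V V' \<Longrightarrow> g \<in> Hom C W W' \<Longrightarrow>
      (f \<boxplus> f') \<boxdot> g = (f \<boxdot> g) \<boxplus> (f' \<boxdot> g)"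
    and Tensor_add_right: "f \<in> Hom C V V' \<Longrightarrow> g \<in> Hom C W W' \<Longrightarrow> g' \<in> Hom C W W' \<Longrightarrow>
      f \<boxdot> (g \<boxplus> g') = (f \<boxdot> g) \<boxplus> (f \<boxdot> g')"
    and Tensor_scale_left: "f \<in> Hom C V V' \<Longrightarrow> g \<in> Hom C W W' \<Longrightarrow> (c \<star> f) \<boxdot> g = c \<star> (f \<boxdot> g)"
    and Tensor_scale_right: "f \<in> Hom C V V' \<Longrightarrow> g \<in> Hom C W W' \<Longrightarrow> f \<boxdot> (c \<star> g) = c \<star> (f \<boxdot> g)"
    and monos_split: "is_mono C f \<Longrightarrow> \<exists>r\<in>Hom C (Cod C f) (Dom C f). r \<cdot> f = Ident C (Dom C f)"
    and sums_of_simples: "V \<in> Obj C \<Longrightarrow> \<exists>Ss. (\<forall>S\<in>set Ss. is_simple C S) \<and> is_direct_sum C V Ss"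
    and unit_simple: "is_simple C (UnitObj C)"
    and finitely_many_simples: "\<exists>Vs. is_simple_reps C Vs"

definition simple_reps :: "('o, 'm, 'x) linear_cat_scheme \<Rightarrow> 'o list" where
  "simple_reps C = (SOME Vs. is_simple_reps C Vs)"

text \<open>The Grothendieck group is written multiplicatively because HOL-Algebra quotient groups are: the
  group operation is the addition of classes, and integral multiples are powers.\<close>

definition K0_relations :: "('o, 'm, 'x) linear_cat_scheme \<Rightarrow> ('o \<Rightarrow>\<^sub>0 int) set" where
  "K0_relations C = generate (free_Abelian_group (Obj C))
     {frag_of (Cod C f) - frag_of (Dom C f) - frag_of (Cod C g) | f g. short_exact C f g}"

definition K0 :: "('o, 'm, 'x) linear_cat_scheme \<Rightarrow> ('o \<Rightarrow>\<^sub>0 int) set monoid" where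
  "K0 C = free_Abelian_group (Obj C) Mod K0_relations C"

definition K0_class :: "('o, 'm, 'x) linear_cat_scheme \<Rightarrow> 'o \<Rightarrow> ('o \<Rightarrow>\<^sub>0 int) set" where
  "K0_class C V = K0_relations C #>\<^bsub>free_Abelian_group (Obj C)\<^esub> frag_of V"

text \<open>The coefficients of \<open>[V][X]\<close> in the basis of classes of simple objects, where the product in
  the Grothendieck ring is given by \<open>[V][X] = [V \<boxtimes> X]\<close>.\<close>

definition fusion_coeff :: "('o, 'm, 'x) monoidal_cat_scheme \<Rightarrow> 'o \<Rightarrow> 'o \<Rightarrow> nat \<Rightarrow> int" where
  "fusion_coeff C V X = (THE n. n \<in> {..<length (simple_reps C)} \<rightarrow>\<^sub>E UNIV \<and>
     K0_class C (V \<boxtimes>\<^bsub>C\<^esub> X) =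
     finprod (K0 C) (\<lambda>k. K0_class C (simple_reps C ! k) [^]\<^bsub>K0 C\<^esub> n k) {..<length (simple_reps C)})"

definition fusion_matrix :: "('o, 'm, 'x) monoidal_cat_scheme \<Rightarrow> 'o \<Rightarrow> real mat" where
  "fusion_matrix C V = mat (length (simple_reps C)) (length (simple_reps C))
     (\<lambda>(i, k). of_int (fusion_coeff C V (simple_reps C ! i) k))"

definition FPdim :: "('o, 'm, 'x) monoidal_cat_scheme \<Rightarrow> 'o \<Rightarrow> real" where
  "FPdim C V = Max {r. 0 \<le> r \<and> eigenvalue (fusion_matrix C V) r}"

definition FPdim_cat :: "('o, 'm, 'x) monoidal_cat_scheme \<Rightarrow> real" where
  "FPdim_cat C = (\<Sum>V\<leftarrow>simple_reps C. (FPdim C V)\<^sup>2)"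

text \<open>The endomorphism ring of the unit object is identified with the complex numbers.\<close>

definition unit_scalar :: "('o, 'm, 'x) monoidal_cat_scheme \<Rightarrow> 'm \<Rightarrow> complex" where
  "unit_scalar C f = (THE c. f = c \<star>\<^bsub>C\<^esub> Ident C (UnitObj C))"

definition ptrace :: "('o, 'm, 'x) rigid_cat_scheme \<Rightarrow> 'o \<Rightarrow> 'm \<Rightarrow> complex" where
  "ptrace C V a = unit_scalar C
     (Ev C (Dual C V) \<cdot>\<^bsub>C\<^esub> (a \<boxdot>\<^bsub>C\<^esub> Ident C (Dual C V)) \<cdot>\<^bsub>C\<^esub> Db C V)"

text \<open>The squared norm of a simple object does not depend on the chosen isomorphism to the double
  dual.\<close>

definition squared_norm :: "('o, 'm, 'x) rigid_cat_scheme \<Rightarrow> 'o \<Rightarrow> complex" where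
  "squared_norm C V = (let a = (SOME a. a \<in> Iso C V (Dual C (Dual C V)))
     in ptrace C V a * ptrace C (Dual C V) (DualArr C (Inv C a)))"

definition global_dim :: "('o, 'm, 'x) rigid_cat_scheme \<Rightarrow> complex" where
  "global_dim C = (\<Sum>V\<leftarrow>simple_reps C. squared_norm C V)"

locale pseudo_unitary_fusion_category = fusion_category C
  for C :: "('o, 'm, 'x) rigid_cat_scheme" (structure) +
  assumes pseudo_unitary: "global_dim C = of_real (FPdim_cat C)"

definition is_canonical_pivotal_structure ::
    "('o, 'm, 'x) rigid_cat_scheme \<Rightarrow> ('o \<Rightarrow> 'm) \<Rightarrow> bool" where
  "is_canonical_pivotal_structure C j \<longleftrightarrow> is_pivotal_structure C j \<and>
     (\<forall>V. is_simple C V \<longrightarrow> ptrace C V (j V) = of_real (FPdim C V))"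

section \<open>Monoidal functors\<close>

record ('o, 'm, 'p, 'n) functor_data =
  FObj :: "'o \<Rightarrow> 'p"
  FArr :: "'m \<Rightarrow> 'n"

record ('o, 'm, 'p, 'n) monoidal_functor_data = "('o, 'm, 'p, 'n) functor_data" +
  FTensor :: "'o \<Rightarrow> 'o \<Rightarrow> 'n"

locale category_functor = source: category C + target: category D
  for C :: "('o, 'm, 'x) cat_scheme" and D :: "('p, 'n, 'y) cat_scheme" +
  fixes F :: "('o, 'm, 'p, 'n, 'z) functor_data_scheme"
  assumes FObj_closed: "X \<in> Obj C \<Longrightarrow> FObj F X \<in> Obj D"
    and FArr_Hom: "f \<in> Hom C X Y \<Longrightarrow> FArr F f \<in> Hom D (FObj F X) (FObj F Y)"
    and FArr_Ident: "X \<in> Obj C \<Longrightarrow> FArr F (Ident C X) = Ident D (FObj F X)"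
    and FArr_Comp: "f \<in> Hom C X Y \<Longrightarrow> g \<in> Hom C Y Z \<Longrightarrow>
      FArr F (g \<cdot>\<^bsub>C\<^esub> f) = FArr F g \<cdot>\<^bsub>D\<^esub> FArr F f"

definition id_functor :: "('o, 'm, 'o, 'm) functor_data" where
  "id_functor = \<lparr>FObj = (\<lambda>X. X), FArr = (\<lambda>f. f)\<rparr>"

definition comp_functor :: "('p, 'n, 'q, 'l, 'y) functor_data_scheme \<Rightarrow>
    ('o, 'm, 'p, 'n, 'z) functor_data_scheme \<Rightarrow> ('o, 'm, 'q, 'l) functor_data" where
  "comp_functor G F = \<lparr>FObj = (\<lambda>X. FObj G (FObj F X)), FArr = (\<lambda>f. FArr G (FArr F f))\<rparr>"

definition is_natural_iso :: "('o, 'm, 'x) cat_scheme \<Rightarrow> ('p, 'n, 'y) cat_scheme \<Rightarrow>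
    ('o, 'm, 'p, 'n, 'z) functor_data_scheme \<Rightarrow> ('o, 'm, 'p, 'n, 'w) functor_data_scheme \<Rightarrow>
    ('o \<Rightarrow> 'n) \<Rightarrow> bool" where
  "is_natural_iso C D F G \<tau> \<longleftrightarrow>
     (\<forall>X\<in>Obj C. \<tau> X \<in> Iso D (FObj F X) (FObj G X)) \<and>
     (\<forall>X Y. \<forall>f\<in>Hom C X Y. \<tau> Y \<cdot>\<^bsub>D\<^esub> FArr F f = FArr G f \<cdot>\<^bsub>D\<^esub> \<tau> X)"

definition is_equivalence :: "('o, 'm, 'x) cat_scheme \<Rightarrow> ('p, 'n, 'y) cat_scheme \<Rightarrow>
    ('o, 'm, 'p, 'n, 'z) functor_data_scheme \<Rightarrow> bool" where
  "is_equivalence C D F \<longleftrightarrow> category_functor C D F \<and>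
     (\<exists>(G :: ('p, 'n, 'o, 'm) functor_data) \<eta> \<epsilon>. category_functor D C G \<and>
        is_natural_iso C C id_functor (comp_functor G F) \<eta> \<and>
        is_natural_iso D D (comp_functor F G) id_functor \<epsilon>)"

locale linear_functor = category_functor C D F
  for C :: "('o, 'm, 'x) linear_cat_scheme" and D :: "('p, 'n, 'y) linear_cat_scheme"
    and F :: "('o, 'm, 'p, 'n, 'z) functor_data_scheme" +
  assumes FArr_add: "f \<in> Hom C X Y \<Longrightarrow> g \<in> Hom C X Y \<Longrightarrow>
      FArr F (f \<boxplus>\<^bsub>C\<^esub> g) = FArr F f \<boxplus>\<^bsub>D\<^esub> FArr F g"
    and FArr_scale: "f \<in> Hom C X Y \<Longrightarrow> FArr F (c \<star>\<^bsub>C\<^esub> f) = c \<star>\<^bsub>D\<^esub> FArr F f"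

locale monoidal_functor = category_functor C D F
  for C :: "('o, 'm, 'x) monoidal_cat_scheme" and D :: "('p, 'n, 'y) monoidal_cat_scheme"
    and F :: "('o, 'm, 'p, 'n, 'z) monoidal_functor_data_scheme" +
  assumes FTensor_Iso: "V \<in> Obj C \<Longrightarrow> W \<in> Obj C \<Longrightarrow>
      FTensor F V W \<in> Iso D (FObj F V \<boxtimes>\<^bsub>D\<^esub> FObj F W) (FObj F (V \<boxtimes>\<^bsub>C\<^esub> W))"
    and FTensor_natural: "f \<in> Hom C V V' \<Longrightarrow> g \<in> Hom C W W' \<Longrightarrow>
      FTensor F V' W' \<cdot>\<^bsub>D\<^esub> (FArr F f \<boxdot>\<^bsub>D\<^esub> FArr F g) = FArr F (f \<boxdot>\<^bsub>C\<^esub> g) \<cdot>\<^bsub>D\<^esub> FTensor F V W"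
    and FTensor_coherent: "U \<in> Obj C \<Longrightarrow> V \<in> Obj C \<Longrightarrow> W \<in> Obj C \<Longrightarrow>
      FArr F (Assoc C U V W) \<cdot>\<^bsub>D\<^esub> FTensor F (U \<boxtimes>\<^bsub>C\<^esub> V) W
        \<cdot>\<^bsub>D\<^esub> (FTensor F U V \<boxdot>\<^bsub>D\<^esub> Ident D (FObj F W)) =
      FTensor F U (V \<boxtimes>\<^bsub>C\<^esub> W) \<cdot>\<^bsub>D\<^esub> (Ident D (FObj F U) \<boxdot>\<^bsub>D\<^esub> FTensor F V W)
        \<cdot>\<^bsub>D\<^esub> Assoc D (FObj F U) (FObj F V) (FObj F W)"
    and FObj_UnitObj: "FObj F (UnitObj C) = UnitObj D"
    and FTensor_unit_right: "V \<in> Obj C \<Longrightarrow> FTensor F V (UnitObj C) = Ident D (FObj F V)"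
    and FTensor_unit_left: "V \<in> Obj C \<Longrightarrow> FTensor F (UnitObj C) V = Ident D (FObj F V)"

definition duality_transformation :: "('o, 'm, 'x) rigid_cat_scheme \<Rightarrow>
    ('p, 'n, 'y) rigid_cat_scheme \<Rightarrow> ('o, 'm, 'p, 'n, 'z) monoidal_functor_data_scheme \<Rightarrow>
    'o \<Rightarrow> 'n" where
  "duality_transformation C D F X =
     (THE t. t \<in> Hom D (FObj F (Dual C X)) (Dual D (FObj F X)) \<and>
        Ev D (FObj F X) \<cdot>\<^bsub>D\<^esub> (t \<boxdot>\<^bsub>D\<^esub> Ident D (FObj F X)) =
        FArr F (Ev C X) \<cdot>\<^bsub>D\<^esub> FTensor F (Dual C X) X)"

definition preserves_pivotal :: "('o, 'm, 'x) rigid_cat_scheme \<Rightarrow>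
    ('p, 'n, 'y) rigid_cat_scheme \<Rightarrow> ('o, 'm, 'p, 'n, 'z) monoidal_functor_data_scheme \<Rightarrow>
    ('o \<Rightarrow> 'm) \<Rightarrow> ('p \<Rightarrow> 'n) \<Rightarrow> bool" where
  "preserves_pivotal C D F j j' \<longleftrightarrow> (\<forall>X\<in>Obj C.
     duality_transformation C D F (Dual C X) \<cdot>\<^bsub>D\<^esub> FArr F (j X) =
     DualArr D (duality_transformation C D F X) \<cdot>\<^bsub>D\<^esub> j' (FObj F X))"

end

theory Submission
  imports Defs
begin

text \<open>Both sides of the condition that \<open>F\<close> preserves pivotal structures are arrows from \<open>F X\<close> to
  the dual of \<open>F(X\<^sup>\<or>)\<close>. By the universal property of duals they can be compared after transposing
  them into pairings of \<open>F X\<close> with \<open>F(X\<^sup>\<or>)\<close>. One pairing is the image under \<open>F\<close> of the pairing of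
  \<open>X\<close> with \<open>X\<^sup>\<or>\<close> that defines the pivotal trace; the other is the corresponding pairing of \<open>F X\<close> with
  its dual, pulled back along the duality transformation.

  Both pairings are dinatural in \<open>X\<close> (\<open>source_pairing_dinatural\<close>, \<open>target_pairing_dinatural\<close>), and the
  inclusions of the simple summands of an object are jointly epic. This reduces the claim to a
  simple object \<open>X\<close> (\<open>comparisons_agree\<close>). There the pairings lie in a one-dimensional space: \<open>F\<close> is
  fully faithful, and pairings of \<open>X\<close> with \<open>X\<^sup>\<or>\<close> correspond to arrows \<open>X \<rightarrow> X\<^sup>\<or>\<^sup>\<or>\<close>. Evaluated on the
  image of the coevaluation of \<open>X\<close> they become the pivotal traces of \<open>X\<close> and of \<open>F X\<close>, because the
  duality transformation respects coevaluations as well as evaluations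
  (\<open>duality_transformation_Db\<close>). The pivotal structures are canonical, so these traces are the
  Frobenius-Perron dimensions of \<open>X\<close> and of \<open>F X\<close>. It remains to see that the traces are nonzero and
  that \<open>F\<close> preserves Frobenius-Perron dimensions.

  The trace of a simple object is nonzero since its coevaluation is a nonzero arrow out of the
  simple unit object and therefore splits; the retraction is a multiple of the pairing that defines
  the trace (\<open>ptrace_simple_nonzero\<close>).

  Frobenius-Perron dimensions are eigenvalues of fusion matrices. The entries of a fusion matrix are
  coefficients in the Grothendieck group, and they equal dimensions of spaces of arrows
  \<open>V\<^sub>k \<rightarrow> V \<boxtimes> V\<^sub>i\<close> (\<open>fusion_coeff_eq_hdim\<close>): the dimension of \<open>Hom(V\<^sub>k, -)\<close> is additive on short exact
  sequences, which proves that the coefficients are unique, and splitting off simple subobjects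
  proves that they exist. An equivalence preserves dimensions of spaces of arrows and permutes the
  simple objects, so it conjugates fusion matrices by a permutation (\<open>FPdim_FObj\<close>).\<close>

section \<open>Categories\<close>

lemma HomD:
  assumes "f \<in> Hom C X Y"
  shows "f \<in> Arr C" "Dom C f = X" "Cod C f = Y"
  using assms by (auto simp: Hom_def)

lemma Hom_iff: "f \<in> Hom C X Y \<longleftrightarrow> f \<in> Arr C \<and> Dom C f = X \<and> Cod C f = Y"
  by (auto simp: Hom_def)

context category
begin

lemma Hom_objs: "f \<in> Hom C X Y \<Longrightarrow> X \<in> Obj C \<and> Y \<in> Obj C"
  using Dom_closed Cod_closed by (auto simp: Hom_iff)

declare Dom_closed [simp] Cod_closed [simp]

lemma Ident_arr [simp]:
  assumes "X \<in> Obj C"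
  shows "Ident C X \<in> Arr C" "Dom C (Ident C X) = X" "Cod C (Ident C X) = X"
  using Ident_Hom[OF assms] by (auto simp: Hom_iff)

lemma Comp_arr [simp]:
  assumes "f \<in> Arr C" "g \<in> Arr C" "Cod C f = Dom C g"
  shows "g \<cdot> f \<in> Arr C" "Dom C (g \<cdot> f) = Dom C f" "Cod C (g \<cdot> f) = Cod C g"
  using Comp_Hom[of f "Dom C f" "Dom C g" g "Cod C g"] assms by (auto simp: Hom_iff)

lemma Comp_Ident_arr [simp]: "f \<in> Arr C \<Longrightarrow> Dom C f = X \<Longrightarrow> f \<cdot> Ident C X = f"
  using Comp_Ident[of f X "Cod C f"] by (simp add: Hom_iff)

lemma Ident_Comp_arr [simp]: "f \<in> Arr C \<Longrightarrow> Cod C f = X \<Longrightarrow> Ident C X \<cdot> f = f"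
  using Ident_Comp[of f "Dom C f" X] by (simp add: Hom_iff)

lemma Comp_assoc_arr [simp]:
  "f \<in> Arr C \<Longrightarrow> g \<in> Arr C \<Longrightarrow> h \<in> Arr C \<Longrightarrow> Cod C f = Dom C g \<Longrightarrow> Cod C g = Dom C h \<Longrightarrow>
    (h \<cdot> g) \<cdot> f = h \<cdot> (g \<cdot> f)"
  using Comp_assoc[of f "Dom C f" "Dom C g" g "Dom C h" h "Cod C h"] by (simp add: Hom_iff)

lemma Iso_Hom: "f \<in> Iso C X Y \<Longrightarrow> f \<in> Hom C X Y"
  by (auto simp: Iso_def mutually_inverse_def)

lemma IsoI:
  "f \<in> Hom C X Y \<Longrightarrow> g \<in> Hom C Y X \<Longrightarrow> g \<cdot> f = Ident C X \<Longrightarrow> f \<cdot> g = Ident C Y \<Longrightarrow> f \<in> Iso C X Y"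
  by (auto simp: Iso_def mutually_inverse_def)

lemma mutually_inverse_unique:
  assumes "mutually_inverse C X Y f g" "mutually_inverse C X Y f h"
  shows "g = h"
proof -
  have [simp]: "f \<in> Arr C" "Dom C f = X" "Cod C f = Y" "g \<in> Arr C" "Dom C g = Y" "Cod C g = X"
    "h \<in> Arr C" "Dom C h = Y" "Cod C h = X"
    using assms by (auto simp: mutually_inverse_def Hom_iff)
  have "g = g \<cdot> (f \<cdot> h)" using assms by (simp add: mutually_inverse_def)
  also have "\<dots> = (g \<cdot> f) \<cdot> h" by simp
  also have "\<dots> = h" using assms by (simp add: mutually_inverse_def)
  finally show ?thesis .
qed

lemma Inv_mutually_inverse:
  assumes "f \<in> Iso C X Y"
  shows "mutually_inverse C X Y f (Inv C f)"
proof -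
  have f: "Dom C f = X" "Cod C f = Y" using Iso_Hom[OF assms] by (auto simp: Hom_iff)
  obtain g where g: "mutually_inverse C X Y f g" using assms by (auto simp: Iso_def)
  show ?thesis unfolding Inv_def f
    by (rule theI[of _ g]) (use g mutually_inverse_unique in blast)+
qed

lemma Inv_simps:
  assumes "f \<in> Iso C X Y"
  shows "f \<in> Arr C" "Dom C f = X" "Cod C f = Y"
    "Inv C f \<in> Arr C" "Dom C (Inv C f) = Y" "Cod C (Inv C f) = X"
    "Inv C f \<cdot> f = Ident C X" "f \<cdot> Inv C f = Ident C Y"
  using Inv_mutually_inverse[OF assms] by (auto simp: mutually_inverse_def Hom_iff)

lemma Inv_Iso: "f \<in> Iso C X Y \<Longrightarrow> Inv C f \<in> Iso C Y X"
  using Inv_mutually_inverse[of f X Y] by (auto simp: mutually_inverse_def Iso_def)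

lemma Inv_cancel:
  assumes "f \<in> Iso C X Y" "h \<in> Arr C"
  shows "Cod C h = X \<Longrightarrow> Inv C f \<cdot> (f \<cdot> h) = h"
    "Cod C h = Y \<Longrightarrow> f \<cdot> (Inv C f \<cdot> h) = h"
proof -
  note I = Inv_simps[OF assms(1)]
  have X: "X \<in> Obj C" "Y \<in> Obj C" using I by auto
  show "Inv C f \<cdot> (f \<cdot> h) = h" if "Cod C h = X"
    using Comp_assoc_arr[of h f "Inv C f"] I assms(2) that X by auto
  show "f \<cdot> (Inv C f \<cdot> h) = h" if "Cod C h = Y"
    using Comp_assoc_arr[of h "Inv C f" f] I assms(2) that X by auto
qed

lemma Comp_Iso:
  assumes "f \<in> Iso C X Y" "g \<in> Iso C Y Z"
  shows "g \<cdot> f \<in> Iso C X Z"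
proof (rule IsoI)
  note [simp] = Inv_simps[OF assms(1)] Inv_simps[OF assms(2)]
  have [simp]: "X \<in> Obj C" "Y \<in> Obj C" "Z \<in> Obj C"
    using Hom_objs[OF Iso_Hom[OF assms(1)]] Hom_objs[OF Iso_Hom[OF assms(2)]] by auto
  show "g \<cdot> f \<in> Hom C X Z" "Inv C f \<cdot> Inv C g \<in> Hom C Z X" by (auto simp: Hom_iff)
  show "Inv C f \<cdot> Inv C g \<cdot> (g \<cdot> f) = Ident C X" "g \<cdot> f \<cdot> (Inv C f \<cdot> Inv C g) = Ident C Z"
    by (simp_all add: Inv_cancel[OF assms(1)] Inv_cancel[OF assms(2)])
qed

lemma Iso_mono:
  assumes "f \<in> Iso C X Y" "g \<in> Hom C W X" "h \<in> Hom C W X" "f \<cdot> g = f \<cdot> h"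
  shows "g = h"
proof -
  have "g = Inv C f \<cdot> (f \<cdot> g)" using Inv_cancel(1)[OF assms(1)] HomD[OF assms(2)] by metis
  also have "\<dots> = h" using Inv_cancel(1)[OF assms(1)] HomD[OF assms(3)] assms(4) by metis
  finally show ?thesis .
qed

lemma Iso_epi:
  assumes "f \<in> Iso C X Y" "g \<in> Hom C Y W" "h \<in> Hom C Y W" "g \<cdot> f = h \<cdot> f"
  shows "g = h"
proof -
  note [simp] = Inv_simps[OF assms(1)] HomD[OF assms(2)] HomD[OF assms(3)]
  have "g \<cdot> f \<cdot> Inv C f = h \<cdot> f \<cdot> Inv C f" by (simp only: assms(4))
  then show ?thesis by simp
qed

end

section \<open>Monoidal categories\<close>

context monoidal_category
begin

declare UnitObj_closed [simp] TensorObj_closed [simp] right_unit_strict [simp] left_unit_strict [simp]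

lemma TensorArr_arr [simp]:
  assumes "f \<in> Arr C" "g \<in> Arr C"
  shows "f \<boxdot> g \<in> Arr C" "Dom C (f \<boxdot> g) = Dom C f \<boxtimes> Dom C g" "Cod C (f \<boxdot> g) = Cod C f \<boxtimes> Cod C g"
  using TensorArr_Hom[of f "Dom C f" "Cod C f" g "Dom C g" "Cod C g"] assms by (auto simp: Hom_iff)

declare TensorArr_Ident [simp]

lemma interchange:
  "f \<in> Arr C \<Longrightarrow> f' \<in> Arr C \<Longrightarrow> g \<in> Arr C \<Longrightarrow> g' \<in> Arr C \<Longrightarrow> Cod C f = Dom C f' \<Longrightarrow> Cod C g = Dom C g' \<Longrightarrow>
    (f' \<boxdot> g') \<cdot> (f \<boxdot> g) = (f' \<cdot> f) \<boxdot> (g' \<cdot> g)"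
  using TensorArr_Comp[of f "Dom C f" "Dom C f'" f' "Cod C f'" g "Dom C g" "Dom C g'" g' "Cod C g'"]
  by (simp add: Hom_iff)

lemma interchange_assoc:
  assumes "f \<in> Arr C" "f' \<in> Arr C" "g \<in> Arr C" "g' \<in> Arr C" "Cod C f = Dom C f'" "Cod C g = Dom C g'"
    "h \<in> Arr C" "Cod C h = Dom C f \<boxtimes> Dom C g"
  shows "(f' \<boxdot> g') \<cdot> ((f \<boxdot> g) \<cdot> h) = ((f' \<cdot> f) \<boxdot> (g' \<cdot> g)) \<cdot> h"
proof -
  have "(f' \<boxdot> g') \<cdot> ((f \<boxdot> g) \<cdot> h) = ((f' \<boxdot> g') \<cdot> (f \<boxdot> g)) \<cdot> h" using assms by simp
  then show ?thesis using assms by (simp add: interchange)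
qed

lemma Assoc_arr [simp]:
  assumes "U \<in> Obj C" "V \<in> Obj C" "W \<in> Obj C"
  shows "Assoc C U V W \<in> Arr C" "Dom C (Assoc C U V W) = (U \<boxtimes> V) \<boxtimes> W"
    "Cod C (Assoc C U V W) = U \<boxtimes> (V \<boxtimes> W)"
    "Inv C (Assoc C U V W) \<in> Arr C" "Dom C (Inv C (Assoc C U V W)) = U \<boxtimes> (V \<boxtimes> W)"
    "Cod C (Inv C (Assoc C U V W)) = (U \<boxtimes> V) \<boxtimes> W"
    "Assoc C U V W \<cdot> Inv C (Assoc C U V W) = Ident C (U \<boxtimes> (V \<boxtimes> W))"
    "Inv C (Assoc C U V W) \<cdot> Assoc C U V W = Ident C ((U \<boxtimes> V) \<boxtimes> W)"
  using Inv_simps[OF Assoc_Iso[OF assms]] by auto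

lemma Assoc_cancel [simp]:
  assumes "U \<in> Obj C" "V \<in> Obj C" "W \<in> Obj C" "h \<in> Arr C"
  shows "Cod C h = U \<boxtimes> (V \<boxtimes> W) \<Longrightarrow> Assoc C U V W \<cdot> (Inv C (Assoc C U V W) \<cdot> h) = h"
    "Cod C h = (U \<boxtimes> V) \<boxtimes> W \<Longrightarrow> Inv C (Assoc C U V W) \<cdot> (Assoc C U V W \<cdot> h) = h"
  using Inv_cancel[OF Assoc_Iso[OF assms(1-3)] assms(4)] by auto

lemma Assoc_nat:
  "f \<in> Arr C \<Longrightarrow> g \<in> Arr C \<Longrightarrow> h \<in> Arr C \<Longrightarrow>
    Assoc C (Cod C f) (Cod C g) (Cod C h) \<cdot> ((f \<boxdot> g) \<boxdot> h) =
    (f \<boxdot> (g \<boxdot> h)) \<cdot> Assoc C (Dom C f) (Dom C g) (Dom C h)"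
  using Assoc_natural[of f "Dom C f" "Cod C f" g "Dom C g" "Cod C g" h "Dom C h" "Cod C h"]
  by (simp add: Hom_iff)

lemma Inv_Assoc_nat:
  assumes "f \<in> Arr C" "g \<in> Arr C" "h \<in> Arr C"
  shows "((f \<boxdot> g) \<boxdot> h) \<cdot> Inv C (Assoc C (Dom C f) (Dom C g) (Dom C h)) =
    Inv C (Assoc C (Cod C f) (Cod C g) (Cod C h)) \<cdot> (f \<boxdot> (g \<boxdot> h))" (is "?l = ?r")
proof (rule Iso_mono)
  let ?a = "Assoc C (Cod C f) (Cod C g) (Cod C h)" and ?b = "Assoc C (Dom C f) (Dom C g) (Dom C h)"
  let ?X = "Dom C f \<boxtimes> (Dom C g \<boxtimes> Dom C h)"
  show "?a \<in> Iso C ((Cod C f \<boxtimes> Cod C g) \<boxtimes> Cod C h) (Cod C f \<boxtimes> (Cod C g \<boxtimes> Cod C h))"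
    using assms by (intro Assoc_Iso) auto
  show "?l \<in> Hom C ?X ((Cod C f \<boxtimes> Cod C g) \<boxtimes> Cod C h)"
    "?r \<in> Hom C ?X ((Cod C f \<boxtimes> Cod C g) \<boxtimes> Cod C h)"
    using assms by (simp_all add: Hom_iff)
  have "?a \<cdot> ?l = (?a \<cdot> ((f \<boxdot> g) \<boxdot> h)) \<cdot> Inv C ?b"
    using assms by simp
  also have "\<dots> = ((f \<boxdot> (g \<boxdot> h)) \<cdot> ?b) \<cdot> Inv C ?b"
    using assms by (simp only: Assoc_nat)
  also have "\<dots> = f \<boxdot> (g \<boxdot> h)" using assms by simp
  also have "\<dots> = ?a \<cdot> ?r" using assms by simp
  finally show "?a \<cdot> ?l = ?a \<cdot> ?r" .
qed

text \<open>The pentagon with two adjacent units makes this associator idempotent; being invertible,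
  it is the identity.\<close>

lemma Assoc_unit_left:
  assumes "V \<in> Obj C" "W \<in> Obj C"
  shows "Assoc C (UnitObj C) V W = Ident C (V \<boxtimes> W)"
proof -
  let ?a = "Assoc C (UnitObj C) V W"
  have a: "?a \<in> Iso C (V \<boxtimes> W) (V \<boxtimes> W)" using Assoc_Iso[of "UnitObj C" V W] assms by simp
  have "?a = ?a \<cdot> ?a"
    using pentagon[of "UnitObj C" "UnitObj C" V W] assms
    by (simp add: triangle left_unit_strict_Arr)
  then show ?thesis using Iso_mono[OF a, of "Ident C (V \<boxtimes> W)" _ ?a] assms by (simp add: Hom_iff)
qed

lemma Assoc_unit_right:
  assumes "V \<in> Obj C" "W \<in> Obj C"
  shows "Assoc C V W (UnitObj C) = Ident C (V \<boxtimes> W)"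
proof -
  let ?a = "Assoc C V W (UnitObj C)"
  have a: "?a \<in> Iso C (V \<boxtimes> W) (V \<boxtimes> W)" using Assoc_Iso[of V W "UnitObj C"] assms by simp
  have "?a = ?a \<cdot> ?a"
    using pentagon[of V W "UnitObj C" "UnitObj C"] assms
    by (simp add: triangle right_unit_strict_Arr)
  then show ?thesis using Iso_mono[OF a, of "Ident C (V \<boxtimes> W)" _ ?a] assms by (simp add: Hom_iff)
qed

end

section \<open>Duals and evaluation\<close>

context monoidal_category
begin

lemma is_left_dual_simps:
  assumes "is_left_dual C V V' ev db"
  shows "V \<in> Obj C" "V' \<in> Obj C" "ev \<in> Arr C" "Dom C ev = V' \<boxtimes> V" "Cod C ev = UnitObj C"
    "db \<in> Arr C" "Dom C db = UnitObj C" "Cod C db = V \<boxtimes> V'"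
  using assms by (auto simp: is_left_dual_def Hom_iff)

lemma Ident_unit_TensorArr: "f \<in> Arr C \<Longrightarrow> Ident C (UnitObj C) \<boxdot> f = f"
  "f \<in> Arr C \<Longrightarrow> f \<boxdot> Ident C (UnitObj C) = f"
  by (simp_all add: left_unit_strict_Arr right_unit_strict_Arr)

text \<open>The second snake identity recovers an arrow into a dual from the pairing that it
  induces: the right-hand side is the inverse of transposition, applied to the pairing of
  \<open>t\<close>.\<close>

lemma pairing_transpose_unique:
  assumes dual: "is_left_dual C V V' ev db" and t: "t \<in> Hom C A V'"
  shows "t = ((ev \<cdot> (t \<boxdot> Ident C V)) \<boxdot> Ident C V') \<cdot> (Inv C (Assoc C A V V') \<cdot> (Ident C A \<boxdot> db))"
proof -
  note [simp] = is_left_dual_simps[OF dual] HomD[OF t]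
  have [simp]: "A \<in> Obj C" using Hom_objs[OF t] by simp
  have n: "((t \<boxdot> Ident C V) \<boxdot> Ident C V') \<cdot> Inv C (Assoc C A V V') =
      Inv C (Assoc C V' V V') \<cdot> (t \<boxdot> Ident C (V \<boxtimes> V'))"
    using Inv_Assoc_nat[of t "Ident C V" "Ident C V'"] by simp
  have "((ev \<cdot> (t \<boxdot> Ident C V)) \<boxdot> Ident C V') \<cdot> (Inv C (Assoc C A V V') \<cdot> (Ident C A \<boxdot> db)) =
      (ev \<boxdot> Ident C V') \<cdot> ((((t \<boxdot> Ident C V) \<boxdot> Ident C V') \<cdot> Inv C (Assoc C A V V')) \<cdot> (Ident C A \<boxdot> db))"
    by (simp add: interchange_assoc)
  also have "\<dots> = (ev \<boxdot> Ident C V') \<cdot> (Inv C (Assoc C V' V V') \<cdot> ((t \<boxdot> Ident C (V \<boxtimes> V')) \<cdot> (Ident C A \<boxdot> db)))"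
    unfolding n by simp
  also have "(t \<boxdot> Ident C (V \<boxtimes> V')) \<cdot> (Ident C A \<boxdot> db) = (Ident C V' \<boxdot> db) \<cdot> (t \<boxdot> Ident C (UnitObj C))"
    by (simp add: interchange)
  also have "\<dots> = (Ident C V' \<boxdot> db) \<cdot> t" by (simp add: Ident_unit_TensorArr)
  also have "(ev \<boxdot> Ident C V') \<cdot> (Inv C (Assoc C V' V V') \<cdot> ((Ident C V' \<boxdot> db) \<cdot> t)) =
     ((ev \<boxdot> Ident C V') \<cdot> Inv C (Assoc C V' V V') \<cdot> (Ident C V' \<boxdot> db)) \<cdot> t" by simp
  also have "\<dots> = t" using dual by (simp add: is_left_dual_def del: Comp_assoc_arr)
  finally show ?thesis by simp
qed

text \<open>The formula of the previous lemma defines a preimage of \<open>f\<close>: the pentagon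
  moves \<open>A\<close> out of the way, and what remains next to it is the first snake
  identity.\<close>

lemma pairing_transpose_exists:
  assumes dual: "is_left_dual C V V' ev db" and f: "f \<in> Hom C (A \<boxtimes> V) (UnitObj C)" and A [simp]: "A \<in> Obj C"
  shows "\<exists>t\<in>Hom C A V'. ev \<cdot> (t \<boxdot> Ident C V) = f"
proof
  note [simp] = is_left_dual_simps[OF dual] HomD[OF f]
  let ?a = "Assoc C A V V'"
  let ?t = "(f \<boxdot> Ident C V') \<cdot> (Inv C ?a \<cdot> (Ident C A \<boxdot> db))"
  show "?t \<in> Hom C A V'" by (simp add: Hom_iff)
  have 1: "?t \<boxdot> Ident C V =
      ((f \<boxdot> Ident C V') \<boxdot> Ident C V) \<cdot> ((Inv C ?a \<boxdot> Ident C V) \<cdot> ((Ident C A \<boxdot> db) \<boxdot> Ident C V))"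
    by (simp add: interchange)
  have 2: "ev \<cdot> ((f \<boxdot> Ident C V') \<boxdot> Ident C V) = (f \<boxdot> ev) \<cdot> Assoc C (A \<boxtimes> V) V' V"
  proof -
    have "ev \<cdot> ((f \<boxdot> Ident C V') \<boxdot> Ident C V) = ev \<cdot> (Assoc C (UnitObj C) V' V \<cdot> ((f \<boxdot> Ident C V') \<boxdot> Ident C V))"
      by (simp add: Assoc_unit_left)
    also have "\<dots> = (Ident C (UnitObj C) \<boxdot> ev) \<cdot> ((f \<boxdot> Ident C (V' \<boxtimes> V)) \<cdot> Assoc C (A \<boxtimes> V) V' V)"
      using Assoc_nat[of f "Ident C V'" "Ident C V"] by (simp add: Ident_unit_TensorArr)
    also have "\<dots> = (f \<boxdot> ev) \<cdot> Assoc C (A \<boxtimes> V) V' V"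
      by (simp add: interchange_assoc)
    finally show ?thesis .
  qed
  have 3: "Assoc C (A \<boxtimes> V) V' V \<cdot> (Inv C ?a \<boxdot> Ident C V) =
      Inv C (Assoc C A V (V' \<boxtimes> V)) \<cdot> ((Ident C A \<boxdot> Assoc C V V' V) \<cdot> Assoc C A (V \<boxtimes> V') V)" (is "?l = ?r")
  proof -
    have "?l = Inv C (Assoc C A V (V' \<boxtimes> V)) \<cdot> ((Assoc C A V (V' \<boxtimes> V) \<cdot> Assoc C (A \<boxtimes> V) V' V) \<cdot> (Inv C ?a \<boxdot> Ident C V))"
      by simp
    also have "\<dots> = Inv C (Assoc C A V (V' \<boxtimes> V)) \<cdot> (((Ident C A \<boxdot> Assoc C V V' V) \<cdot> Assoc C A (V \<boxtimes> V') V) \<cdot>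
        ((?a \<boxdot> Ident C V) \<cdot> (Inv C ?a \<boxdot> Ident C V)))"
      using pentagon[of A V V' V] by simp
    also have "\<dots> = ?r" by (simp add: interchange)
    finally show ?thesis .
  qed
  have 4: "Assoc C A (V \<boxtimes> V') V \<cdot> ((Ident C A \<boxdot> db) \<boxdot> Ident C V) = Ident C A \<boxdot> (db \<boxdot> Ident C V)"
    using Assoc_nat[of "Ident C A" db "Ident C V"] by (simp add: triangle)
  have 5: "(f \<boxdot> ev) \<cdot> Inv C (Assoc C A V (V' \<boxtimes> V)) = f \<cdot> (Ident C A \<boxdot> (Ident C V \<boxdot> ev))"
  proof -
    have "(f \<boxdot> ev) \<cdot> Inv C (Assoc C A V (V' \<boxtimes> V)) =
        (f \<boxdot> Ident C (UnitObj C)) \<cdot> ((Ident C (A \<boxtimes> V) \<boxdot> ev) \<cdot> Inv C (Assoc C A V (V' \<boxtimes> V)))"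
      by (simp add: interchange_assoc)
    also have "(Ident C (A \<boxtimes> V) \<boxdot> ev) \<cdot> Inv C (Assoc C A V (V' \<boxtimes> V)) =
        Inv C (Assoc C A V (UnitObj C)) \<cdot> (Ident C A \<boxdot> (Ident C V \<boxdot> ev))"
      using Inv_Assoc_nat[of "Ident C A" "Ident C V" ev] by simp
    also have "\<dots> = Ident C A \<boxdot> (Ident C V \<boxdot> ev)"
      using Assoc_cancel(2)[of A V "UnitObj C" "Ident C A \<boxdot> (Ident C V \<boxdot> ev)"] by (simp add: Assoc_unit_right)
    finally show ?thesis by (simp add: Ident_unit_TensorArr)
  qed
  have "ev \<cdot> (?t \<boxdot> Ident C V) =
     (ev \<cdot> ((f \<boxdot> Ident C V') \<boxdot> Ident C V)) \<cdot> ((Inv C ?a \<boxdot> Ident C V) \<cdot> ((Ident C A \<boxdot> db) \<boxdot> Ident C V))"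
    unfolding 1 by simp
  also have "\<dots> = (f \<boxdot> ev) \<cdot> ((Assoc C (A \<boxtimes> V) V' V \<cdot> (Inv C ?a \<boxdot> Ident C V)) \<cdot> ((Ident C A \<boxdot> db) \<boxdot> Ident C V))"
    unfolding 2 by simp
  also have "\<dots> = ((f \<boxdot> ev) \<cdot> Inv C (Assoc C A V (V' \<boxtimes> V))) \<cdot> ((Ident C A \<boxdot> Assoc C V V' V) \<cdot>
      (Assoc C A (V \<boxtimes> V') V \<cdot> ((Ident C A \<boxdot> db) \<boxdot> Ident C V)))"
    unfolding 3 by simp
  also have "\<dots> = f \<cdot> (Ident C A \<boxdot> ((Ident C V \<boxdot> ev) \<cdot> Assoc C V V' V \<cdot> (db \<boxdot> Ident C V)))"
    unfolding 4 5 by (simp add: interchange)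
  also have "\<dots> = f" using dual by (simp add: is_left_dual_def del: Comp_assoc_arr)
  finally show "ev \<cdot> (?t \<boxdot> Ident C V) = f" .
qed

lemma pairing_transpose_ex1:
  assumes "is_left_dual C V V' ev db" "f \<in> Hom C (A \<boxtimes> V) (UnitObj C)" "A \<in> Obj C"
  shows "\<exists>!t. t \<in> Hom C A V' \<and> ev \<cdot> (t \<boxdot> Ident C V) = f"
  using pairing_transpose_exists[OF assms] pairing_transpose_unique[OF assms(1)] by metis

lemma pairing_cancel:
  assumes "is_left_dual C V V' ev db" "s \<in> Hom C A V'" "t \<in> Hom C A V'"
    "ev \<cdot> (s \<boxdot> Ident C V) = ev \<cdot> (t \<boxdot> Ident C V)"
  shows "s = t"
  using pairing_transpose_unique[OF assms(1,2)] pairing_transpose_unique[OF assms(1,3)] assms(4) by metis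

text \<open>A comparison of two duals of \<open>V\<close> that respects the evaluations also
  respects the coevaluations: by uniqueness it is the transpose of \<open>e\<close>, and the
  pentagon then brings together \<open>d\<close> and \<open>e\<close> in the snake identity of
  \<open>A\<close>.\<close>

lemma copairing_transport:
  assumes dual: "is_left_dual C V V' ev db" and t: "t \<in> Hom C A V'"
    and e: "ev \<cdot> (t \<boxdot> Ident C V) = e" and d: "d \<in> Hom C (UnitObj C) (V \<boxtimes> A)"
    and snake: "(Ident C V \<boxdot> e) \<cdot> Assoc C V A V \<cdot> (d \<boxdot> Ident C V) = Ident C V"
  shows "(Ident C V \<boxdot> t) \<cdot> d = db"
proof -
  note [simp] = is_left_dual_simps[OF dual] HomD[OF t] HomD[OF d]
  have A [simp]: "A \<in> Obj C" using Hom_objs[OF t] by simp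
  have [simp]: "e \<in> Arr C" "Dom C e = A \<boxtimes> V" "Cod C e = UnitObj C" using e by auto
  have t_eq: "t = (e \<boxdot> Ident C V') \<cdot> (Inv C (Assoc C A V V') \<cdot> (Ident C A \<boxdot> db))"
    using pairing_transpose_unique[OF dual t] e by simp
  have 1: "(Ident C V \<boxdot> (Ident C A \<boxdot> db)) \<cdot> d = Assoc C V A (V \<boxtimes> V') \<cdot> ((d \<boxdot> Ident C (V \<boxtimes> V')) \<cdot> db)"
  proof -
    have "(Ident C V \<boxdot> (Ident C A \<boxdot> db)) \<cdot> d = Assoc C V A (V \<boxtimes> V') \<cdot> ((Ident C (V \<boxtimes> A) \<boxdot> db) \<cdot> d)"
      using Assoc_nat[of "Ident C V" "Ident C A" db] by (simp add: Assoc_unit_right flip: Comp_assoc_arr)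
    also have "(Ident C (V \<boxtimes> A) \<boxdot> db) \<cdot> d = (Ident C (V \<boxtimes> A) \<boxdot> db) \<cdot> (d \<boxdot> Ident C (UnitObj C))"
      by (simp add: Ident_unit_TensorArr)
    also have "\<dots> = (d \<boxdot> Ident C (V \<boxtimes> V')) \<cdot> (Ident C (UnitObj C) \<boxdot> db)"
      by (simp add: interchange)
    finally show ?thesis by (simp add: Ident_unit_TensorArr)
  qed
  have 2: "(Ident C V \<boxdot> Inv C (Assoc C A V V')) \<cdot> Assoc C V A (V \<boxtimes> V') =
     Assoc C V (A \<boxtimes> V) V' \<cdot> ((Assoc C V A V \<boxdot> Ident C V') \<cdot> Inv C (Assoc C (V \<boxtimes> A) V V'))" (is "?l = ?r")
  proof -
    have "?l = (Ident C V \<boxdot> Inv C (Assoc C A V V')) \<cdot> ((Assoc C V A (V \<boxtimes> V') \<cdot> Assoc C (V \<boxtimes> A) V V') \<cdot> Inv C (Assoc C (V \<boxtimes> A) V V'))"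
      by simp
    also have "\<dots> = (Ident C V \<boxdot> Inv C (Assoc C A V V')) \<cdot> ((Ident C V \<boxdot> Assoc C A V V') \<cdot> ?r)"
      using pentagon[of V A V V'] by simp
    also have "\<dots> = ?r" by (simp add: interchange_assoc)
    finally show ?thesis .
  qed
  have 3: "Inv C (Assoc C (V \<boxtimes> A) V V') \<cdot> (d \<boxdot> Ident C (V \<boxtimes> V')) = (d \<boxdot> Ident C V) \<boxdot> Ident C V'"
    using Inv_Assoc_nat[of d "Ident C V" "Ident C V'"] Assoc_arr(4-8)[of "UnitObj C" V V']
    by (simp add: Assoc_unit_left)
  have 4: "(Ident C V \<boxdot> (e \<boxdot> Ident C V')) \<cdot> Assoc C V (A \<boxtimes> V) V' = (Ident C V \<boxdot> e) \<boxdot> Ident C V'"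
    using Assoc_nat[of "Ident C V" e "Ident C V'"] by (simp add: triangle)
  have "(Ident C V \<boxdot> t) \<cdot> d = (Ident C V \<boxdot> (e \<boxdot> Ident C V')) \<cdot> ((Ident C V \<boxdot> Inv C (Assoc C A V V')) \<cdot> 
      ((Ident C V \<boxdot> (Ident C A \<boxdot> db)) \<cdot> d))"
    by (subst t_eq) (simp add: interchange_assoc)
  also have "\<dots> = (Ident C V \<boxdot> (e \<boxdot> Ident C V')) \<cdot> (((Ident C V \<boxdot> Inv C (Assoc C A V V')) \<cdot> 
      Assoc C V A (V \<boxtimes> V')) \<cdot> ((d \<boxdot> Ident C (V \<boxtimes> V')) \<cdot> db))"
    unfolding 1 by simp
  also have "\<dots> = ((Ident C V \<boxdot> (e \<boxdot> Ident C V')) \<cdot> Assoc C V (A \<boxtimes> V) V') \<cdot> ((Assoc C V A V \<boxdot> Ident C V') \<cdot>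
     ((Inv C (Assoc C (V \<boxtimes> A) V V') \<cdot> (d \<boxdot> Ident C (V \<boxtimes> V'))) \<cdot> db))"
    unfolding 2 by simp
  also have "\<dots> = (((Ident C V \<boxdot> e) \<cdot> Assoc C V A V \<cdot> (d \<boxdot> Ident C V)) \<boxdot> Ident C V') \<cdot> db"
    unfolding 3 4 by (simp add: interchange_assoc)
  also have "\<dots> = db" unfolding snake by simp
  finally show ?thesis .
qed

end

context rigid_category
begin

lemma Dual_closed [simp]: "V \<in> Obj C \<Longrightarrow> Dual C V \<in> Obj C"
  using left_dual by (auto simp: is_left_dual_def)

lemma Ev_Db_arr [simp]:
  assumes "V \<in> Obj C"
  shows "Ev C V \<in> Arr C" "Dom C (Ev C V) = Dual C V \<boxtimes> V" "Cod C (Ev C V) = UnitObj C"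
    "Db C V \<in> Arr C" "Dom C (Db C V) = UnitObj C" "Cod C (Db C V) = V \<boxtimes> Dual C V"
  using is_left_dual_simps[OF left_dual[OF assms]] by auto

lemma DualArr_props:
  assumes f: "f \<in> Hom C V W"
  shows "DualArr C f \<in> Hom C (Dual C W) (Dual C V)"
    "Ev C V \<cdot> (DualArr C f \<boxdot> Ident C V) = Ev C W \<cdot> (Ident C (Dual C W) \<boxdot> f)"
proof -
  note [simp] = HomD[OF f]
  have [simp]: "V \<in> Obj C" "W \<in> Obj C" using Hom_objs[OF f] by auto
  have "\<exists>!g. g \<in> Hom C (Dual C W) (Dual C V) \<and>
      Ev C V \<cdot> (g \<boxdot> Ident C V) = Ev C W \<cdot> (Ident C (Dual C W) \<boxdot> f)"
    by (rule pairing_transpose_ex1[OF left_dual]) (simp_all add: Hom_iff)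
  from theI'[OF this] show "DualArr C f \<in> Hom C (Dual C W) (Dual C V)"
    "Ev C V \<cdot> (DualArr C f \<boxdot> Ident C V) = Ev C W \<cdot> (Ident C (Dual C W) \<boxdot> f)"
    by (simp_all add: DualArr_def)
qed

end

section \<open>Linear structure on arrows\<close>

lemma Hom_space_simps [simp]:
  "carrier (Hom_space C X Y) = Hom C X Y"
  "\<zero>\<^bsub>Hom_space C X Y\<^esub> = ZeroArr C X Y"
  "f \<oplus>\<^bsub>Hom_space C X Y\<^esub> g = f \<boxplus>\<^bsub>C\<^esub> g"
  "c \<odot>\<^bsub>Hom_space C X Y\<^esub> f = c \<star>\<^bsub>C\<^esub> f"
  by (simp_all add: Hom_space_def)

context linear_category
begin

lemma Hom_space_module: "X \<in> Obj C \<Longrightarrow> Y \<in> Obj C \<Longrightarrow> Module.module class_ring (Hom_space C X Y)"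
  using Hom_vectorspace vectorspace_def by blast

lemma Hom_space_abelian_group: "X \<in> Obj C \<Longrightarrow> Y \<in> Obj C \<Longrightarrow> abelian_group (Hom_space C X Y)"
  using Hom_space_module Module.module_def by blast

lemma ZeroArr_arr [simp]:
  assumes "X \<in> Obj C" "Y \<in> Obj C"
  shows "ZeroArr C X Y \<in> Arr C" "Dom C (ZeroArr C X Y) = X" "Cod C (ZeroArr C X Y) = Y"
  using abelian_monoid.zero_closed[of "Hom_space C X Y"] Hom_space_abelian_group[OF assms]
  by (auto simp: abelian_group_def Hom_iff)

lemma AddArr_arr [simp]:
  assumes "f \<in> Arr C" "g \<in> Arr C" "Dom C f = Dom C g" "Cod C f = Cod C g"
  shows "f \<boxplus> g \<in> Arr C" "Dom C (f \<boxplus> g) = Dom C g" "Cod C (f \<boxplus> g) = Cod C g"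
  using abelian_monoid.a_closed[of "Hom_space C (Dom C g) (Cod C g)" f g]
    Hom_space_abelian_group[of "Dom C g" "Cod C g"] assms
  by (auto simp: abelian_group_def Hom_iff)

lemma Scale_arr [simp]:
  assumes "f \<in> Arr C"
  shows "c \<star> f \<in> Arr C" "Dom C (c \<star> f) = Dom C f" "Cod C (c \<star> f) = Cod C f"
  using Module.module.smult_closed[OF Hom_space_module[of "Dom C f" "Cod C f"], of c f] assms
  by (auto simp: Hom_iff)

lemma Scale_zero [simp]: "f \<in> Arr C \<Longrightarrow> 0 \<star> f = ZeroArr C (Dom C f) (Cod C f)"
  using Module.module.smult_l_null[OF Hom_space_module[of "Dom C f" "Cod C f"], of f] by (simp add: Hom_iff)

lemma Scale_one [simp]: "f \<in> Arr C \<Longrightarrow> 1 \<star> f = f"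
  using Module.module.smult_one[OF Hom_space_module[of "Dom C f" "Cod C f"], of f] by (simp add: Hom_iff)

lemma Scale_Scale [simp]: "f \<in> Arr C \<Longrightarrow> a \<star> (b \<star> f) = (a * b) \<star> f"
  using Module.module.smult_assoc1[OF Hom_space_module[of "Dom C f" "Cod C f"], of a b f] by (simp add: Hom_iff)

lemma Scale_ZeroArr [simp]: "X \<in> Obj C \<Longrightarrow> Y \<in> Obj C \<Longrightarrow> c \<star> ZeroArr C X Y = ZeroArr C X Y"
  using Module.module.smult_r_null[OF Hom_space_module[of X Y], of c] by (simp add: Hom_iff)

lemma Scale_eq_ZeroD:
  assumes "c \<star> f = ZeroArr C (Dom C f) (Cod C f)" "f \<in> Arr C" "c \<noteq> 0"
  shows "f = ZeroArr C (Dom C f) (Cod C f)"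
proof -
  have "f = (inverse c * c) \<star> f" using assms(2,3) by simp
  also have "\<dots> = inverse c \<star> (c \<star> f)" using assms(2) by (simp only: Scale_Scale)
  also have "\<dots> = ZeroArr C (Dom C f) (Cod C f)" unfolding assms(1) using assms(2) by simp
  finally show ?thesis .
qed

lemma Add_ZeroArr [simp]:
  "f \<in> Arr C \<Longrightarrow> Dom C f = X \<Longrightarrow> Cod C f = Y \<Longrightarrow> f \<boxplus> ZeroArr C X Y = f"
  "f \<in> Arr C \<Longrightarrow> Dom C f = X \<Longrightarrow> Cod C f = Y \<Longrightarrow> ZeroArr C X Y \<boxplus> f = f"
  using abelian_monoid.r_zero[of "Hom_space C X Y" f] abelian_monoid.l_zero[of "Hom_space C X Y" f]
    Hom_space_abelian_group[of X Y] by (auto simp: abelian_group_def Hom_iff)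

lemma Add_minus:
  assumes "f \<in> Arr C"
  shows "f \<boxplus> (- 1) \<star> f = ZeroArr C (Dom C f) (Cod C f)"
proof -
  have "(1 + - 1) \<star> f = 1 \<star> f \<boxplus> (- 1) \<star> f"
    using Module.module.smult_l_distr[OF Hom_space_module[of "Dom C f" "Cod C f"], of 1 "-1" f] assms
    by (simp add: Hom_iff)
  then show ?thesis using assms by simp
qed

lemma minus_eq_ZeroD:
  assumes "f \<in> Hom C X Y" "g \<in> Hom C X Y" "f \<boxplus> (- 1) \<star> g = ZeroArr C X Y"
  shows "f = g"
proof -
  note [simp] = HomD[OF assms(1)] HomD[OF assms(2)]
  have [simp]: "X \<in> Obj C" "Y \<in> Obj C" using Hom_objs[OF assms(1)] by auto
  interpret abelian_group "Hom_space C X Y" by (rule Hom_space_abelian_group) simp_all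
  have "g \<boxplus> (- 1) \<star> g = ZeroArr C X Y" using Add_minus[of g] by simp
  then have "f \<boxplus> (- 1) \<star> g = g \<boxplus> (- 1) \<star> g" using assms(3) by simp
  then show ?thesis using add.right_cancel[of "(- 1) \<star> g" f g] by (simp add: Hom_iff)
qed

lemma Comp_Scale [simp]:
  "f \<in> Arr C \<Longrightarrow> g \<in> Arr C \<Longrightarrow> Cod C f = Dom C g \<Longrightarrow> g \<cdot> (c \<star> f) = c \<star> (g \<cdot> f)"
  "f \<in> Arr C \<Longrightarrow> g \<in> Arr C \<Longrightarrow> Cod C f = Dom C g \<Longrightarrow> (c \<star> g) \<cdot> f = c \<star> (g \<cdot> f)"
  using Comp_scale_left[of f "Dom C f" "Cod C f" g "Cod C g" c]
    Comp_scale_right[of f "Dom C f" "Cod C f" g "Cod C g" c] by (auto simp: Hom_iff)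

lemma Comp_ZeroArr [simp]:
  assumes "g \<in> Arr C" "X \<in> Obj C"
  shows "Dom C g = Y \<Longrightarrow> g \<cdot> ZeroArr C X Y = ZeroArr C X (Cod C g)"
    "Cod C g = Y \<Longrightarrow> ZeroArr C Y X \<cdot> g = ZeroArr C (Dom C g) X"
proof -
  show "g \<cdot> ZeroArr C X Y = ZeroArr C X (Cod C g)" if "Dom C g = Y"
  proof -
    have "Y \<in> Obj C" using that assms by auto
    then show ?thesis using Comp_Scale(1)[of "ZeroArr C X Y" g 0] assms that by simp
  qed
  show "ZeroArr C Y X \<cdot> g = ZeroArr C (Dom C g) X" if "Cod C g = Y"
  proof -
    have "Y \<in> Obj C" using that assms by auto
    then show ?thesis using Comp_Scale(2)[of g "ZeroArr C Y X" 0] assms that by simp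
  qed
qed

lemma Comp_Add:
  "f \<in> Arr C \<Longrightarrow> f' \<in> Arr C \<Longrightarrow> g \<in> Arr C \<Longrightarrow> Dom C f = Dom C f' \<Longrightarrow> Cod C f = Dom C g \<Longrightarrow> Cod C f' = Dom C g \<Longrightarrow>
    g \<cdot> (f \<boxplus> f') = (g \<cdot> f) \<boxplus> (g \<cdot> f')"
  "f \<in> Arr C \<Longrightarrow> g \<in> Arr C \<Longrightarrow> g' \<in> Arr C \<Longrightarrow> Cod C g = Cod C g' \<Longrightarrow> Cod C f = Dom C g \<Longrightarrow> Cod C f = Dom C g' \<Longrightarrow>
    (g \<boxplus> g') \<cdot> f = (g \<cdot> f) \<boxplus> (g' \<cdot> f)"
  using Comp_add_right[of f "Dom C f" "Cod C f" f' g "Cod C g"]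
    Comp_add_left[of f "Dom C f" "Cod C f" g "Cod C g" g'] by (auto simp: Hom_iff)

lemma Comp_finsum_cong:
  assumes "finite A" "\<And>k. k \<in> A \<Longrightarrow> a k \<in> Hom C X Y" "g \<in> Hom C Y Z" "h \<in> Hom C Y Z"
    "\<And>k. k \<in> A \<Longrightarrow> g \<cdot> a k = h \<cdot> a k" "X \<in> Obj C"
  shows "g \<cdot> finsum (Hom_space C X Y) a A = h \<cdot> finsum (Hom_space C X Y) a A"
proof -
  note [simp] = HomD[OF assms(3)] HomD[OF assms(4)]
  have [simp]: "X \<in> Obj C" "Y \<in> Obj C" "Z \<in> Obj C" using assms(6) Hom_objs[OF assms(3)] by auto
  interpret abelian_group "Hom_space C X Y" by (rule Hom_space_abelian_group) simp_all
  show ?thesis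
    using assms(1,2,5)
  proof (induction A)
    case (insert k A)
    have c: "a k \<in> Hom C X Y" "finsum (Hom_space C X Y) a A \<in> Hom C X Y"
      using insert.prems finsum_closed[of a A] by auto
    then show ?case using insert by (simp add: finsum_insert Pi_def Comp_Add Hom_iff)
  qed simp
qed

text \<open>An arrow out of a direct sum is its composite with \<open>\<Sum> \<iota>\<^sub>k
  \<pi>\<^sub>k\<close>, so it is determined by its composites with the inclusions.\<close>

lemma direct_sum_jointly_epic:
  assumes "is_direct_sum C V Ss" "g \<in> Hom C V Z" "h \<in> Hom C V Z"
    "\<And>S \<iota>. S \<in> set Ss \<Longrightarrow> \<iota> \<in> Hom C S V \<Longrightarrow> g \<cdot> \<iota> = h \<cdot> \<iota>"
  shows "g = h"
proof -
  obtain \<iota> \<pi> where \<iota>: "\<And>k. k < length Ss \<Longrightarrow> \<iota> k \<in> Hom C (Ss ! k) V"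
    and \<pi>: "\<And>k. k < length Ss \<Longrightarrow> \<pi> k \<in> Hom C V (Ss ! k)"
    and sum: "finsum (Hom_space C V V) (\<lambda>k. \<iota> k \<cdot> \<pi> k) {..<length Ss} = Ident C V"
    using assms(1) unfolding is_direct_sum_def by blast
  have "g \<cdot> finsum (Hom_space C V V) (\<lambda>k. \<iota> k \<cdot> \<pi> k) {..<length Ss} =
      h \<cdot> finsum (Hom_space C V V) (\<lambda>k. \<iota> k \<cdot> \<pi> k) {..<length Ss}"
  proof (rule Comp_finsum_cong)
    fix k assume "k \<in> {..<length Ss}"
    then have k: "k < length Ss" by simp
    show "\<iota> k \<cdot> \<pi> k \<in> Hom C V V" using Comp_Hom[OF \<pi>[OF k] \<iota>[OF k]] .
    have "(g \<cdot> \<iota> k) \<cdot> \<pi> k = (h \<cdot> \<iota> k) \<cdot> \<pi> k" using assms(4)[OF _ \<iota>[OF k]] k by simp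
    then show "g \<cdot> (\<iota> k \<cdot> \<pi> k) = h \<cdot> (\<iota> k \<cdot> \<pi> k)"
      using Comp_assoc[OF \<pi>[OF k] \<iota>[OF k] assms(2)] Comp_assoc[OF \<pi>[OF k] \<iota>[OF k] assms(3)] by simp
  qed (use assms Hom_objs in auto)
  then show ?thesis unfolding sum using assms by (simp add: Hom_iff)
qed

lemma simple_endo_scalar:
  assumes "is_simple C S" "e \<in> Hom C S S"
  obtains c where "e = c \<star> Ident C S"
  using assms unfolding is_simple_def bij_betw_def by blast

lemma simple_scalar_inj: "is_simple C S \<Longrightarrow> a \<star> Ident C S = b \<star> Ident C S \<Longrightarrow> a = b"
  unfolding is_simple_def bij_betw_def inj_def by blast

lemma simple_Obj [simp]: "is_simple C S \<Longrightarrow> S \<in> Obj C"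
  by (simp add: is_simple_def)

lemma simple_Ident_nonzero: "is_simple C S \<Longrightarrow> Ident C S \<noteq> ZeroArr C S S"
  using simple_scalar_inj[of S 1 0] by auto

lemma kernel_factor:
  "is_kernel C f k \<Longrightarrow> h \<in> Hom C W (Dom C f) \<Longrightarrow> f \<cdot> h = ZeroArr C W (Cod C f) \<Longrightarrow>
    \<exists>u\<in>Hom C W (Dom C k). k \<cdot> u = h"
  unfolding is_kernel_def by blast

lemma cokernel_factor:
  "is_cokernel C f q \<Longrightarrow> h \<in> Hom C (Cod C f) W \<Longrightarrow> h \<cdot> f = ZeroArr C (Dom C f) W \<Longrightarrow>
    \<exists>u\<in>Hom C (Cod C q) W. u \<cdot> q = h"
  unfolding is_cokernel_def by blast

lemma kernel_cancel:
  assumes "is_kernel C f k" "g \<in> Hom C W (Dom C k)" "h \<in> Hom C W (Dom C k)" "k \<cdot> g = k \<cdot> h"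
  shows "g = h"
proof -
  have k [simp]: "f \<in> Arr C" "k \<in> Arr C" "Cod C k = Dom C f" and 0: "f \<cdot> k = ZeroArr C (Dom C k) (Cod C f)"
    using assms by (auto simp: is_kernel_def)
  note [simp] = HomD[OF assms(2)]
  have "f \<cdot> (k \<cdot> g) = (f \<cdot> k) \<cdot> g" by simp
  also have "\<dots> = ZeroArr C W (Cod C f)" unfolding 0 by simp
  finally have "f \<cdot> (k \<cdot> g) = ZeroArr C W (Cod C f)" .
  moreover have "k \<cdot> g \<in> Hom C W (Dom C f)" by (simp add: Hom_iff)
  ultimately have "\<exists>!u. u \<in> Hom C W (Dom C k) \<and> k \<cdot> u = k \<cdot> g"
    using assms(1) unfolding is_kernel_def by blast
  then show ?thesis using assms by auto
qed

lemma cokernel_cancel: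
  assumes "is_cokernel C f q" "g \<in> Hom C (Cod C q) W" "h \<in> Hom C (Cod C q) W" "g \<cdot> q = h \<cdot> q"
  shows "g = h"
proof -
  have k [simp]: "f \<in> Arr C" "q \<in> Arr C" "Dom C q = Cod C f" and 0: "q \<cdot> f = ZeroArr C (Dom C f) (Cod C q)"
    using assms by (auto simp: is_cokernel_def)
  note [simp] = HomD[OF assms(2)]
  have [simp]: "W \<in> Obj C" using Hom_objs[OF assms(2)] by simp
  have "(g \<cdot> q) \<cdot> f = ZeroArr C (Dom C f) W" using 0 by simp
  moreover have "g \<cdot> q \<in> Hom C (Cod C f) W" by (simp add: Hom_iff)
  ultimately have "\<exists>!u. u \<in> Hom C (Cod C q) W \<and> u \<cdot> q = g \<cdot> q"
    using assms(1) unfolding is_cokernel_def by blast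
  then show ?thesis using assms by auto
qed

text \<open>By subtraction, cancellation only has to be tested against zero arrows.\<close>

lemma is_monoI:
  assumes f: "f \<in> Arr C"
    and 0: "\<And>W g. g \<in> Hom C W (Dom C f) \<Longrightarrow> f \<cdot> g = ZeroArr C W (Cod C f) \<Longrightarrow> g = ZeroArr C W (Dom C f)"
  shows "is_mono C f"
  unfolding is_mono_def
proof (intro conjI allI ballI impI f)
  fix W g h assume g: "g \<in> Hom C W (Dom C f)" and h: "h \<in> Hom C W (Dom C f)" and eq: "f \<cdot> g = f \<cdot> h"
  note [simp] = f HomD[OF g] HomD[OF h]
  have [simp]: "W \<in> Obj C" using Hom_objs[OF g] by simp
  have "f \<cdot> (g \<boxplus> (- 1) \<star> h) = ZeroArr C W (Cod C f)"
    using Add_minus[of "f \<cdot> h"] by (simp add: Comp_Add eq)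
  then have "g \<boxplus> (- 1) \<star> h = ZeroArr C W (Dom C f)" by (intro 0) (simp_all add: Hom_iff)
  then show "g = h" using minus_eq_ZeroD g h by blast
qed

end

section \<open>Simple objects of a fusion category\<close>

context fusion_category
begin

text \<open>The kernel of such an arrow splits off \<open>S\<close> and so gives an idempotent of
  \<open>S\<close>, which is a scalar. The scalar is zero because the arrow is not; hence the arrow
  is a monomorphism and splits in turn.\<close>

lemma nonzero_from_simple_splits:
  assumes S: "is_simple C S" and f: "f \<in> Hom C S T" and nz: "f \<noteq> ZeroArr C S T"
  shows "\<exists>r\<in>Hom C T S. r \<cdot> f = Ident C S"
proof -
  note [simp] = HomD[OF f] simple_Obj[OF S]
  have T [simp]: "T \<in> Obj C" using Hom_objs[OF f] by simp
  obtain k where k: "is_kernel C f k" using kernels[of f] by auto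
  then have [simp]: "k \<in> Arr C" "Cod C k = S" and fk: "f \<cdot> k = ZeroArr C (Dom C k) T"
    by (auto simp: is_kernel_def)
  have "is_mono C k" using kernel_cancel[OF k] by (auto simp: is_mono_def)
  then obtain r where r: "r \<in> Hom C S (Dom C k)" and rk: "r \<cdot> k = Ident C (Dom C k)"
    using monos_split by fastforce
  note [simp] = HomD[OF r]
  obtain c where c: "k \<cdot> r = c \<star> Ident C S"
    using simple_endo_scalar[OF S, of "k \<cdot> r"] by (auto simp: Hom_iff)
  have "c \<star> f = f \<cdot> (k \<cdot> r)" unfolding c by simp
  also have "\<dots> = (f \<cdot> k) \<cdot> r" by simp
  also have "\<dots> = ZeroArr C S T" unfolding fk by simp
  finally have "c = 0" using Scale_eq_ZeroD[of c f] nz by auto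
  then have kr: "k \<cdot> r = ZeroArr C S S" using c by simp
  have "k = k \<cdot> (r \<cdot> k)" unfolding rk by simp
  also have "\<dots> = (k \<cdot> r) \<cdot> k" by simp
  also have "\<dots> = ZeroArr C (Dom C k) S" unfolding kr by simp
  finally have k0: "k = ZeroArr C (Dom C k) S" .
  have "is_mono C f"
  proof (rule is_monoI)
    fix W g assume g: "g \<in> Hom C W (Dom C f)" and fg: "f \<cdot> g = ZeroArr C W (Cod C f)"
    then obtain u where u: "u \<in> Hom C W (Dom C k)" "k \<cdot> u = g"
      using kernel_factor[OF k] by blast
    have "g = ZeroArr C (Dom C k) S \<cdot> u" using u k0 by simp
    then show "g = ZeroArr C W (Dom C f)" using u by (simp add: Hom_iff)
  qed simp
  then show ?thesis using monos_split by fastforce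
qed

text \<open>Schur's lemma: with a retraction \<open>r\<close> of \<open>f\<close>, the endomorphism
  \<open>f r\<close> is a scalar, and it is one because \<open>f r f = f\<close>.\<close>

lemma nonzero_between_simples_Iso:
  assumes S: "is_simple C S" and T: "is_simple C T" and f: "f \<in> Hom C S T" and nz: "f \<noteq> ZeroArr C S T"
  shows "f \<in> Iso C S T"
proof -
  note [simp] = HomD[OF f] simple_Obj[OF S] simple_Obj[OF T]
  obtain r where r: "r \<in> Hom C T S" and rf: "r \<cdot> f = Ident C S"
    using nonzero_from_simple_splits[OF S f nz] by blast
  note [simp] = HomD[OF r]
  obtain c where c: "f \<cdot> r = c \<star> Ident C T"
    using simple_endo_scalar[OF T, of "f \<cdot> r"] by (auto simp: Hom_iff)
  have "c \<star> f = (f \<cdot> r) \<cdot> f" unfolding c by simp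
  also have "\<dots> = f \<cdot> (r \<cdot> f)" by simp
  also have "\<dots> = f" unfolding rf by simp
  finally have cf: "c \<star> f = f" .
  have "(c - 1) \<star> f = c \<star> f \<boxplus> (- 1) \<star> f"
    using Module.module.smult_l_distr[OF Hom_space_module[of S T], of c "-1" f] by (simp add: Hom_iff)
  also have "\<dots> = ZeroArr C S T" unfolding cf using Add_minus[of f] by simp
  finally have "c = 1" using Scale_eq_ZeroD[of "c - 1" f] nz by auto
  then show ?thesis using c f r rf by (intro IsoI) auto
qed

end

section \<open>Dimensions of spaces of arrows\<close>

definition hdim :: "('o, 'm, 'x) linear_cat_scheme \<Rightarrow> 'o \<Rightarrow> 'o \<Rightarrow> nat" where
  "hdim C X Y = vectorspace.dim class_ring (Hom_space C X Y)"

lemma linear_mapI: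
  assumes "vectorspace class_ring V" "vectorspace class_ring W"
    "\<And>f. f \<in> carrier V \<Longrightarrow> \<phi> f \<in> carrier W"
    "\<And>f g. f \<in> carrier V \<Longrightarrow> g \<in> carrier V \<Longrightarrow> \<phi> (f \<oplus>\<^bsub>V\<^esub> g) = \<phi> f \<oplus>\<^bsub>W\<^esub> \<phi> g"
    "\<And>c f. f \<in> carrier V \<Longrightarrow> \<phi> (c \<odot>\<^bsub>V\<^esub> f) = c \<odot>\<^bsub>W\<^esub> \<phi> f"
  shows "linear_map class_ring V W \<phi>"
  using assms unfolding linear_map_def mod_hom_def mod_hom_axioms_def LinearCombinations.module_hom_def
  by (auto simp: vectorspace_def)

lemma hdim_eqI:
  assumes "vectorspace class_ring (Hom_space C X Y)" "vectorspace class_ring (Hom_space D X' Y')"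
    "vectorspace.fin_dim class_ring (Hom_space C X Y)"
    "\<And>f g. f \<in> Hom C X Y \<Longrightarrow> g \<in> Hom C X Y \<Longrightarrow> \<phi> (f \<boxplus>\<^bsub>C\<^esub> g) = \<phi> f \<boxplus>\<^bsub>D\<^esub> \<phi> g"
    "\<And>c f. f \<in> Hom C X Y \<Longrightarrow> \<phi> (c \<star>\<^bsub>C\<^esub> f) = c \<star>\<^bsub>D\<^esub> \<phi> f"
    "bij_betw \<phi> (Hom C X Y) (Hom D X' Y')"
  shows "hdim C X Y = hdim D X' Y'"
proof -
  interpret linear_map class_ring "Hom_space C X Y" "Hom_space D X' Y'" \<phi>
    by (rule linear_mapI) (use assms in \<open>auto simp: bij_betw_def\<close>)
  show ?thesis unfolding hdim_def
    by (rule dim_eq) (use assms in \<open>auto simp: bij_betw_def\<close>)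
qed

context fusion_category
begin

lemma hdim_Iso_right:
  assumes X: "X \<in> Obj C" and u: "u \<in> Iso C Y Z"
  shows "hdim C X Y = hdim C X Z"
proof (rule hdim_eqI[where \<phi> = "\<lambda>f. u \<cdot> f"])
  note [simp] = Inv_simps[OF u]
  have [simp]: "X \<in> Obj C" "Y \<in> Obj C" "Z \<in> Obj C" using X Hom_objs[OF Iso_Hom[OF u]] by auto
  show "vectorspace class_ring (Hom_space C X Y)" "vectorspace class_ring (Hom_space C X Z)"
    "vectorspace.fin_dim class_ring (Hom_space C X Y)"
    by (simp_all add: Hom_vectorspace Hom_fin_dim)
  show "bij_betw ((\<cdot>) u) (Hom C X Y) (Hom C X Z)"
    by (rule bij_betw_byWitness[where f' = "\<lambda>f. Inv C u \<cdot> f"]) (auto simp: Hom_iff Inv_cancel[OF u])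
qed (use Inv_simps[OF u] in \<open>auto simp: Hom_iff Comp_Add\<close>)

lemma hdim_Iso_left:
  assumes X: "X \<in> Obj C" and u: "u \<in> Iso C Z Y"
  shows "hdim C Y X = hdim C Z X"
proof (rule hdim_eqI[where \<phi> = "\<lambda>f. f \<cdot> u"])
  note [simp] = Inv_simps[OF u]
  have [simp]: "X \<in> Obj C" "Y \<in> Obj C" "Z \<in> Obj C" using X Hom_objs[OF Iso_Hom[OF u]] by auto
  show "vectorspace class_ring (Hom_space C Y X)" "vectorspace class_ring (Hom_space C Z X)"
    "vectorspace.fin_dim class_ring (Hom_space C Y X)"
    by (simp_all add: Hom_vectorspace Hom_fin_dim)
  show "bij_betw (\<lambda>f. f \<cdot> u) (Hom C Y X) (Hom C Z X)"
    by (rule bij_betw_byWitness[where f' = "\<lambda>f. f \<cdot> Inv C u"]) (auto simp: Hom_iff)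
qed (use Inv_simps[OF u] in \<open>auto simp: Hom_iff Comp_Add\<close>)

lemma hdim_simple_self:
  assumes S: "is_simple C S"
  shows "hdim C S S = 1"
proof -
  interpret vectorspace class_ring "Hom_space C S S" using S by (intro Hom_vectorspace) auto
  have id: "Ident C S \<in> Hom C S S" using S by (auto simp: Hom_iff)
  have "span {Ident C S} = carrier (Hom_space C S S)"
  proof
    show "carrier (Hom_space C S S) \<subseteq> span {Ident C S}"
    proof
      fix f assume "f \<in> carrier (Hom_space C S S)"
      then obtain c where f: "f = c \<star> Ident C S" using simple_endo_scalar[OF S] by auto
      have "submodule class_ring (span {Ident C S}) (Hom_space C S S)"
        using id by (intro span_is_submodule) auto
      then have "c \<odot>\<^bsub>Hom_space C S S\<^esub> Ident C S \<in> span {Ident C S}"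
        by (rule submodule.smult_closed) (use id in \<open>auto intro!: span_self\<close>)
      then show "f \<in> span {Ident C S}" using f by simp
    qed
  qed (use id span_closed[of "{Ident C S}"] in auto)
  then show ?thesis unfolding hdim_def using id simple_Ident_nonzero[OF S]
    by (intro dim1I[of "Ident C S"]) auto
qed

lemma hdim_simple_distinct:
  assumes S: "is_simple C S" and T: "is_simple C T" and ne: "Iso C S T = {}"
  shows "hdim C S T = 0"
proof -
  note [simp] = simple_Obj[OF S] simple_Obj[OF T]
  interpret vectorspace class_ring "Hom_space C S T" by (intro Hom_vectorspace) auto
  have "Hom C S T = {ZeroArr C S T}"
  proof
    show "Hom C S T \<subseteq> {ZeroArr C S T}" using nonzero_between_simples_Iso[OF S T] ne by blast
  qed (simp add: Hom_iff)
  then have "span {\<zero>\<^bsub>Hom_space C S T\<^esub>} = carrier (Hom_space C S T)"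
    using span_closed[of "{ZeroArr C S T}"] span_self[of "ZeroArr C S T"] by auto
  then show ?thesis unfolding hdim_def by (rule dim0I)
qed

text \<open>Left exactness of \<open>Hom(X, -)\<close> identifies the kernel of composition with
  \<open>g\<close>. Composition with \<open>g\<close> is onto because the splitting of
  \<open>f\<close> induces a section of \<open>g\<close>; the rank-nullity theorem then counts
  dimensions.\<close>

lemma hdim_short_exact:
  assumes ex: "short_exact C f g" and X [simp]: "X \<in> Obj C"
  shows "hdim C X (Cod C f) = hdim C X (Dom C f) + hdim C X (Cod C g)"
proof -
  have k: "is_kernel C g f" and q: "is_cokernel C f g" using ex by (auto simp: short_exact_def)
  have [simp]: "f \<in> Arr C" "g \<in> Arr C" "Dom C g = Cod C f"
    and gf: "g \<cdot> f = ZeroArr C (Dom C f) (Cod C g)"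
    using k by (auto simp: is_kernel_def)
  have "is_mono C f" using kernel_cancel[OF k] by (auto simp: is_mono_def)
  then obtain r where r: "r \<in> Hom C (Cod C f) (Dom C f)" and rf: "r \<cdot> f = Ident C (Dom C f)"
    using monos_split by blast
  note [simp] = HomD[OF r]
  \<comment> \<open>The arrow \<open>id - f r\<close> vanishes on \<open>f\<close>, so it factors
    through the cokernel \<open>g\<close>; the factor is a section of \<open>g\<close>.\<close>
  let ?e = "Ident C (Cod C f) \<boxplus> (- 1) \<star> (f \<cdot> r)"
  have e: "?e \<in> Hom C (Cod C f) (Cod C f)" by (simp add: Hom_iff)
  have ef: "?e \<cdot> f = ZeroArr C (Dom C f) (Cod C f)"
    using rf Add_minus[of f] by (simp add: Comp_Add)
  obtain s where s: "s \<in> Hom C (Cod C g) (Cod C f)" and sg: "s \<cdot> g = ?e"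
    using cokernel_factor[OF q e ef] by blast
  note [simp] = HomD[OF s]
  have "(g \<cdot> s) \<cdot> g = g \<cdot> (s \<cdot> g)" by simp
  also have "\<dots> = g \<boxplus> (- 1) \<star> ((g \<cdot> f) \<cdot> r)" unfolding sg by (simp add: Comp_Add)
  also have "\<dots> = Ident C (Cod C g) \<cdot> g" unfolding gf by simp
  finally have gs: "g \<cdot> s = Ident C (Cod C g)"
    using cokernel_cancel[OF q, of "g \<cdot> s" "Cod C g" "Ident C (Cod C g)"] by (simp add: Hom_iff)
  let ?A = "Hom_space C X (Dom C f)" and ?B = "Hom_space C X (Cod C f)" and ?Q = "Hom_space C X (Cod C g)"
  have vs: "vectorspace class_ring ?A" "vectorspace class_ring ?B" "vectorspace class_ring ?Q"
    by (simp_all add: Hom_vectorspace)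
  interpret T: linear_map class_ring ?B ?Q "\<lambda>h. g \<cdot> h"
    by (rule linear_mapI) (use vs in \<open>auto simp: Hom_iff Comp_Add\<close>)
  have im: "T.im = Hom C X (Cod C g)"
  proof
    show "Hom C X (Cod C g) \<subseteq> T.im"
    proof
      fix h assume h: "h \<in> Hom C X (Cod C g)"
      note [simp] = HomD[OF h]
      have "g \<cdot> (s \<cdot> h) = (g \<cdot> s) \<cdot> h" by simp
      also have "\<dots> = h" unfolding gs by simp
      finally show "h \<in> T.im" unfolding T.im_def by (auto simp: Hom_iff intro!: image_eqI[of _ _ "s \<cdot> h"])
    qed
  qed (auto simp: T.im_def Hom_iff)
  have ker: "T.ker = {h \<in> Hom C X (Cod C f). g \<cdot> h = ZeroArr C X (Cod C g)}" by (simp add: T.ker_def)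
  have vK: "vectorspace class_ring (?B\<lparr>carrier := T.ker\<rparr>)"
    using T.V.subspace_is_vs[OF T.kerT_is_subspace] .
  interpret J: linear_map class_ring ?A "?B\<lparr>carrier := T.ker\<rparr>" "\<lambda>h. f \<cdot> h"
  proof (rule linear_mapI)
    fix h assume "h \<in> carrier ?A"
    then have [simp]: "h \<in> Arr C" "Dom C h = X" "Cod C h = Dom C f" by (auto simp: Hom_iff)
    have "g \<cdot> (f \<cdot> h) = (g \<cdot> f) \<cdot> h" by simp
    also have "\<dots> = ZeroArr C X (Cod C g)" unfolding gf by simp
    finally show "f \<cdot> h \<in> carrier (?B\<lparr>carrier := T.ker\<rparr>)" by (simp add: ker Hom_iff)
  qed (use vs vK in \<open>auto simp: Hom_iff Comp_Add\<close>)
  have "vectorspace.dim class_ring ?A = vectorspace.dim class_ring (?B\<lparr>carrier := T.ker\<rparr>)"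
  proof (rule J.dim_eq)
    show "inj_on (\<lambda>h. f \<cdot> h) (carrier ?A)" using kernel_cancel[OF k] by (auto simp: inj_on_def)
    show "(\<lambda>h. f \<cdot> h) ` carrier ?A = carrier (?B\<lparr>carrier := T.ker\<rparr>)"
    proof
      show "carrier (?B\<lparr>carrier := T.ker\<rparr>) \<subseteq> (\<lambda>h. f \<cdot> h) ` carrier ?A"
      proof
        fix h assume "h \<in> carrier (?B\<lparr>carrier := T.ker\<rparr>)"
        then have "h \<in> Hom C X (Dom C g)" "g \<cdot> h = ZeroArr C X (Cod C g)" by (auto simp: ker)
        from kernel_factor[OF k this] show "h \<in> (\<lambda>h. f \<cdot> h) ` carrier ?A" by auto
      qed
    qed (use J.T_im in auto)
  qed (simp add: Hom_fin_dim)
  moreover have "vectorspace.dim class_ring (?Q\<lparr>carrier := T.im\<rparr>) +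
      vectorspace.dim class_ring (?B\<lparr>carrier := T.ker\<rparr>) = vectorspace.dim class_ring ?B"
    by (rule T.rank_nullity) (simp add: Hom_fin_dim)
  moreover have "?Q\<lparr>carrier := T.im\<rparr> = ?Q" unfolding im by (simp add: Hom_space_def)
  ultimately show ?thesis by (simp add: hdim_def)
qed

end

section \<open>Multiplicities in the Grothendieck group\<close>

lemma hom_finprod_comm_group:
  assumes "comm_group G" "comm_group H" "\<phi> \<in> hom G H" "finite A" "f \<in> A \<rightarrow> carrier G"
  shows "\<phi> (finprod G f A) = finprod H (\<lambda>k. \<phi> (f k)) A"
proof -
  interpret G: comm_group G by fact
  interpret H: comm_group H by fact
  interpret group_hom G H \<phi> using assms by unfold_locales
  show ?thesis using assms(4,5)
  proof (induction A)
    case (insert k A)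
    then have "f k \<in> carrier G" "f \<in> A \<rightarrow> carrier G" by auto
    moreover from this have "(\<lambda>k. \<phi> (f k)) \<in> A \<rightarrow> carrier H" "\<phi> (f k) \<in> carrier H"
      by (auto simp: Pi_iff)
    ultimately show ?case using insert by simp
  qed simp
qed

lemma finprod_integer_group: "finite A \<Longrightarrow> finprod integer_group f A = sum f A"
proof (induction A rule: finite_induct)
  case (insert k A)
  interpret comm_group integer_group by (rule abelian_integer_group)
  show ?case using insert by simp
qed (simp add: comm_monoid.finprod_empty[OF comm_group.axioms(1)[OF abelian_integer_group]])

context fusion_category
begin

lemma K0_relations_subgroup: "subgroup (K0_relations C) (free_Abelian_group (Obj C))"
  unfolding K0_relations_def
proof (rule group.generate_is_subgroup)
  have "frag_of (Cod C f) - frag_of (Dom C f) - frag_of (Cod C g) \<in> carrier (free_Abelian_group (Obj C))"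
    if "short_exact C f g" for f g
  proof -
    have "f \<in> Arr C" "g \<in> Arr C" using that by (auto simp: short_exact_def is_kernel_def)
    have "Poly_Mapping.keys (frag_of (Cod C f) - frag_of (Dom C f) - frag_of (Cod C g))
        \<subseteq> {Cod C f, Dom C f, Cod C g}"
      using keys_diff[of "frag_of (Cod C f) - frag_of (Dom C f)" "frag_of (Cod C g)"]
        keys_diff[of "frag_of (Cod C f)" "frag_of (Dom C f)"] by auto
    also have "\<dots> \<subseteq> Obj C" using \<open>f \<in> Arr C\<close> \<open>g \<in> Arr C\<close> by simp
    finally show ?thesis by simp
  qed
  then show "{frag_of (Cod C f) - frag_of (Dom C f) - frag_of (Cod C g) | f g. short_exact C f g}
      \<subseteq> carrier (free_Abelian_group (Obj C))" by blast
qed simp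

lemma K0_relations_normal: "K0_relations C \<lhd> free_Abelian_group (Obj C)"
  using comm_group.subgroup_imp_normal[OF abelian_free_Abelian_group K0_relations_subgroup] .

lemma K0_comm_group: "comm_group (K0 C)"
  unfolding K0_def using comm_group.abelian_FactGroup[OF abelian_free_Abelian_group K0_relations_subgroup] .

lemma K0_class_closed [simp]: "V \<in> Obj C \<Longrightarrow> K0_class C V \<in> carrier (K0 C)"
  by (auto simp: K0_def K0_class_def carrier_FactGroup intro!: image_eqI[of _ _ "frag_of V"])

lemma K0_class_short_exact:
  assumes "short_exact C f g"
  shows "K0_class C (Cod C f) = K0_class C (Dom C f) \<otimes>\<^bsub>K0 C\<^esub> K0_class C (Cod C g)"
proof -
  let ?G = "free_Abelian_group (Obj C)" and ?R = "K0_relations C"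
  interpret normal ?R ?G by (rule K0_relations_normal)
  have [simp]: "f \<in> Arr C" "g \<in> Arr C" using assms by (auto simp: short_exact_def is_kernel_def)
  define s where "s = frag_of (Dom C f) + frag_of (Cod C g)"
  have s: "s \<in> carrier ?G" using keys_add[of "frag_of (Dom C f)" "frag_of (Cod C g)"] by (auto simp: s_def)
  have "frag_of (Cod C f) \<in> ?R #>\<^bsub>?G\<^esub> s"
    unfolding r_coset_def
  proof (rule UN_I)
    show "frag_of (Cod C f) - frag_of (Dom C f) - frag_of (Cod C g) \<in> ?R"
      unfolding K0_relations_def using assms by (intro generate.incl) blast
  qed (simp add: s_def)
  then have "?R #>\<^bsub>?G\<^esub> s = ?R #>\<^bsub>?G\<^esub> frag_of (Cod C f)"
    using repr_independence s K0_relations_subgroup by blast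
  then show ?thesis
    using rcos_sum[of "frag_of (Dom C f)" "frag_of (Cod C g)"]
    by (simp add: K0_def K0_class_def FactGroup_def s_def)
qed

text \<open>Dimensions of \<open>Hom(X, -)\<close> are additive on short exact sequences, so they
  descend to the Grothendieck group. These functionals are what makes the multiplicities of simple
  objects unique.\<close>

lemma hdim_K0_hom:
  assumes X: "X \<in> Obj C"
  obtains \<phi> where "\<phi> \<in> hom (K0 C) integer_group" "\<And>V. V \<in> Obj C \<Longrightarrow> \<phi> (K0_class C V) = int (hdim C X V)"
proof -
  let ?G = "free_Abelian_group (Obj C)"
  obtain h where h: "h \<in> hom ?G integer_group" and hV: "\<And>V. V \<in> Obj C \<Longrightarrow> h (frag_of V) = int (hdim C X V)"
    using comm_group.free_Abelian_group_universal[OF abelian_integer_group, of "\<lambda>V. int (hdim C X V)" "Obj C"]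
    by auto
  interpret group_hom ?G integer_group h
    using h by (simp add: group_hom_def group_hom_axioms_def)
  have h_diff: "h (a - b) = h a - h b" if "a \<in> carrier ?G" "b \<in> carrier ?G" for a b
    using hom_mult[of a "inv\<^bsub>?G\<^esub> b"] hom_inv[of b] that by simp
  have "K0_relations C \<subseteq> kernel ?G integer_group h"
    unfolding K0_relations_def
  proof (rule G.generate_subgroup_incl)
    show "subgroup (kernel ?G integer_group h) ?G" by (rule subgroup_kernel)
    have "frag_of (Cod C f) - frag_of (Dom C f) - frag_of (Cod C g) \<in> kernel ?G integer_group h"
      if ex: "short_exact C f g" for f g
    proof -
      have [simp]: "f \<in> Arr C" "g \<in> Arr C" using ex by (auto simp: short_exact_def is_kernel_def)
      have c: "frag_of (Cod C f) \<in> carrier ?G" "frag_of (Dom C f) \<in> carrier ?G" "frag_of (Cod C g) \<in> carrier ?G"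
        by simp_all
      have d: "frag_of (Cod C f) - frag_of (Dom C f) \<in> carrier ?G"
        using keys_diff[of "frag_of (Cod C f)" "frag_of (Dom C f)"] by auto
      have "frag_of (Cod C f) - frag_of (Dom C f) - frag_of (Cod C g) \<in> carrier ?G"
        using d keys_diff[of "frag_of (Cod C f) - frag_of (Dom C f)" "frag_of (Cod C g)"] by auto
      moreover have "h (frag_of (Cod C f) - frag_of (Dom C f) - frag_of (Cod C g)) = 0"
        using hdim_short_exact[OF ex X] by (simp add: h_diff[OF d c(3)] h_diff[OF c(1,2)] hV)
      ultimately show ?thesis by (simp add: kernel_def)
    qed
    then show "{frag_of (Cod C f) - frag_of (Dom C f) - frag_of (Cod C g) | f g. short_exact C f g}
      \<subseteq> kernel ?G integer_group h" by blast
  qed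
  then obtain \<phi> where "\<phi> \<in> hom (?G Mod K0_relations C) integer_group"
      "\<And>x. x \<in> carrier ?G \<Longrightarrow> \<phi> (r_coset ?G (K0_relations C) x) = h x"
    using FactGroup_universal_kernel[OF K0_relations_normal] by blast
  then show thesis by (intro that[of \<phi>]) (auto simp: K0_def K0_class_def hV)
qed

lemma is_simple_reps_simple_reps: "is_simple_reps C (simple_reps C)"
  unfolding simple_reps_def using finitely_many_simples by (rule someI_ex)

lemma simple_reps_nth:
  assumes "k < length (simple_reps C)"
  shows "is_simple C (simple_reps C ! k)" "simple_reps C ! k \<in> Obj C"
  using is_simple_reps_simple_reps assms unfolding is_simple_reps_def by auto

lemma hdim_simple_reps:
  assumes "k < length (simple_reps C)" "l < length (simple_reps C)"
  shows "hdim C (simple_reps C ! k) (simple_reps C ! l) = (if k = l then 1 else 0)"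
  using assms is_simple_reps_simple_reps simple_reps_nth
  by (auto simp: hdim_simple_self is_simple_reps_def intro!: hdim_simple_distinct)

text \<open>Otherwise the inclusions of all simple summands of \<open>V\<close> would vanish,
  although they are jointly epic.\<close>

lemma nonzero_from_simple_rep:
  assumes V: "V \<in> Obj C" and nz: "Ident C V \<noteq> ZeroArr C V V"
  shows "\<exists>k<length (simple_reps C). \<exists>f\<in>Hom C (simple_reps C ! k) V. f \<noteq> ZeroArr C (simple_reps C ! k) V"
proof (rule ccontr)
  assume no: "\<not> ?thesis"
  obtain Ss where simp: "\<And>S. S \<in> set Ss \<Longrightarrow> is_simple C S" and sum: "is_direct_sum C V Ss"
    using sums_of_simples[OF V] by blast
  have "Ident C V = ZeroArr C V V"
  proof (rule direct_sum_jointly_epic[OF sum])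
    fix S \<iota> assume S: "S \<in> set Ss" and \<iota>: "\<iota> \<in> Hom C S V"
    obtain W u where "W \<in> set (simple_reps C)" and u: "u \<in> Iso C S W"
      using is_simple_reps_simple_reps simp[OF S] unfolding is_simple_reps_def by blast
    then obtain k where k: "k < length (simple_reps C)" "W = simple_reps C ! k"
      by (auto simp: in_set_conv_nth)
    note [simp] = Inv_simps[OF u] HomD[OF \<iota>] V simple_Obj[OF simp[OF S]]
    have W [simp]: "W \<in> Obj C" using simple_reps_nth k by simp
    have "\<iota> \<cdot> Inv C u \<in> Hom C W V" by (simp add: Hom_iff)
    then have "\<iota> \<cdot> Inv C u = ZeroArr C W V" using no k by blast
    then have "(\<iota> \<cdot> Inv C u) \<cdot> u = ZeroArr C S V" by simp
    then show "Ident C V \<cdot> \<iota> = ZeroArr C V V \<cdot> \<iota>" by simp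
  qed (use V in \<open>simp_all add: Hom_iff\<close>)
  then show False using nz by simp
qed

text \<open>As monomorphisms are normal, \<open>f\<close> is the kernel of some \<open>g\<close>;
  this \<open>g\<close> factors through the cokernel \<open>q\<close>, so whatever \<open>q\<close>
  annihilates is annihilated by \<open>g\<close> and factors through \<open>f\<close>.\<close>

lemma split_mono_short_exact:
  assumes f: "f \<in> Hom C S V" and r: "r \<in> Hom C V S" and rf: "r \<cdot> f = Ident C S" and q: "is_cokernel C f q"
  shows "short_exact C f q"
proof -
  note [simp] = HomD[OF f] HomD[OF r]
  have [simp]: "S \<in> Obj C" "V \<in> Obj C" using Hom_objs[OF f] by auto
  have [simp]: "q \<in> Arr C" "Dom C q = V" and qf: "q \<cdot> f = ZeroArr C S (Cod C q)"
    using q by (auto simp: is_cokernel_def)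
  have cancel: "g = h" if "g \<in> Hom C W S" "h \<in> Hom C W S" "f \<cdot> g = f \<cdot> h" for W g h
  proof -
    note [simp] = HomD[OF that(1)] HomD[OF that(2)]
    have "g = (r \<cdot> f) \<cdot> g" unfolding rf by simp
    also have "\<dots> = r \<cdot> (f \<cdot> h)" using that(3) by simp
    also have "\<dots> = (r \<cdot> f) \<cdot> h" by simp
    also have "\<dots> = h" unfolding rf by simp
    finally show ?thesis .
  qed
  then have "is_mono C f" by (simp add: is_mono_def)
  then obtain g where g: "is_kernel C g f" using mono_normal by blast
  then have [simp]: "g \<in> Arr C" "Dom C g = V" and gf: "g \<cdot> f = ZeroArr C S (Cod C g)"
    by (auto simp: is_kernel_def)
  have "g \<in> Hom C (Cod C f) (Cod C g)" "g \<cdot> f = ZeroArr C (Dom C f) (Cod C g)"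
    using gf by (simp_all add: Hom_iff)
  from cokernel_factor[OF q this] obtain g' where g': "g' \<in> Hom C (Cod C q) (Cod C g)" "g' \<cdot> q = g"
    by blast
  note [simp] = HomD[OF g'(1)]
  have "is_kernel C q f"
    unfolding is_kernel_def
  proof (intro conjI allI ballI impI)
    fix W h assume h: "h \<in> Hom C W (Dom C q)" and qh: "q \<cdot> h = ZeroArr C W (Cod C q)"
    note [simp] = HomD[OF h]
    have [simp]: "W \<in> Obj C" using Hom_objs[OF h] by simp
    have "g \<cdot> h = g' \<cdot> (q \<cdot> h)" unfolding g'(2)[symmetric] by simp
    also have "\<dots> = ZeroArr C W (Cod C g)" unfolding qh by simp
    finally have "g \<cdot> h = ZeroArr C W (Cod C g)" .
    moreover have "h \<in> Hom C W (Dom C g)" by (simp add: Hom_iff)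
    ultimately obtain u where "u \<in> Hom C W S" "f \<cdot> u = h"
      using kernel_factor[OF g] by fastforce
    then show "\<exists>!u. u \<in> Hom C W (Dom C f) \<and> f \<cdot> u = h" using cancel by auto
  qed (simp_all add: qf)
  then show ?thesis using q by (simp add: short_exact_def)
qed

text \<open>Splitting off simple subobjects one at a time terminates, as each one lowers the sum of
  the dimensions of \<open>Hom(V\<^sub>k, V)\<close>.\<close>

lemma K0_class_spanned:
  assumes "V \<in> Obj C"
  shows "\<exists>n :: nat \<Rightarrow> int. K0_class C V =
    finprod (K0 C) (\<lambda>k. K0_class C (simple_reps C ! k) [^]\<^bsub>K0 C\<^esub> n k) {..<length (simple_reps C)}"
  using assms
proof (induction "\<Sum>k<length (simple_reps C). hdim C (simple_reps C ! k) V" arbitrary: V rule: less_induct)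
  case less
  note V [simp] = less.prems
  let ?N = "length (simple_reps C)" and ?x = "\<lambda>k. K0_class C (simple_reps C ! k)"
  interpret comm_group "K0 C" by (rule K0_comm_group)
  have x: "?x k \<in> carrier (K0 C)" if "k < ?N" for k using simple_reps_nth that by simp
  show ?case
  proof (cases "Ident C V = ZeroArr C V V")
    case True
    \<comment> \<open>A zero object gives the exact sequence of identities of \<open>V\<close>, so
      its class equals twice itself and vanishes.\<close>
    have "Ident C V \<cdot> Ident C V = ZeroArr C V V" unfolding True by simp
    moreover have "\<exists>!u. u \<in> Hom C W V \<and> Ident C V \<cdot> u = h" if "h \<in> Hom C W V" for W h
      using that by (intro ex1I[of _ h]) (auto simp: Hom_iff)
    moreover have "\<exists>!u. u \<in> Hom C V W \<and> u \<cdot> Ident C V = h" if "h \<in> Hom C V W" for W h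
      using that by (intro ex1I[of _ h]) (auto simp: Hom_iff)
    ultimately have "short_exact C (Ident C V) (Ident C V)"
      unfolding short_exact_def is_kernel_def is_cokernel_def by simp
    from K0_class_short_exact[OF this] have "K0_class C V = \<one>\<^bsub>K0 C\<^esub>" by simp
    then show ?thesis by (intro exI[of _ "\<lambda>_. 0"]) (simp add: int_pow_0)
  next
    case False
    then obtain k f where k: "k < ?N" and f: "f \<in> Hom C (simple_reps C ! k) V"
      and nz: "f \<noteq> ZeroArr C (simple_reps C ! k) V"
      using nonzero_from_simple_rep[OF V] by blast
    note [simp] = HomD[OF f]
    obtain r where r: "r \<in> Hom C V (simple_reps C ! k)" "r \<cdot> f = Ident C (simple_reps C ! k)"
      using nonzero_from_simple_splits[OF simple_reps_nth(1)[OF k] f nz] by blast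
    obtain q where q: "is_cokernel C f q" using cokernels[of f] by auto
    have Q [simp]: "q \<in> Arr C" using q by (simp add: is_cokernel_def)
    have ex: "short_exact C f q" using split_mono_short_exact[OF f r q] .
    have h: "hdim C X V = hdim C X (simple_reps C ! k) + hdim C X (Cod C q)" if "X \<in> Obj C" for X
      using hdim_short_exact[OF ex that] by simp
    have "(\<Sum>l<?N. hdim C (simple_reps C ! l) (Cod C q)) < (\<Sum>l<?N. hdim C (simple_reps C ! l) V)"
    proof (rule sum_strict_mono_ex1)
      show "\<forall>l\<in>{..<?N}. hdim C (simple_reps C ! l) (Cod C q) \<le> hdim C (simple_reps C ! l) V"
        using h simple_reps_nth by simp
      show "\<exists>l\<in>{..<?N}. hdim C (simple_reps C ! l) (Cod C q) < hdim C (simple_reps C ! l) V"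
        using h[OF simple_reps_nth(2)[OF k]] k by (intro bexI[of _ k]) (simp_all add: hdim_simple_reps)
    qed simp
    then obtain n :: "nat \<Rightarrow> int" where
      n: "K0_class C (Cod C q) = finprod (K0 C) (\<lambda>k. ?x k [^]\<^bsub>K0 C\<^esub> n k) {..<?N}"
      using less.hyps[of "Cod C q"] by auto
    let ?d = "\<lambda>l. if k = l then ?x l else \<one>\<^bsub>K0 C\<^esub>"
    have "finprod (K0 C) (\<lambda>l. ?x l [^]\<^bsub>K0 C\<^esub> (n l + (if k = l then 1 else 0))) {..<?N} =
        finprod (K0 C) (\<lambda>l. (?x l [^]\<^bsub>K0 C\<^esub> n l) \<otimes>\<^bsub>K0 C\<^esub> ?d l) {..<?N}"
      by (rule finprod_cong') (auto simp: x int_pow_mult int_pow_1)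
    also have "\<dots> = finprod (K0 C) (\<lambda>l. ?x l [^]\<^bsub>K0 C\<^esub> n l) {..<?N} \<otimes>\<^bsub>K0 C\<^esub> finprod (K0 C) ?d {..<?N}"
      by (rule finprod_multf) (auto simp: x)
    also have "finprod (K0 C) ?d {..<?N} = ?x k"
      by (rule finprod_singleton) (use k x in auto)
    also have "finprod (K0 C) (\<lambda>l. ?x l [^]\<^bsub>K0 C\<^esub> n l) {..<?N} \<otimes>\<^bsub>K0 C\<^esub> ?x k = K0_class C V"
      using K0_class_short_exact[OF ex] k x n[symmetric] by (simp add: m_comm)
    finally show ?thesis by (intro exI[of _ "\<lambda>l. n l + (if k = l then 1 else 0)"]) (rule sym)
  qed
qed

text \<open>By Schur's lemma the functionals given by the dimensions of \<open>Hom(V\<^sub>l,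
  -)\<close> are dual to the classes of the simple objects.\<close>

lemma K0_class_coefficient:
  assumes V: "V \<in> Obj C" and l: "l < length (simple_reps C)"
    and n: "K0_class C V =
      finprod (K0 C) (\<lambda>k. K0_class C (simple_reps C ! k) [^]\<^bsub>K0 C\<^esub> (n k :: int)) {..<length (simple_reps C)}"
  shows "n l = int (hdim C (simple_reps C ! l) V)"
proof -
  let ?N = "length (simple_reps C)" and ?x = "\<lambda>k. K0_class C (simple_reps C ! k)"
  obtain \<phi> where \<phi>: "\<phi> \<in> hom (K0 C) integer_group"
    and \<phi>V: "\<And>V. V \<in> Obj C \<Longrightarrow> \<phi> (K0_class C V) = int (hdim C (simple_reps C ! l) V)"
    using hdim_K0_hom[OF simple_reps_nth(2)[OF l]] by blast
  interpret K: comm_group "K0 C" by (rule K0_comm_group)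
  interpret group_hom "K0 C" integer_group \<phi>
    using \<phi> by (simp add: group_hom_def group_hom_axioms_def)
  have x: "?x k \<in> carrier (K0 C)" if "k < ?N" for k using simple_reps_nth that by simp
  have "int (hdim C (simple_reps C ! l) V) = \<phi> (finprod (K0 C) (\<lambda>k. ?x k [^]\<^bsub>K0 C\<^esub> n k) {..<?N})"
    using \<phi>V[OF V] n by simp
  also have "\<dots> = (\<Sum>k<?N. \<phi> (?x k [^]\<^bsub>K0 C\<^esub> n k))"
    by (subst hom_finprod_comm_group[OF K0_comm_group abelian_integer_group \<phi>])
      (auto simp: x finprod_integer_group)
  also have "\<dots> = (\<Sum>k<?N. n k * (if l = k then 1 else 0))"
    by (rule sum.cong) (use l simple_reps_nth in \<open>auto simp: x hom_int_pow \<phi>V hdim_simple_reps\<close>)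
  also have "\<dots> = n l" using l by (simp add: if_distrib cong: if_cong)
  finally show ?thesis by simp
qed

text \<open>The description by dimensions refers to the objects up to isomorphism only, and so it
  can be compared across an equivalence.\<close>

lemma fusion_coeff_eq_hdim:
  assumes "V \<in> Obj C" "X \<in> Obj C" "k < length (simple_reps C)"
  shows "fusion_coeff C V X k = int (hdim C (simple_reps C ! k) (V \<boxtimes> X))"
proof -
  let ?N = "length (simple_reps C)"
  let ?P = "\<lambda>n. n \<in> {..<?N} \<rightarrow>\<^sub>E (UNIV :: int set) \<and> K0_class C (V \<boxtimes> X) =
     finprod (K0 C) (\<lambda>k. K0_class C (simple_reps C ! k) [^]\<^bsub>K0 C\<^esub> n k) {..<?N}"
  interpret comm_group "K0 C" by (rule K0_comm_group)
  have VX: "V \<boxtimes> X \<in> Obj C" using assms by simp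
  obtain n :: "nat \<Rightarrow> int" where n: "K0_class C (V \<boxtimes> X) =
     finprod (K0 C) (\<lambda>k. K0_class C (simple_reps C ! k) [^]\<^bsub>K0 C\<^esub> n k) {..<?N}"
    using K0_class_spanned[OF VX] by blast
  have P: "?P (restrict n {..<?N})"
    unfolding n by (intro conjI finprod_cong') (auto simp: simple_reps_nth)
  have "n' = restrict n {..<?N}" if "?P n'" for n'
  proof
    fix k show "n' k = restrict n {..<?N} k"
      using K0_class_coefficient[OF VX, of k n'] K0_class_coefficient[OF VX _ n, of k] that
      by (cases "k < ?N") (auto simp: PiE_def extensional_def)
  qed
  with P have "fusion_coeff C V X = restrict n {..<?N}"
    unfolding fusion_coeff_def by (rule the_equality)
  then show ?thesis using K0_class_coefficient[OF VX assms(3) n] assms(3) by simp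
qed

end

section \<open>Equivalences of linear categories\<close>

context category_functor
begin

declare FObj_closed [simp]

lemma FArr_arr [simp]:
  assumes "f \<in> Arr C"
  shows "FArr F f \<in> Arr D" "Dom D (FArr F f) = FObj F (Dom C f)" "Cod D (FArr F f) = FObj F (Cod C f)"
  using FArr_Hom[of f "Dom C f" "Cod C f"] assms by (auto simp: Hom_iff)

lemma FArr_Comp_arr:
  "f \<in> Arr C \<Longrightarrow> g \<in> Arr C \<Longrightarrow> Cod C f = Dom C g \<Longrightarrow> FArr F (g \<cdot>\<^bsub>C\<^esub> f) = FArr F g \<cdot>\<^bsub>D\<^esub> FArr F f"
  using FArr_Comp[of f "Dom C f" "Cod C f" g "Cod C g"] by (simp add: Hom_iff)

lemma FArr_Iso:
  assumes "u \<in> Iso C X Y"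
  shows "FArr F u \<in> Iso D (FObj F X) (FObj F Y)"
proof -
  note [simp] = source.Inv_simps[OF assms]
  have [simp]: "X \<in> Obj C" "Y \<in> Obj C" using source.Hom_objs[OF source.Iso_Hom[OF assms]] by auto
  show ?thesis
    by (rule target.IsoI[of _ _ _ "FArr F (Inv C u)"])
      (simp_all add: Hom_iff FArr_Ident flip: FArr_Comp_arr)
qed

end

text \<open>By naturality of the unit, \<open>f\<close> is conjugate to \<open>G (F f)\<close>. The
  lemma after this one is the same argument for the counit.\<close>

lemma unit_iso_faithful:
  assumes F: "category_functor C D F" and G: "category_functor D C G"
    and \<eta>: "is_natural_iso C C id_functor (comp_functor G F) \<eta>"
    and f: "f \<in> Hom C X Y" and g: "g \<in> Hom C X Y" and eq: "FArr F f = FArr F g"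
  shows "f = g"
proof -
  interpret category_functor C D F by fact
  have o: "X \<in> Obj C" "Y \<in> Obj C" using source.Hom_objs[OF f] by auto
  have "\<eta> Y \<cdot>\<^bsub>C\<^esub> f = \<eta> Y \<cdot>\<^bsub>C\<^esub> g"
    using \<eta> f g eq by (simp add: is_natural_iso_def id_functor_def comp_functor_def)
  moreover have "\<eta> Y \<in> Iso C Y (FObj G (FObj F Y))"
    using \<eta> o by (simp add: is_natural_iso_def id_functor_def comp_functor_def)
  ultimately show ?thesis using source.Iso_mono f g by blast
qed

lemma counit_iso_faithful:
  assumes F: "category_functor C D F" and G: "category_functor D C G"
    and \<epsilon>: "is_natural_iso D D (comp_functor F G) id_functor \<epsilon>"
    and f: "f \<in> Hom D X Y" and g: "g \<in> Hom D X Y" and eq: "FArr G f = FArr G g"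
  shows "f = g"
proof -
  interpret category_functor C D F by fact
  have o: "X \<in> Obj D" "Y \<in> Obj D" using target.Hom_objs[OF f] by auto
  have N: "\<epsilon> Y \<cdot>\<^bsub>D\<^esub> FArr F (FArr G k) = k \<cdot>\<^bsub>D\<^esub> \<epsilon> X" if "k \<in> Hom D X Y" for k
    using \<epsilon> that by (simp add: is_natural_iso_def id_functor_def comp_functor_def)
  have "f \<cdot>\<^bsub>D\<^esub> \<epsilon> X = g \<cdot>\<^bsub>D\<^esub> \<epsilon> X" using N[OF f] N[OF g] eq by simp
  moreover have "\<epsilon> X \<in> Iso D (FObj F (FObj G X)) X"
    using \<epsilon> o by (simp add: is_natural_iso_def id_functor_def comp_functor_def)
  ultimately show ?thesis using target.Iso_epi f g by blast
qed

text \<open>The preimage of \<open>h\<close> is the conjugate of \<open>G h\<close> by the unit.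
  That \<open>F\<close> maps it to \<open>h\<close> can be tested after applying the faithful
  functor \<open>G\<close>, where it is the naturality of the unit.\<close>

lemma equivalence_fully_faithful:
  fixes C :: "('o, 'm, 'x) cat_scheme" and D :: "('p, 'n, 'y) cat_scheme"
    and F :: "('o, 'm, 'p, 'n, 'z) functor_data_scheme"
  assumes eq: "is_equivalence C D F" and X: "X \<in> Obj C" and Y: "Y \<in> Obj C"
  shows "bij_betw (FArr F) (Hom C X Y) (Hom D (FObj F X) (FObj F Y))"
proof -
  obtain G \<eta> \<epsilon> where F: "category_functor C D F" and G: "category_functor D C (G :: ('p, 'n, 'o, 'm) functor_data)"
    and \<eta>: "is_natural_iso C C id_functor (comp_functor G F) \<eta>"
    and \<epsilon>: "is_natural_iso D D (comp_functor F G) id_functor \<epsilon>"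
    using eq unfolding is_equivalence_def by blast
  interpret category_functor C D F by fact
  interpret G: category_functor D C G by fact
  have \<eta>I: "\<eta> Z \<in> Iso C Z (FObj G (FObj F Z))" if "Z \<in> Obj C" for Z
    using \<eta> that by (simp add: is_natural_iso_def id_functor_def comp_functor_def)
  have \<eta>N: "\<eta> Y \<cdot>\<^bsub>C\<^esub> f = FArr G (FArr F f) \<cdot>\<^bsub>C\<^esub> \<eta> X" if "f \<in> Hom C X Y" for f
    using \<eta> that by (simp add: is_natural_iso_def id_functor_def comp_functor_def)
  note [simp] = X Y source.Inv_simps[OF \<eta>I[OF X]] source.Inv_simps[OF \<eta>I[OF Y]]
  show ?thesis
    unfolding bij_betw_def
  proof
    show "inj_on (FArr F) (Hom C X Y)" using unit_iso_faithful[OF F G \<eta>] by (auto simp: inj_on_def)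
    show "FArr F ` Hom C X Y = Hom D (FObj F X) (FObj F Y)"
    proof
      show "FArr F ` Hom C X Y \<subseteq> Hom D (FObj F X) (FObj F Y)" using FArr_Hom by blast
      show "Hom D (FObj F X) (FObj F Y) \<subseteq> FArr F ` Hom C X Y"
      proof
        fix h assume h: "h \<in> Hom D (FObj F X) (FObj F Y)"
        note [simp] = HomD[OF h]
        let ?f = "Inv C (\<eta> Y) \<cdot>\<^bsub>C\<^esub> (FArr G h \<cdot>\<^bsub>C\<^esub> \<eta> X)"
        have f: "?f \<in> Hom C X Y" by (simp add: Hom_iff)
        have "FArr G (FArr F ?f) \<cdot>\<^bsub>C\<^esub> \<eta> X = \<eta> Y \<cdot>\<^bsub>C\<^esub> ?f" using \<eta>N[OF f] by simp
        also have "\<dots> = FArr G h \<cdot>\<^bsub>C\<^esub> \<eta> X" by (simp add: source.Inv_cancel[OF \<eta>I[OF Y]])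
        finally have "FArr G (FArr F ?f) = FArr G h"
          using source.Iso_epi[OF \<eta>I[OF X] G.FArr_Hom[OF FArr_Hom[OF f]] G.FArr_Hom[OF h]] by blast
        then have "FArr F ?f = h" using counit_iso_faithful[OF F G \<epsilon> FArr_Hom[OF f] h] by blast
        then show "h \<in> FArr F ` Hom C X Y" using image_eqI[of h "FArr F" ?f] f by simp
      qed
    qed
  qed
qed

lemma equivalence_essentially_surjective:
  fixes C :: "('o, 'm, 'x) cat_scheme" and D :: "('p, 'n, 'y) cat_scheme"
    and F :: "('o, 'm, 'p, 'n, 'z) functor_data_scheme"
  assumes eq: "is_equivalence C D F" and Z: "Z \<in> Obj D"
  shows "\<exists>X\<in>Obj C. Iso D (FObj F X) Z \<noteq> {}"
proof -
  obtain G \<epsilon> where G: "category_functor D C (G :: ('p, 'n, 'o, 'm) functor_data)"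
    and \<epsilon>: "is_natural_iso D D (comp_functor F G) id_functor \<epsilon>"
    using eq unfolding is_equivalence_def by blast
  have "\<epsilon> Z \<in> Iso D (FObj F (FObj G Z)) Z"
    using \<epsilon> Z by (simp add: is_natural_iso_def id_functor_def comp_functor_def)
  then show ?thesis using category_functor.FObj_closed[OF G Z] by blast
qed

locale fusion_equivalence =
  source: fusion_category C + target: fusion_category D + monoidal_functor C D F + linear_functor C D F
  for C :: "('o, 'm, 'x) rigid_cat_scheme" and D :: "('p, 'n, 'y) rigid_cat_scheme"
    and F :: "('o, 'm, 'p, 'n, 'z) monoidal_functor_data_scheme" +
  assumes equivalence: "is_equivalence C D F"
begin

lemmas fully_faithful = equivalence_fully_faithful[OF equivalence]
lemmas essentially_surjective = equivalence_essentially_surjective[OF equivalence]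

lemma full:
  assumes "X \<in> Obj C" "Y \<in> Obj C" "h \<in> Hom D (FObj F X) (FObj F Y)"
  obtains f where "f \<in> Hom C X Y" "FArr F f = h"
proof -
  have "h \<in> FArr F ` Hom C X Y"
    using bij_betw_imp_surj_on[OF fully_faithful[OF assms(1,2)]] assms(3) by simp
  then show thesis using that by auto
qed

lemma faithful:
  assumes "f \<in> Hom C X Y" "g \<in> Hom C X Y" "FArr F f = FArr F g"
  shows "f = g"
  using bij_betw_imp_inj_on[OF fully_faithful] source.Hom_objs[OF assms(1)] assms by (meson inj_onD)

lemma FArr_scale_arr: "f \<in> Arr C \<Longrightarrow> FArr F (c \<star>\<^bsub>C\<^esub> f) = c \<star>\<^bsub>D\<^esub> FArr F f"
  using FArr_scale[of f "Dom C f" "Cod C f"] by (simp add: Hom_iff)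

lemma reflects_Iso:
  assumes X: "X \<in> Obj C" and Y: "Y \<in> Obj C" and u: "u \<in> Iso D (FObj F X) (FObj F Y)"
  shows "Iso C X Y \<noteq> {}"
proof -
  obtain f where f: "f \<in> Hom C X Y" "FArr F f = u" using full[OF X Y target.Iso_Hom[OF u]] .
  obtain g where g: "g \<in> Hom C Y X" "FArr F g = Inv D u"
    using full[OF Y X target.Iso_Hom[OF target.Inv_Iso[OF u]]] .
  have "f \<in> Iso C X Y"
  proof (rule source.IsoI[OF f(1) g(1)])
    show "g \<cdot>\<^bsub>C\<^esub> f = Ident C X"
      by (rule faithful[OF source.Comp_Hom[OF f(1) g(1)] source.Ident_Hom[OF X]])
        (use FArr_Comp[OF f(1) g(1)] f(2) g(2) target.Inv_simps(7)[OF u] FArr_Ident X in simp)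
    show "f \<cdot>\<^bsub>C\<^esub> g = Ident C Y"
      by (rule faithful[OF source.Comp_Hom[OF g(1) f(1)] source.Ident_Hom[OF Y]])
        (use FArr_Comp[OF g(1) f(1)] f(2) g(2) target.Inv_simps(8)[OF u] FArr_Ident Y in simp)
  qed
  then show ?thesis by blast
qed

lemma FObj_simple_iff:
  assumes X: "X \<in> Obj C"
  shows "is_simple D (FObj F X) \<longleftrightarrow> is_simple C X"
proof -
  have "(\<lambda>c. c \<star>\<^bsub>D\<^esub> Ident D (FObj F X)) = FArr F \<circ> (\<lambda>c. c \<star>\<^bsub>C\<^esub> Ident C X)"
    using X by (simp add: fun_eq_iff FArr_scale_arr FArr_Ident)
  moreover have "bij_betw (FArr F \<circ> (\<lambda>c. c \<star>\<^bsub>C\<^esub> Ident C X)) UNIV (Hom D (FObj F X) (FObj F X)) \<longleftrightarrow>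
      bij_betw (\<lambda>c. c \<star>\<^bsub>C\<^esub> Ident C X) UNIV (Hom C X X)"
    by (rule bij_betw_comp_iff2[OF fully_faithful[OF X X], symmetric]) (use X in \<open>auto simp: Hom_iff\<close>)
  ultimately show ?thesis using X by (simp add: is_simple_def)
qed

lemma hdim_FObj:
  assumes X: "X \<in> Obj C" and Y: "Y \<in> Obj C"
  shows "hdim C X Y = hdim D (FObj F X) (FObj F Y)"
  by (rule hdim_eqI[OF _ _ _ FArr_add FArr_scale fully_faithful[OF X Y]])
    (use X Y in \<open>auto simp: source.Hom_vectorspace target.Hom_vectorspace source.Hom_fin_dim\<close>)

end

context linear_category
begin

lemma simple_Iso_closed:
  assumes u: "u \<in> Iso C X Y" and Y: "is_simple C Y"
  shows "is_simple C X"
proof -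
  note [simp] = Inv_simps[OF u]
  have [simp]: "X \<in> Obj C" "Y \<in> Obj C" using Hom_objs[OF Iso_Hom[OF u]] by auto
  have "bij_betw (\<lambda>e. Inv C u \<cdot> (e \<cdot> u)) (Hom C Y Y) (Hom C X X)"
    by (rule bij_betw_byWitness[where f' = "\<lambda>e. u \<cdot> (e \<cdot> Inv C u)"])
      (auto simp: Hom_iff Inv_cancel[OF u])
  then have "bij_betw ((\<lambda>e. Inv C u \<cdot> (e \<cdot> u)) \<circ> (\<lambda>c. c \<star> Ident C Y)) UNIV (Hom C X X)"
    using Y bij_betw_trans unfolding is_simple_def by blast
  moreover have "(\<lambda>e. Inv C u \<cdot> (e \<cdot> u)) \<circ> (\<lambda>c. c \<star> Ident C Y) = (\<lambda>c. c \<star> Ident C X)"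
    by (simp add: fun_eq_iff)
  ultimately show ?thesis by (simp add: is_simple_def)
qed

end

section \<open>Frobenius-Perron dimensions under equivalences\<close>

text \<open>The matrices are conjugate by the permutation \<open>\<sigma>\<close>, which carries
  eigenvectors to eigenvectors.\<close>

lemma eigenvalue_reindex_imp:
  assumes A: "A \<in> carrier_mat n n" and B: "B \<in> carrier_mat m m" and \<sigma>: "bij_betw \<sigma> {..<n} {..<m}"
    and AB: "\<And>i k. i < n \<Longrightarrow> k < n \<Longrightarrow> B $$ (\<sigma> i, \<sigma> k) = A $$ (i, k)"
    and ev: "eigenvalue A (r :: 'a :: comm_ring_1)"
  shows "eigenvalue B r"
proof -
  obtain v where v: "v \<in> carrier_vec n" "v \<noteq> 0\<^sub>v n" "A *\<^sub>v v = r \<cdot>\<^sub>v v"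
    using ev A unfolding eigenvalue_def eigenvector_def by auto
  define \<tau> where "\<tau> = inv_into {..<n} \<sigma>"
  have \<tau>: "\<tau> j < n" "\<sigma> (\<tau> j) = j" if "j < m" for j
    using that \<sigma> f_inv_into_f[of j \<sigma> "{..<n}"] inv_into_into[of j \<sigma> "{..<n}"]
    by (auto simp: \<tau>_def bij_betw_def)
  have \<sigma>n: "\<sigma> k < m" "\<tau> (\<sigma> k) = k" if "k < n" for k
    using that \<sigma> by (auto simp: \<tau>_def bij_betw_def)
  define w where "w = vec m (\<lambda>j. v $ \<tau> j)"
  have wc: "w \<in> carrier_vec m" by (simp add: w_def)
  obtain k where k: "k < n" "v $ k \<noteq> 0" using v(1,2) by (metis carrier_vecD eq_vecI index_zero_vec)
  have "w $ \<sigma> k \<noteq> 0" using k \<sigma>n by (simp add: w_def)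
  then have "w \<noteq> 0\<^sub>v m" using \<sigma>n k by auto
  moreover have "B *\<^sub>v w = r \<cdot>\<^sub>v w"
  proof
    fix j assume "j < dim_vec (r \<cdot>\<^sub>v w)"
    then have j: "j < m" using wc by simp
    have "(B *\<^sub>v w) $ j = (\<Sum>l<m. B $$ (j, l) * w $ l)"
      using j B wc by (simp add: scalar_prod_def atLeast0LessThan)
    also have "\<dots> = (\<Sum>k<n. B $$ (j, \<sigma> k) * w $ \<sigma> k)"
      by (rule sum.reindex_bij_betw[OF \<sigma>, symmetric])
    also have "\<dots> = (\<Sum>k<n. A $$ (\<tau> j, k) * v $ k)"
      using AB[OF \<tau>(1)[OF j]] \<tau>(2)[OF j] \<sigma>n by (intro sum.cong) (auto simp: w_def)
    also have "\<dots> = (A *\<^sub>v v) $ \<tau> j"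
      using \<tau>(1)[OF j] A v(1) by (simp add: scalar_prod_def atLeast0LessThan)
    also have "\<dots> = (r \<cdot>\<^sub>v w) $ j" unfolding v(3) using v(1) j \<tau>(1)[OF j] by (simp add: w_def)
    finally show "(B *\<^sub>v w) $ j = (r \<cdot>\<^sub>v w) $ j" .
  qed (use B wc in simp)
  ultimately show ?thesis using B wc unfolding eigenvalue_def eigenvector_def by auto
qed

lemma eigenvalue_reindex:
  assumes A: "A \<in> carrier_mat n n" and B: "B \<in> carrier_mat m m" and \<sigma>: "bij_betw \<sigma> {..<n} {..<m}"
    and AB: "\<And>i k. i < n \<Longrightarrow> k < n \<Longrightarrow> B $$ (\<sigma> i, \<sigma> k) = A $$ (i, k)"
  shows "eigenvalue A (r :: 'a :: comm_ring_1) \<longleftrightarrow> eigenvalue B r"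
proof
  show "eigenvalue B r" if "eigenvalue A r" using eigenvalue_reindex_imp[OF A B \<sigma> AB that] .
  let ?\<tau> = "inv_into {..<n} \<sigma>"
  have "?\<tau> j < n \<and> \<sigma> (?\<tau> j) = j" if "j < m" for j
    using that \<sigma> f_inv_into_f[of j \<sigma> "{..<n}"] inv_into_into[of j \<sigma> "{..<n}"]
    by (auto simp: bij_betw_def)
  then have "A $$ (?\<tau> i, ?\<tau> k) = B $$ (i, k)" if "i < m" "k < m" for i k
    using AB[of "?\<tau> i" "?\<tau> k"] that by simp
  then show "eigenvalue A r" if "eigenvalue B r"
    using eigenvalue_reindex_imp[OF B A bij_betw_inv_into[OF \<sigma>] _ that] by blast
qed

context fusion_equivalence
begin

text \<open>A map of representatives exists because images of simple objects are simple. It is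
  injective because \<open>F\<close> reflects isomorphy, and surjective because \<open>F\<close> is
  essentially surjective and reflects simplicity.\<close>

lemma simple_reps_matching:
  obtains \<sigma> where "bij_betw \<sigma> {..<length (simple_reps C)} {..<length (simple_reps D)}"
    "\<And>k. k < length (simple_reps C) \<Longrightarrow> Iso D (FObj F (simple_reps C ! k)) (simple_reps D ! \<sigma> k) \<noteq> {}"
proof -
  let ?n = "length (simple_reps C)" and ?m = "length (simple_reps D)"
  note reps = source.is_simple_reps_simple_reps target.is_simple_reps_simple_reps
  have "\<exists>j<?m. Iso D (FObj F (simple_reps C ! k)) (simple_reps D ! j) \<noteq> {}" if "k < ?n" for k
  proof -
    have "is_simple D (FObj F (simple_reps C ! k))"
      using FObj_simple_iff source.simple_reps_nth[OF that] by blast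
    then show ?thesis using reps(2) unfolding is_simple_reps_def by (metis in_set_conv_nth)
  qed
  then obtain \<sigma> where \<sigma>: "\<And>k. k < ?n \<Longrightarrow> \<sigma> k < ?m"
      "\<And>k. k < ?n \<Longrightarrow> Iso D (FObj F (simple_reps C ! k)) (simple_reps D ! \<sigma> k) \<noteq> {}"
    by metis
  have "inj_on \<sigma> {..<?n}"
  proof (rule inj_onI, rule ccontr)
    fix i k assume ik: "i \<in> {..<?n}" "k \<in> {..<?n}" "\<sigma> i = \<sigma> k" "i \<noteq> k"
    obtain u where u: "u \<in> Iso D (FObj F (simple_reps C ! i)) (simple_reps D ! \<sigma> i)" using \<sigma>(2)[of i] ik by auto
    obtain v where v: "v \<in> Iso D (FObj F (simple_reps C ! k)) (simple_reps D ! \<sigma> i)" using \<sigma>(2)[of k] ik by auto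
    have "Iso C (simple_reps C ! i) (simple_reps C ! k) \<noteq> {}"
      using reflects_Iso[OF _ _ target.Comp_Iso[OF u target.Inv_Iso[OF v]]] source.simple_reps_nth ik by auto
    then show False using reps(1) ik unfolding is_simple_reps_def by auto
  qed
  moreover have "{..<?m} \<subseteq> \<sigma> ` {..<?n}"
  proof
    fix j assume j: "j \<in> {..<?m}"
    let ?W = "simple_reps D ! j"
    have W: "is_simple D ?W" "?W \<in> Obj D" using target.simple_reps_nth j by auto
    obtain X u where X: "X \<in> Obj C" and u: "u \<in> Iso D (FObj F X) ?W"
      using essentially_surjective[OF W(2)] by blast
    have "is_simple C X" using FObj_simple_iff[OF X] target.simple_Iso_closed[OF u W(1)] by blast
    then obtain k v where k: "k < ?n" and v: "v \<in> Iso C X (simple_reps C ! k)"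
      using reps(1) unfolding is_simple_reps_def by (metis in_set_conv_nth ex_in_conv)
    obtain w where w: "w \<in> Iso D (FObj F (simple_reps C ! k)) (simple_reps D ! \<sigma> k)" using \<sigma>(2)[OF k] by auto
    have "Iso D ?W (simple_reps D ! \<sigma> k) \<noteq> {}"
      using target.Comp_Iso[OF target.Comp_Iso[OF target.Inv_Iso[OF u] FArr_Iso[OF v]] w] by blast
    then have "\<sigma> k = j" using reps(2) j \<sigma>(1)[OF k] unfolding is_simple_reps_def by (metis lessThan_iff)
    then show "j \<in> \<sigma> ` {..<?n}" using k by blast
  qed
  ultimately have "bij_betw \<sigma> {..<?n} {..<?m}" using \<sigma>(1) by (auto simp: bij_betw_def)
  then show thesis using \<sigma>(2) that by blast
qed

text \<open>Under the matching of simple objects the fusion matrices have the same entries, since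
  these are dimensions of spaces of arrows; so the matrices have the same eigenvalues.\<close>

lemma FPdim_FObj:
  assumes V: "V \<in> Obj C"
  shows "FPdim D (FObj F V) = FPdim C V"
proof -
  let ?n = "length (simple_reps C)" and ?m = "length (simple_reps D)"
  obtain \<sigma> where \<sigma>: "bij_betw \<sigma> {..<?n} {..<?m}"
    and iso: "\<And>k. k < ?n \<Longrightarrow> Iso D (FObj F (simple_reps C ! k)) (simple_reps D ! \<sigma> k) \<noteq> {}"
    using simple_reps_matching by blast
  have \<sigma>m: "\<sigma> k < ?m" if "k < ?n" for k using \<sigma> that by (auto simp: bij_betw_def)
  have "fusion_matrix D (FObj F V) $$ (\<sigma> i, \<sigma> k) = fusion_matrix C V $$ (i, k)" if i: "i < ?n" and k: "k < ?n" for i k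
  proof -
    let ?Vi = "simple_reps C ! i" and ?Vk = "simple_reps C ! k"
    let ?Wi = "simple_reps D ! \<sigma> i" and ?Wk = "simple_reps D ! \<sigma> k"
    have [simp]: "?Vi \<in> Obj C" "?Vk \<in> Obj C" "?Wi \<in> Obj D" "?Wk \<in> Obj D" "V \<in> Obj C"
      using source.simple_reps_nth target.simple_reps_nth i k \<sigma>m V by auto
    obtain u where u: "u \<in> Iso D (FObj F ?Vi) ?Wi" using iso[OF i] by blast
    obtain w where w: "w \<in> Iso D (FObj F ?Vk) ?Wk" using iso[OF k] by blast
    note [simp] = target.Inv_simps[OF u]
    have t: "Ident D (FObj F V) \<boxdot>\<^bsub>D\<^esub> u \<in> Iso D (FObj F V \<boxtimes>\<^bsub>D\<^esub> FObj F ?Vi) (FObj F V \<boxtimes>\<^bsub>D\<^esub> ?Wi)"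
      by (rule target.IsoI[of _ _ _ "Ident D (FObj F V) \<boxdot>\<^bsub>D\<^esub> Inv D u"])
        (simp_all add: Hom_iff target.interchange)
    have "hdim D ?Wk (FObj F V \<boxtimes>\<^bsub>D\<^esub> ?Wi) = hdim D (FObj F ?Vk) (FObj F V \<boxtimes>\<^bsub>D\<^esub> ?Wi)"
      by (rule target.hdim_Iso_left[OF _ w]) simp
    also have "\<dots> = hdim D (FObj F ?Vk) (FObj F V \<boxtimes>\<^bsub>D\<^esub> FObj F ?Vi)"
      by (rule target.hdim_Iso_right[OF _ t, symmetric]) simp
    also have "\<dots> = hdim D (FObj F ?Vk) (FObj F (V \<boxtimes>\<^bsub>C\<^esub> ?Vi))"
      by (rule target.hdim_Iso_right[OF _ FTensor_Iso]) simp_all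
    also have "\<dots> = hdim C ?Vk (V \<boxtimes>\<^bsub>C\<^esub> ?Vi)" by (rule hdim_FObj[symmetric]) simp_all
    finally show ?thesis using i k \<sigma>m
      by (simp add: fusion_matrix_def source.fusion_coeff_eq_hdim target.fusion_coeff_eq_hdim)
  qed
  then have "eigenvalue (fusion_matrix C V) r \<longleftrightarrow> eigenvalue (fusion_matrix D (FObj F V)) r" for r
    by (intro eigenvalue_reindex[OF _ _ \<sigma>]) (simp_all add: fusion_matrix_def)
  then show ?thesis by (simp add: FPdim_def)
qed

end

section \<open>Pivotal traces\<close>

context fusion_category
begin

lemma unit_scalar_Scale [simp]: "unit_scalar C (c \<star> Ident C (UnitObj C)) = c"
  unfolding unit_scalar_def by (rule the_equality) (use simple_scalar_inj[OF unit_simple] in auto)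

lemma ptrace_Scale_unit:
  assumes V: "V \<in> Obj C" and a: "a \<in> Hom C V (Dual C (Dual C V))"
  shows "Ev C (Dual C V) \<cdot> (a \<boxdot> Ident C (Dual C V)) \<cdot> Db C V = ptrace C V a \<star> Ident C (UnitObj C)"
proof -
  note [simp] = V HomD[OF a]
  have "Ev C (Dual C V) \<cdot> (a \<boxdot> Ident C (Dual C V)) \<cdot> Db C V \<in> Hom C (UnitObj C) (UnitObj C)"
    by (simp add: Hom_iff)
  from simple_endo_scalar[OF unit_simple this]
  obtain c where "Ev C (Dual C V) \<cdot> (a \<boxdot> Ident C (Dual C V)) \<cdot> Db C V = c \<star> Ident C (UnitObj C)" .
  then show ?thesis by (simp add: ptrace_def)
qed

lemma Scale_TensorArr:
  "f \<in> Arr C \<Longrightarrow> g \<in> Arr C \<Longrightarrow> (c \<star> f) \<boxdot> g = c \<star> (f \<boxdot> g)"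
  using Tensor_scale_left[of f "Dom C f" "Cod C f" g "Dom C g" "Cod C g"] by (simp add: Hom_iff)

text \<open>If the coevaluation vanished, so would the identity of \<open>V\<close>, by the first
  snake identity.\<close>

lemma Db_nonzero:
  assumes V: "is_simple C V"
  shows "Db C V \<noteq> ZeroArr C (UnitObj C) (V \<boxtimes> Dual C V)"
proof
  assume z: "Db C V = ZeroArr C (UnitObj C) (V \<boxtimes> Dual C V)"
  note [simp] = simple_Obj[OF V]
  have "Db C V = 0 \<star> Db C V" using z by simp
  then have "Db C V \<boxdot> Ident C V = 0 \<star> (Db C V \<boxdot> Ident C V)"
    using Scale_TensorArr[of "Db C V" "Ident C V" 0] by simp
  then have t: "Db C V \<boxdot> Ident C V = ZeroArr C V ((V \<boxtimes> Dual C V) \<boxtimes> V)" by simp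
  have "Ident C V = (Ident C V \<boxdot> Ev C V) \<cdot> Assoc C V (Dual C V) V \<cdot> (Db C V \<boxdot> Ident C V)"
    using left_dual[of V] by (simp add: is_left_dual_def del: Comp_assoc_arr)
  also have "\<dots> = ZeroArr C V V" unfolding t by simp
  finally show False using simple_Ident_nonzero[OF V] by simp
qed

lemma simple_Iso_multiple:
  assumes V: "is_simple C V" and j: "j \<in> Iso C V W" and a: "a \<in> Hom C V W"
  obtains c where "a = c \<star> j"
proof -
  note [simp] = simple_Obj[OF V] Inv_simps[OF j] HomD[OF a]
  have "Inv C j \<cdot> a \<in> Hom C V V" by (simp add: Hom_iff)
  from simple_endo_scalar[OF V this] obtain c where c: "Inv C j \<cdot> a = c \<star> Ident C V" .
  have "a = j \<cdot> (Inv C j \<cdot> a)" by (simp add: Inv_cancel[OF j])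
  also have "\<dots> = c \<star> j" unfolding c by simp
  finally show thesis by (rule that)
qed

text \<open>Pairings of \<open>V\<close> with its dual correspond to arrows from \<open>V\<close> to
  its double dual, and those are the multiples of the given isomorphism.\<close>

lemma simple_pairing_multiple:
  assumes V: "is_simple C V" and j: "j \<in> Iso C V (Dual C (Dual C V))"
    and h: "h \<in> Hom C (V \<boxtimes> Dual C V) (UnitObj C)"
  obtains c where "h = c \<star> (Ev C (Dual C V) \<cdot> (j \<boxdot> Ident C (Dual C V)))"
proof -
  note [simp] = simple_Obj[OF V] Inv_simps[OF j]
  obtain a where a: "a \<in> Hom C V (Dual C (Dual C V))" and ah: "Ev C (Dual C V) \<cdot> (a \<boxdot> Ident C (Dual C V)) = h"
    using pairing_transpose_exists[OF left_dual[OF Dual_closed] h] by auto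
  obtain c where "a = c \<star> j" using simple_Iso_multiple[OF V j a] .
  then have "h = c \<star> (Ev C (Dual C V) \<cdot> (j \<boxdot> Ident C (Dual C V)))"
    unfolding ah[symmetric] by (simp add: Scale_TensorArr)
  then show thesis by (rule that)
qed

text \<open>The coevaluation of a simple object has a retraction. The retraction is a multiple of
  the pairing given by \<open>j\<close>, so that pairing cannot vanish on the coevaluation, and its
  value there is the trace.\<close>

lemma ptrace_simple_nonzero:
  assumes V: "is_simple C V" and j: "j \<in> Iso C V (Dual C (Dual C V))"
  shows "ptrace C V j \<noteq> 0"
proof
  assume z: "ptrace C V j = 0"
  note [simp] = simple_Obj[OF V] Inv_simps[OF j]
  have "Db C V \<in> Hom C (UnitObj C) (V \<boxtimes> Dual C V)" by (simp add: Hom_iff)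
  then obtain r where r: "r \<in> Hom C (V \<boxtimes> Dual C V) (UnitObj C)" and rd: "r \<cdot> Db C V = Ident C (UnitObj C)"
    using nonzero_from_simple_splits[OF unit_simple _ Db_nonzero[OF V]] by blast
  obtain c where c: "r = c \<star> (Ev C (Dual C V) \<cdot> (j \<boxdot> Ident C (Dual C V)))"
    using simple_pairing_multiple[OF V j r] .
  have "Ident C (UnitObj C) = c \<star> (Ev C (Dual C V) \<cdot> (j \<boxdot> Ident C (Dual C V)) \<cdot> Db C V)"
    unfolding rd[symmetric] c by simp
  also have "\<dots> = ZeroArr C (UnitObj C) (UnitObj C)"
    using ptrace_Scale_unit[OF _ Iso_Hom[OF j]] z by simp
  finally show False using simple_Ident_nonzero[OF unit_simple] by simp
qed

end

section \<open>The duality transformation\<close>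

context fusion_equivalence
begin

abbreviation "duality \<equiv> duality_transformation C D F"

lemma FTensor_arr [simp]:
  assumes "V \<in> Obj C" "W \<in> Obj C"
  shows "FTensor F V W \<in> Arr D" "Dom D (FTensor F V W) = FObj F V \<boxtimes>\<^bsub>D\<^esub> FObj F W"
    "Cod D (FTensor F V W) = FObj F (V \<boxtimes>\<^bsub>C\<^esub> W)"
    "Inv D (FTensor F V W) \<in> Arr D" "Dom D (Inv D (FTensor F V W)) = FObj F (V \<boxtimes>\<^bsub>C\<^esub> W)"
    "Cod D (Inv D (FTensor F V W)) = FObj F V \<boxtimes>\<^bsub>D\<^esub> FObj F W"
    "Inv D (FTensor F V W) \<cdot>\<^bsub>D\<^esub> FTensor F V W = Ident D (FObj F V \<boxtimes>\<^bsub>D\<^esub> FObj F W)"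
    "FTensor F V W \<cdot>\<^bsub>D\<^esub> Inv D (FTensor F V W) = Ident D (FObj F (V \<boxtimes>\<^bsub>C\<^esub> W))"
  using target.Inv_simps[OF FTensor_Iso[OF assms]] by auto

lemma FTensor_cancel [simp]:
  assumes "V \<in> Obj C" "W \<in> Obj C" "h \<in> Arr D"
  shows "Cod D h = FObj F (V \<boxtimes>\<^bsub>C\<^esub> W) \<Longrightarrow> FTensor F V W \<cdot>\<^bsub>D\<^esub> (Inv D (FTensor F V W) \<cdot>\<^bsub>D\<^esub> h) = h"
    "Cod D h = FObj F V \<boxtimes>\<^bsub>D\<^esub> FObj F W \<Longrightarrow> Inv D (FTensor F V W) \<cdot>\<^bsub>D\<^esub> (FTensor F V W \<cdot>\<^bsub>D\<^esub> h) = h"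
  using target.Inv_cancel[OF FTensor_Iso[OF assms(1,2)] assms(3)] by auto

declare FObj_UnitObj [simp] FArr_Ident [simp]

lemma FTensor_nat:
  "f \<in> Arr C \<Longrightarrow> g \<in> Arr C \<Longrightarrow> FTensor F (Cod C f) (Cod C g) \<cdot>\<^bsub>D\<^esub> (FArr F f \<boxdot>\<^bsub>D\<^esub> FArr F g) =
    FArr F (f \<boxdot>\<^bsub>C\<^esub> g) \<cdot>\<^bsub>D\<^esub> FTensor F (Dom C f) (Dom C g)"
  using FTensor_natural[of f "Dom C f" "Cod C f" g "Dom C g" "Cod C g"] by (simp add: Hom_iff)

lemma duality_transformation_props:
  assumes X: "X \<in> Obj C"
  shows "duality X \<in> Hom D (FObj F (Dual C X)) (Dual D (FObj F X))"
    "Ev D (FObj F X) \<cdot>\<^bsub>D\<^esub> (duality X \<boxdot>\<^bsub>D\<^esub> Ident D (FObj F X)) = FArr F (Ev C X) \<cdot>\<^bsub>D\<^esub> FTensor F (Dual C X) X"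
proof -
  note [simp] = X
  have "\<exists>!t. t \<in> Hom D (FObj F (Dual C X)) (Dual D (FObj F X)) \<and>
      Ev D (FObj F X) \<cdot>\<^bsub>D\<^esub> (t \<boxdot>\<^bsub>D\<^esub> Ident D (FObj F X)) = FArr F (Ev C X) \<cdot>\<^bsub>D\<^esub> FTensor F (Dual C X) X"
    by (rule target.pairing_transpose_ex1[OF target.left_dual]) (simp_all add: Hom_iff)
  from theI'[OF this] show "duality X \<in> Hom D (FObj F (Dual C X)) (Dual D (FObj F X))"
    "Ev D (FObj F X) \<cdot>\<^bsub>D\<^esub> (duality X \<boxdot>\<^bsub>D\<^esub> Ident D (FObj F X)) = FArr F (Ev C X) \<cdot>\<^bsub>D\<^esub> FTensor F (Dual C X) X"
    by (simp_all add: duality_transformation_def)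
qed

text \<open>This is \<open>F\<close> applied to the first snake identity of \<open>X\<close>:
  coherence moves the associator through \<open>F\<close>, and naturality collects the evaluation
  and the coevaluation. So the image of a dual of \<open>X\<close> is a dual of the image of
  \<open>X\<close>.\<close>

lemma image_dual_snake:
  assumes X: "X \<in> Obj C"
  defines "X' \<equiv> Dual C X"
  shows "(Ident D (FObj F X) \<boxdot>\<^bsub>D\<^esub> (FArr F (Ev C X) \<cdot>\<^bsub>D\<^esub> FTensor F X' X)) \<cdot>\<^bsub>D\<^esub>
      Assoc D (FObj F X) (FObj F X') (FObj F X) \<cdot>\<^bsub>D\<^esub>
      ((Inv D (FTensor F X X') \<cdot>\<^bsub>D\<^esub> FArr F (Db C X)) \<boxdot>\<^bsub>D\<^esub> Ident D (FObj F X)) = Ident D (FObj F X)"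
proof -
  note [simp] = X
  have [simp]: "X' \<in> Obj C" "Dom C (Ev C X) = X' \<boxtimes>\<^bsub>C\<^esub> X" "Cod C (Db C X) = X \<boxtimes>\<^bsub>C\<^esub> X'"
    by (simp_all add: X'_def)
  let ?FX = "Ident D (FObj F X)"
  have 1: "?FX \<boxdot>\<^bsub>D\<^esub> FArr F (Ev C X) = FArr F (Ident C X \<boxdot>\<^bsub>C\<^esub> Ev C X) \<cdot>\<^bsub>D\<^esub> FTensor F X (X' \<boxtimes>\<^bsub>C\<^esub> X)"
    using FTensor_nat[of "Ident C X" "Ev C X"] by (simp add: FTensor_unit_right)
  have 2: "FTensor F (X \<boxtimes>\<^bsub>C\<^esub> X') X \<cdot>\<^bsub>D\<^esub> (FArr F (Db C X) \<boxdot>\<^bsub>D\<^esub> ?FX) = FArr F (Db C X \<boxdot>\<^bsub>C\<^esub> Ident C X)"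
    using FTensor_nat[of "Db C X" "Ident C X"] by (simp add: FTensor_unit_left)
  have "(?FX \<boxdot>\<^bsub>D\<^esub> (FArr F (Ev C X) \<cdot>\<^bsub>D\<^esub> FTensor F X' X)) \<cdot>\<^bsub>D\<^esub>
      Assoc D (FObj F X) (FObj F X') (FObj F X) \<cdot>\<^bsub>D\<^esub>
      ((Inv D (FTensor F X X') \<cdot>\<^bsub>D\<^esub> FArr F (Db C X)) \<boxdot>\<^bsub>D\<^esub> ?FX) =
    (?FX \<boxdot>\<^bsub>D\<^esub> FArr F (Ev C X)) \<cdot>\<^bsub>D\<^esub> ((?FX \<boxdot>\<^bsub>D\<^esub> FTensor F X' X) \<cdot>\<^bsub>D\<^esub>
      (Assoc D (FObj F X) (FObj F X') (FObj F X) \<cdot>\<^bsub>D\<^esub>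
      ((Inv D (FTensor F X X') \<cdot>\<^bsub>D\<^esub> FArr F (Db C X)) \<boxdot>\<^bsub>D\<^esub> ?FX)))"
    by (simp add: target.interchange_assoc)
  also have "\<dots> = FArr F (Ident C X \<boxdot>\<^bsub>C\<^esub> Ev C X) \<cdot>\<^bsub>D\<^esub> ((FTensor F X (X' \<boxtimes>\<^bsub>C\<^esub> X) \<cdot>\<^bsub>D\<^esub> (?FX \<boxdot>\<^bsub>D\<^esub> FTensor F X' X) \<cdot>\<^bsub>D\<^esub>
      Assoc D (FObj F X) (FObj F X') (FObj F X)) \<cdot>\<^bsub>D\<^esub>
      ((Inv D (FTensor F X X') \<cdot>\<^bsub>D\<^esub> FArr F (Db C X)) \<boxdot>\<^bsub>D\<^esub> ?FX))"
    unfolding 1 by simp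
  also have "\<dots> = FArr F (Ident C X \<boxdot>\<^bsub>C\<^esub> Ev C X) \<cdot>\<^bsub>D\<^esub> ((FArr F (Assoc C X X' X) \<cdot>\<^bsub>D\<^esub> FTensor F (X \<boxtimes>\<^bsub>C\<^esub> X') X \<cdot>\<^bsub>D\<^esub>
      (FTensor F X X' \<boxdot>\<^bsub>D\<^esub> ?FX)) \<cdot>\<^bsub>D\<^esub> ((Inv D (FTensor F X X') \<cdot>\<^bsub>D\<^esub> FArr F (Db C X)) \<boxdot>\<^bsub>D\<^esub> ?FX))"
    by (simp only: FTensor_coherent \<open>X' \<in> Obj C\<close> X)
  also have "\<dots> = FArr F (Ident C X \<boxdot>\<^bsub>C\<^esub> Ev C X) \<cdot>\<^bsub>D\<^esub> (FArr F (Assoc C X X' X) \<cdot>\<^bsub>D\<^esub>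
      (FTensor F (X \<boxtimes>\<^bsub>C\<^esub> X') X \<cdot>\<^bsub>D\<^esub> (FArr F (Db C X) \<boxdot>\<^bsub>D\<^esub> ?FX)))"
    by (simp add: target.interchange)
  also have "\<dots> = FArr F ((Ident C X \<boxdot>\<^bsub>C\<^esub> Ev C X) \<cdot>\<^bsub>C\<^esub> Assoc C X X' X \<cdot>\<^bsub>C\<^esub> (Db C X \<boxdot>\<^bsub>C\<^esub> Ident C X))"
    unfolding 2 by (simp add: FArr_Comp_arr)
  also have "\<dots> = ?FX"
    using source.left_dual[OF X] by (simp add: is_left_dual_def X'_def del: source.Comp_assoc_arr)
  finally show ?thesis .
qed

text \<open>The duality transformation compares two duals of \<open>F X\<close> through their
  evaluations, hence also through their coevaluations.\<close>

lemma duality_transformation_Db: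
  assumes X: "X \<in> Obj C"
  shows "(Ident D (FObj F X) \<boxdot>\<^bsub>D\<^esub> duality X) \<cdot>\<^bsub>D\<^esub> (Inv D (FTensor F X (Dual C X)) \<cdot>\<^bsub>D\<^esub> FArr F (Db C X)) = Db D (FObj F X)"
  by (rule target.copairing_transport[OF target.left_dual duality_transformation_props[OF X] _ image_dual_snake[OF X]])
    (use X in \<open>simp_all add: Hom_iff\<close>)

text \<open>Both sides induce the same pairing of \<open>F(Y\<^sup>\<or>)\<close> with \<open>F
  X\<close>.\<close>

lemma duality_transformation_natural:
  assumes f: "f \<in> Hom C X Y"
  shows "DualArr D (FArr F f) \<cdot>\<^bsub>D\<^esub> duality Y = duality X \<cdot>\<^bsub>D\<^esub> FArr F (DualArr C f)"
proof -
  have [simp]: "X \<in> Obj C" "Y \<in> Obj C" using source.Hom_objs[OF f] by auto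
  note f' = source.DualArr_props[OF f] and Ff' = target.DualArr_props[OF FArr_Hom[OF f]]
  note tX = duality_transformation_props[of X] and tY = duality_transformation_props[of Y]
  note [simp] = HomD[OF f] HomD[OF f'(1)] HomD[OF Ff'(1)] HomD[OF tX(1)] HomD[OF tY(1)]
  let ?FX = "Ident D (FObj F X)"
  have "Ev D (FObj F X) \<cdot>\<^bsub>D\<^esub> ((DualArr D (FArr F f) \<cdot>\<^bsub>D\<^esub> duality Y) \<boxdot>\<^bsub>D\<^esub> ?FX) =
      (Ev D (FObj F X) \<cdot>\<^bsub>D\<^esub> (DualArr D (FArr F f) \<boxdot>\<^bsub>D\<^esub> ?FX)) \<cdot>\<^bsub>D\<^esub> (duality Y \<boxdot>\<^bsub>D\<^esub> ?FX)"
    by (simp add: target.interchange)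
  also have "\<dots> = (Ev D (FObj F Y) \<cdot>\<^bsub>D\<^esub> (duality Y \<boxdot>\<^bsub>D\<^esub> Ident D (FObj F Y))) \<cdot>\<^bsub>D\<^esub> (Ident D (FObj F (Dual C Y)) \<boxdot>\<^bsub>D\<^esub> FArr F f)"
    unfolding Ff'(2) by (simp add: target.interchange)
  also have "\<dots> = FArr F (Ev C Y) \<cdot>\<^bsub>D\<^esub> (FTensor F (Dual C Y) Y \<cdot>\<^bsub>D\<^esub> (FArr F (Ident C (Dual C Y)) \<boxdot>\<^bsub>D\<^esub> FArr F f))"
    unfolding tY(2)[OF \<open>Y \<in> Obj C\<close>] by simp
  also have "\<dots> = FArr F (Ev C Y) \<cdot>\<^bsub>D\<^esub> (FArr F (Ident C (Dual C Y) \<boxdot>\<^bsub>C\<^esub> f) \<cdot>\<^bsub>D\<^esub> FTensor F (Dual C Y) X)"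
    using FTensor_nat[of "Ident C (Dual C Y)" f] by simp
  also have "\<dots> = FArr F (Ev C Y \<cdot>\<^bsub>C\<^esub> (Ident C (Dual C Y) \<boxdot>\<^bsub>C\<^esub> f)) \<cdot>\<^bsub>D\<^esub> FTensor F (Dual C Y) X"
    by (simp add: FArr_Comp_arr)
  also have "\<dots> = FArr F (Ev C X) \<cdot>\<^bsub>D\<^esub> (FArr F (DualArr C f \<boxdot>\<^bsub>C\<^esub> Ident C X) \<cdot>\<^bsub>D\<^esub> FTensor F (Dual C Y) X)"
    unfolding f'(2)[symmetric] by (simp add: FArr_Comp_arr)
  also have "\<dots> = FArr F (Ev C X) \<cdot>\<^bsub>D\<^esub> (FTensor F (Dual C X) X \<cdot>\<^bsub>D\<^esub> (FArr F (DualArr C f) \<boxdot>\<^bsub>D\<^esub> ?FX))"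
    using FTensor_nat[of "DualArr C f" "Ident C X"] by simp
  also have "\<dots> = (Ev D (FObj F X) \<cdot>\<^bsub>D\<^esub> (duality X \<boxdot>\<^bsub>D\<^esub> ?FX)) \<cdot>\<^bsub>D\<^esub> (FArr F (DualArr C f) \<boxdot>\<^bsub>D\<^esub> ?FX)"
    unfolding tX(2)[OF \<open>X \<in> Obj C\<close>] by simp
  also have "\<dots> = Ev D (FObj F X) \<cdot>\<^bsub>D\<^esub> ((duality X \<cdot>\<^bsub>D\<^esub> FArr F (DualArr C f)) \<boxdot>\<^bsub>D\<^esub> ?FX)"
    by (simp add: target.interchange)
  finally show ?thesis
    by (rule target.pairing_cancel[OF target.left_dual, rotated -1]) (simp_all add: Hom_iff)
qed

end

section \<open>Transport of pivotal pairings\<close>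

locale fusion_equivalence_pivotal = fusion_equivalence C D F
  for C :: "('o, 'm, 'x) rigid_cat_scheme" and D :: "('p, 'n, 'y) rigid_cat_scheme"
    and F :: "('o, 'm, 'p, 'n, 'z) monoidal_functor_data_scheme" +
  fixes jC :: "'o \<Rightarrow> 'm" and jD :: "'p \<Rightarrow> 'n"
  assumes jC: "is_pivotal_structure C jC" and jD: "is_pivotal_structure D jD"
begin

lemma jC_Iso: "V \<in> Obj C \<Longrightarrow> jC V \<in> Iso C V (Dual C (Dual C V))"
  using jC by (simp add: is_pivotal_structure_def)

lemma jD_Iso: "V \<in> Obj D \<Longrightarrow> jD V \<in> Iso D V (Dual D (Dual D V))"
  using jD by (simp add: is_pivotal_structure_def)

lemma jC_natural: "f \<in> Hom C V W \<Longrightarrow> jC W \<cdot>\<^bsub>C\<^esub> f = DualArr C (DualArr C f) \<cdot>\<^bsub>C\<^esub> jC V"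
  using jC by (simp add: is_pivotal_structure_def)

lemma jD_natural: "f \<in> Hom D V W \<Longrightarrow> jD W \<cdot>\<^bsub>D\<^esub> f = DualArr D (DualArr D f) \<cdot>\<^bsub>D\<^esub> jD V"
  using jD by (simp add: is_pivotal_structure_def)

lemma j_arr [simp]:
  "V \<in> Obj C \<Longrightarrow> jC V \<in> Arr C" "V \<in> Obj C \<Longrightarrow> Dom C (jC V) = V"
  "V \<in> Obj C \<Longrightarrow> Cod C (jC V) = Dual C (Dual C V)"
  "W \<in> Obj D \<Longrightarrow> jD W \<in> Arr D" "W \<in> Obj D \<Longrightarrow> Dom D (jD W) = W"
  "W \<in> Obj D \<Longrightarrow> Cod D (jD W) = Dual D (Dual D W)"
  using source.Inv_simps[OF jC_Iso] target.Inv_simps[OF jD_Iso] by auto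

lemma duality_arr [simp]:
  assumes "X \<in> Obj C"
  shows "duality X \<in> Arr D" "Dom D (duality X) = FObj F (Dual C X)" "Cod D (duality X) = Dual D (FObj F X)"
  using HomD[OF duality_transformation_props(1)[OF assms]] by auto

text \<open>The two sides of the condition that \<open>F\<close> preserves pivotal structures are
  arrows from \<open>F X\<close> to the dual of \<open>F(X\<^sup>\<or>)\<close>, called comparisons
  below. Their transposes are the following pairings of \<open>F X\<close> with
  \<open>F(X\<^sup>\<or>)\<close>. The pairings no longer involve the dual of a duality
  transformation, and for a simple object they live in a one-dimensional space.\<close>

definition source_pairing :: "'o \<Rightarrow> 'n" where
  "source_pairing X = FArr F (Ev C (Dual C X) \<cdot>\<^bsub>C\<^esub> (jC X \<boxdot>\<^bsub>C\<^esub> Ident C (Dual C X))) \<cdot>\<^bsub>D\<^esub> FTensor F X (Dual C X)"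

definition target_pairing :: "'o \<Rightarrow> 'n" where
  "target_pairing X = Ev D (Dual D (FObj F X)) \<cdot>\<^bsub>D\<^esub> (jD (FObj F X) \<boxdot>\<^bsub>D\<^esub> duality X)"

definition source_comparison :: "'o \<Rightarrow> 'n" where
  "source_comparison X = duality (Dual C X) \<cdot>\<^bsub>D\<^esub> FArr F (jC X)"

definition target_comparison :: "'o \<Rightarrow> 'n" where
  "target_comparison X = DualArr D (duality X) \<cdot>\<^bsub>D\<^esub> jD (FObj F X)"

lemma source_comparison_pairing:
  assumes [simp]: "X \<in> Obj C"
  shows "source_comparison X \<in> Hom D (FObj F X) (Dual D (FObj F (Dual C X)))"
    "Ev D (FObj F (Dual C X)) \<cdot>\<^bsub>D\<^esub> (source_comparison X \<boxdot>\<^bsub>D\<^esub> Ident D (FObj F (Dual C X))) = source_pairing X"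
proof -
  let ?X' = "Dual C X"
  show "source_comparison X \<in> Hom D (FObj F X) (Dual D (FObj F ?X'))"
    by (simp add: source_comparison_def Hom_iff)
  have "Ev D (FObj F ?X') \<cdot>\<^bsub>D\<^esub> (source_comparison X \<boxdot>\<^bsub>D\<^esub> Ident D (FObj F ?X')) =
      (Ev D (FObj F ?X') \<cdot>\<^bsub>D\<^esub> (duality ?X' \<boxdot>\<^bsub>D\<^esub> Ident D (FObj F ?X'))) \<cdot>\<^bsub>D\<^esub> (FArr F (jC X) \<boxdot>\<^bsub>D\<^esub> Ident D (FObj F ?X'))"
    by (simp add: source_comparison_def target.interchange)
  also have "\<dots> = FArr F (Ev C ?X') \<cdot>\<^bsub>D\<^esub> (FTensor F (Dual C ?X') ?X' \<cdot>\<^bsub>D\<^esub> (FArr F (jC X) \<boxdot>\<^bsub>D\<^esub> FArr F (Ident C ?X')))"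
    using duality_transformation_props(2)[of ?X'] by simp
  also have "\<dots> = source_pairing X"
    using FTensor_nat[of "jC X" "Ident C ?X'"] by (simp add: source_pairing_def FArr_Comp_arr)
  finally show "Ev D (FObj F ?X') \<cdot>\<^bsub>D\<^esub> (source_comparison X \<boxdot>\<^bsub>D\<^esub> Ident D (FObj F ?X')) = source_pairing X" .
qed

lemma target_comparison_pairing:
  assumes [simp]: "X \<in> Obj C"
  shows "target_comparison X \<in> Hom D (FObj F X) (Dual D (FObj F (Dual C X)))"
    "Ev D (FObj F (Dual C X)) \<cdot>\<^bsub>D\<^esub> (target_comparison X \<boxdot>\<^bsub>D\<^esub> Ident D (FObj F (Dual C X))) = target_pairing X"
proof -
  let ?X' = "Dual C X"
  note t' = target.DualArr_props[OF duality_transformation_props(1)[OF assms]]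
  note [simp] = HomD[OF t'(1)]
  show "target_comparison X \<in> Hom D (FObj F X) (Dual D (FObj F ?X'))"
    by (simp add: target_comparison_def Hom_iff)
  have "Ev D (FObj F ?X') \<cdot>\<^bsub>D\<^esub> (target_comparison X \<boxdot>\<^bsub>D\<^esub> Ident D (FObj F ?X')) =
      (Ev D (FObj F ?X') \<cdot>\<^bsub>D\<^esub> (DualArr D (duality X) \<boxdot>\<^bsub>D\<^esub> Ident D (FObj F ?X'))) \<cdot>\<^bsub>D\<^esub> (jD (FObj F X) \<boxdot>\<^bsub>D\<^esub> Ident D (FObj F ?X'))"
    by (simp add: target_comparison_def target.interchange)
  also have "\<dots> = target_pairing X" unfolding t'(2) by (simp add: target_pairing_def target.interchange)
  finally show "Ev D (FObj F ?X') \<cdot>\<^bsub>D\<^esub> (target_comparison X \<boxdot>\<^bsub>D\<^esub> Ident D (FObj F ?X')) = target_pairing X" .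
qed

text \<open>By naturality of the pivotal structures, restricting either pairing along
  \<open>f\<close> in the first variable amounts to restricting it along the dual of
  \<open>f\<close> in the second. This replaces a pairing on \<open>Y\<close> by one on
  \<open>X\<close>, which will be a simple summand of \<open>Y\<close>.\<close>

lemma source_pairing_dinatural:
  assumes f: "f \<in> Hom C X Y"
  shows "source_pairing Y \<cdot>\<^bsub>D\<^esub> (FArr F f \<boxdot>\<^bsub>D\<^esub> Ident D (FObj F (Dual C Y))) =
    source_pairing X \<cdot>\<^bsub>D\<^esub> (Ident D (FObj F X) \<boxdot>\<^bsub>D\<^esub> FArr F (DualArr C f))"
proof -
  have [simp]: "X \<in> Obj C" "Y \<in> Obj C" using source.Hom_objs[OF f] by auto
  note f' = source.DualArr_props[OF f] note f'' = source.DualArr_props[OF f'(1)]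
  note [simp] = HomD[OF f] HomD[OF f'(1)] HomD[OF f''(1)]
  let ?Y' = "Ident C (Dual C Y)"
  have "source_pairing Y \<cdot>\<^bsub>D\<^esub> (FArr F f \<boxdot>\<^bsub>D\<^esub> Ident D (FObj F (Dual C Y))) =
      FArr F (Ev C (Dual C Y) \<cdot>\<^bsub>C\<^esub> (jC Y \<boxdot>\<^bsub>C\<^esub> ?Y')) \<cdot>\<^bsub>D\<^esub> (FTensor F Y (Dual C Y) \<cdot>\<^bsub>D\<^esub> (FArr F f \<boxdot>\<^bsub>D\<^esub> FArr F ?Y'))"
    by (simp add: source_pairing_def)
  also have "\<dots> = FArr F (Ev C (Dual C Y) \<cdot>\<^bsub>C\<^esub> ((jC Y \<cdot>\<^bsub>C\<^esub> f) \<boxdot>\<^bsub>C\<^esub> ?Y')) \<cdot>\<^bsub>D\<^esub> FTensor F X (Dual C Y)"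
    using FTensor_nat[of f ?Y'] by (simp add: source.interchange flip: FArr_Comp_arr target.Comp_assoc_arr)
  also have "Ev C (Dual C Y) \<cdot>\<^bsub>C\<^esub> ((jC Y \<cdot>\<^bsub>C\<^esub> f) \<boxdot>\<^bsub>C\<^esub> ?Y') =
      (Ev C (Dual C Y) \<cdot>\<^bsub>C\<^esub> (DualArr C (DualArr C f) \<boxdot>\<^bsub>C\<^esub> ?Y')) \<cdot>\<^bsub>C\<^esub> (jC X \<boxdot>\<^bsub>C\<^esub> ?Y')"
    using jC_natural[OF f] by (simp add: source.interchange)
  also have "\<dots> = (Ev C (Dual C X) \<cdot>\<^bsub>C\<^esub> (jC X \<boxdot>\<^bsub>C\<^esub> Ident C (Dual C X))) \<cdot>\<^bsub>C\<^esub> (Ident C X \<boxdot>\<^bsub>C\<^esub> DualArr C f)"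
    unfolding f''(2) by (simp add: source.interchange)
  also have "FArr F \<dots> \<cdot>\<^bsub>D\<^esub> FTensor F X (Dual C Y) =
      FArr F (Ev C (Dual C X) \<cdot>\<^bsub>C\<^esub> (jC X \<boxdot>\<^bsub>C\<^esub> Ident C (Dual C X))) \<cdot>\<^bsub>D\<^esub> (FArr F (Ident C X \<boxdot>\<^bsub>C\<^esub> DualArr C f) \<cdot>\<^bsub>D\<^esub> FTensor F X (Dual C Y))"
    by (simp add: FArr_Comp_arr del: source.Comp_assoc_arr)
  also have "\<dots> = source_pairing X \<cdot>\<^bsub>D\<^esub> (Ident D (FObj F X) \<boxdot>\<^bsub>D\<^esub> FArr F (DualArr C f))"
    using FTensor_nat[of "Ident C X" "DualArr C f"] by (simp add: source_pairing_def)
  finally show ?thesis .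
qed

lemma target_pairing_dinatural:
  assumes f: "f \<in> Hom C X Y"
  shows "target_pairing Y \<cdot>\<^bsub>D\<^esub> (FArr F f \<boxdot>\<^bsub>D\<^esub> Ident D (FObj F (Dual C Y))) =
    target_pairing X \<cdot>\<^bsub>D\<^esub> (Ident D (FObj F X) \<boxdot>\<^bsub>D\<^esub> FArr F (DualArr C f))"
proof -
  have [simp]: "X \<in> Obj C" "Y \<in> Obj C" using source.Hom_objs[OF f] by auto
  note g' = target.DualArr_props[OF FArr_Hom[OF f]] note g'' = target.DualArr_props[OF g'(1)]
  note [simp] = HomD[OF f] HomD[OF source.DualArr_props(1)[OF f]] HomD[OF g'(1)] HomD[OF g''(1)]
  let ?FX = "FObj F X" and ?FY = "FObj F Y" and ?g = "FArr F f"
  have "target_pairing Y \<cdot>\<^bsub>D\<^esub> (?g \<boxdot>\<^bsub>D\<^esub> Ident D (FObj F (Dual C Y))) =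
      Ev D (Dual D ?FY) \<cdot>\<^bsub>D\<^esub> ((jD ?FY \<cdot>\<^bsub>D\<^esub> ?g) \<boxdot>\<^bsub>D\<^esub> duality Y)"
    by (simp add: target_pairing_def target.interchange)
  also have "\<dots> = (Ev D (Dual D ?FY) \<cdot>\<^bsub>D\<^esub> (DualArr D (DualArr D ?g) \<boxdot>\<^bsub>D\<^esub> Ident D (Dual D ?FY))) \<cdot>\<^bsub>D\<^esub> (jD ?FX \<boxdot>\<^bsub>D\<^esub> duality Y)"
    using jD_natural[OF FArr_Hom[OF f]] by (simp add: target.interchange)
  also have "\<dots> = Ev D (Dual D ?FX) \<cdot>\<^bsub>D\<^esub> (jD ?FX \<boxdot>\<^bsub>D\<^esub> (DualArr D ?g \<cdot>\<^bsub>D\<^esub> duality Y))"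
    unfolding g''(2) by (simp add: target.interchange)
  also have "\<dots> = target_pairing X \<cdot>\<^bsub>D\<^esub> (Ident D ?FX \<boxdot>\<^bsub>D\<^esub> FArr F (DualArr C f))"
    unfolding duality_transformation_natural[OF f] by (simp add: target_pairing_def target.interchange)
  finally show ?thesis .
qed

text \<open>Evaluated on the image of the coevaluation, each pairing gives the trace of its pivotal
  structure. For the pairing in the target category this is the compatibility of the duality
  transformation with coevaluations.\<close>

lemma source_pairing_ptrace:
  assumes [simp]: "X \<in> Obj C"
  shows "source_pairing X \<cdot>\<^bsub>D\<^esub> (Inv D (FTensor F X (Dual C X)) \<cdot>\<^bsub>D\<^esub> FArr F (Db C X)) =
    ptrace C X (jC X) \<star>\<^bsub>D\<^esub> Ident D (UnitObj D)"
proof -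
  have "source_pairing X \<cdot>\<^bsub>D\<^esub> (Inv D (FTensor F X (Dual C X)) \<cdot>\<^bsub>D\<^esub> FArr F (Db C X)) =
      FArr F (Ev C (Dual C X) \<cdot>\<^bsub>C\<^esub> (jC X \<boxdot>\<^bsub>C\<^esub> Ident C (Dual C X)) \<cdot>\<^bsub>C\<^esub> Db C X)"
    by (simp add: source_pairing_def FArr_Comp_arr)
  also have "\<dots> = FArr F (ptrace C X (jC X) \<star>\<^bsub>C\<^esub> Ident C (UnitObj C))"
    using source.ptrace_Scale_unit[OF assms source.Iso_Hom[OF jC_Iso]] by simp
  finally show ?thesis by (simp add: FArr_scale_arr)
qed

lemma target_pairing_ptrace:
  assumes [simp]: "X \<in> Obj C"
  shows "target_pairing X \<cdot>\<^bsub>D\<^esub> (Inv D (FTensor F X (Dual C X)) \<cdot>\<^bsub>D\<^esub> FArr F (Db C X)) =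
    ptrace D (FObj F X) (jD (FObj F X)) \<star>\<^bsub>D\<^esub> Ident D (UnitObj D)"
proof -
  let ?FX = "FObj F X" and ?d = "Inv D (FTensor F X (Dual C X)) \<cdot>\<^bsub>D\<^esub> FArr F (Db C X)"
  have "target_pairing X \<cdot>\<^bsub>D\<^esub> ?d =
      Ev D (Dual D ?FX) \<cdot>\<^bsub>D\<^esub> ((jD ?FX \<boxdot>\<^bsub>D\<^esub> Ident D (Dual D ?FX)) \<cdot>\<^bsub>D\<^esub> ((Ident D ?FX \<boxdot>\<^bsub>D\<^esub> duality X) \<cdot>\<^bsub>D\<^esub> ?d))"
    by (simp add: target_pairing_def target.interchange_assoc)
  also have "\<dots> = ptrace D ?FX (jD ?FX) \<star>\<^bsub>D\<^esub> Ident D (UnitObj D)"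
    unfolding duality_transformation_Db[OF assms]
    using target.ptrace_Scale_unit[OF _ target.Iso_Hom[OF jD_Iso], of ?FX] by simp
  finally show ?thesis .
qed

text \<open>As \<open>F\<close> is full, pairings of \<open>F X\<close> with
  \<open>F(X\<^sup>\<or>)\<close> come from pairings of \<open>X\<close> with its dual, so the two
  pairings are proportional. Evaluating both on the image of the coevaluation compares the traces;
  these are equal and nonzero, so the factor is one.\<close>

lemma pairings_agree_on_simple:
  assumes X: "is_simple C X" and tr: "ptrace D (FObj F X) (jD (FObj F X)) = ptrace C X (jC X)"
  shows "source_pairing X = target_pairing X"
proof -
  have [simp]: "X \<in> Obj C" using X by simp
  let ?e = "Ev C (Dual C X) \<cdot>\<^bsub>C\<^esub> (jC X \<boxdot>\<^bsub>C\<^esub> Ident C (Dual C X))"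
  let ?\<xi> = "FTensor F X (Dual C X)"
  let ?d = "Inv D ?\<xi> \<cdot>\<^bsub>D\<^esub> FArr F (Db C X)"
  have "target_pairing X \<cdot>\<^bsub>D\<^esub> Inv D ?\<xi> \<in> Hom D (FObj F (X \<boxtimes>\<^bsub>C\<^esub> Dual C X)) (FObj F (UnitObj C))"
    by (simp add: Hom_iff target_pairing_def)
  then obtain h where h: "h \<in> Hom C (X \<boxtimes>\<^bsub>C\<^esub> Dual C X) (UnitObj C)" and Fh: "FArr F h = target_pairing X \<cdot>\<^bsub>D\<^esub> Inv D ?\<xi>"
    by (rule full[rotated 2]) auto
  obtain c where c: "h = c \<star>\<^bsub>C\<^esub> ?e"
    using source.simple_pairing_multiple[OF X jC_Iso h] by auto
  have "target_pairing X = FArr F h \<cdot>\<^bsub>D\<^esub> ?\<xi>" unfolding Fh by (simp add: target_pairing_def)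
  also have "\<dots> = c \<star>\<^bsub>D\<^esub> source_pairing X"
    unfolding c by (simp add: FArr_scale_arr source_pairing_def)
  finally have tc: "target_pairing X = c \<star>\<^bsub>D\<^esub> source_pairing X" .
  have s [simp]: "source_pairing X \<in> Arr D" "Dom D (source_pairing X) = FObj F X \<boxtimes>\<^bsub>D\<^esub> FObj F (Dual C X)"
    by (simp_all add: source_pairing_def)
  have "ptrace C X (jC X) \<star>\<^bsub>D\<^esub> Ident D (UnitObj D) = c \<star>\<^bsub>D\<^esub> (source_pairing X \<cdot>\<^bsub>D\<^esub> ?d)"
    using target_pairing_ptrace[of X] unfolding tc tr by simp
  also have "\<dots> = (c * ptrace C X (jC X)) \<star>\<^bsub>D\<^esub> Ident D (UnitObj D)"
    using source_pairing_ptrace[of X] by simp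
  finally have "ptrace C X (jC X) = c * ptrace C X (jC X)"
    by (rule target.simple_scalar_inj[OF target.unit_simple])
  then have "c = 1" using source.ptrace_simple_nonzero[OF X jC_Iso] by simp
  then show ?thesis using tc by simp
qed

text \<open>Restricted to a simple summand \<open>S\<close> of \<open>X\<close>, the comparisons
  have equal transposes, by dinaturality and the agreement of the pairings on \<open>S\<close>.
  Inclusions of the simple summands detect equality.\<close>

lemma comparisons_agree:
  assumes X [simp]: "X \<in> Obj C"
    and tr: "\<And>S. is_simple C S \<Longrightarrow> ptrace D (FObj F S) (jD (FObj F S)) = ptrace C S (jC S)"
  shows "source_comparison X = target_comparison X"
proof -
  let ?L = "source_comparison X" and ?R = "target_comparison X"
  note L = source_comparison_pairing[OF X] and R = target_comparison_pairing[OF X]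
  note [simp] = HomD[OF L(1)] HomD[OF R(1)]
  let ?Z = "Dual D (FObj F (Dual C X))" and ?I = "Ident D (FObj F (Dual C X))"
  have agree: "?L \<cdot>\<^bsub>D\<^esub> FArr F \<iota> = ?R \<cdot>\<^bsub>D\<^esub> FArr F \<iota>" if S: "is_simple C S" and \<iota>: "\<iota> \<in> Hom C S X" for S \<iota>
  proof -
    note [simp] = HomD[OF \<iota>]
    have [simp]: "S \<in> Obj C" using S by simp
    have "Ev D (FObj F (Dual C X)) \<cdot>\<^bsub>D\<^esub> ((?L \<cdot>\<^bsub>D\<^esub> FArr F \<iota>) \<boxdot>\<^bsub>D\<^esub> ?I) =
        source_pairing X \<cdot>\<^bsub>D\<^esub> (FArr F \<iota> \<boxdot>\<^bsub>D\<^esub> ?I)"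
      unfolding L(2)[symmetric] by (simp add: target.interchange)
    also have "\<dots> = target_pairing X \<cdot>\<^bsub>D\<^esub> (FArr F \<iota> \<boxdot>\<^bsub>D\<^esub> ?I)"
      unfolding source_pairing_dinatural[OF \<iota>] target_pairing_dinatural[OF \<iota>]
        pairings_agree_on_simple[OF S tr[OF S]] ..
    also have "\<dots> = Ev D (FObj F (Dual C X)) \<cdot>\<^bsub>D\<^esub> ((?R \<cdot>\<^bsub>D\<^esub> FArr F \<iota>) \<boxdot>\<^bsub>D\<^esub> ?I)"
      unfolding R(2)[symmetric] by (simp add: target.interchange)
    finally show ?thesis
      by (rule target.pairing_cancel[OF target.left_dual, rotated -1]) (simp_all add: Hom_iff)
  qed
  \<comment> \<open>Fullness moves the two arrows back to the source category, where the inclusions of the simple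
    summands are jointly epic.\<close>
  obtain Y u where Y: "Y \<in> Obj C" and u: "u \<in> Iso D (FObj F Y) ?Z"
    using essentially_surjective[of ?Z] by auto
  note [simp] = Y target.Inv_simps[OF u]
  obtain l where l: "l \<in> Hom C X Y" "FArr F l = Inv D u \<cdot>\<^bsub>D\<^esub> ?L"
    by (rule full[of X Y "Inv D u \<cdot>\<^bsub>D\<^esub> ?L"]) (auto simp: Hom_iff)
  obtain r where r: "r \<in> Hom C X Y" "FArr F r = Inv D u \<cdot>\<^bsub>D\<^esub> ?R"
    by (rule full[of X Y "Inv D u \<cdot>\<^bsub>D\<^esub> ?R"]) (auto simp: Hom_iff)
  obtain Ss where Ss: "\<And>S. S \<in> set Ss \<Longrightarrow> is_simple C S" "is_direct_sum C X Ss"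
    using source.sums_of_simples[OF X] by blast
  have "l = r"
  proof (rule source.direct_sum_jointly_epic[OF Ss(2) l(1) r(1)])
    fix S \<iota> assume S: "S \<in> set Ss" and \<iota>: "\<iota> \<in> Hom C S X"
    note [simp] = HomD[OF \<iota>]
    show "l \<cdot>\<^bsub>C\<^esub> \<iota> = r \<cdot>\<^bsub>C\<^esub> \<iota>"
      by (rule faithful[OF source.Comp_Hom[OF \<iota> l(1)] source.Comp_Hom[OF \<iota> r(1)]])
        (simp add: FArr_Comp[OF \<iota> l(1)] FArr_Comp[OF \<iota> r(1)] l(2) r(2) agree[OF Ss(1)[OF S] \<iota>])
  qed
  then have "Inv D u \<cdot>\<^bsub>D\<^esub> ?L = Inv D u \<cdot>\<^bsub>D\<^esub> ?R" using l r by simp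
  then show ?thesis using target.Iso_mono[OF target.Inv_Iso[OF u] L(1) R(1)] by blast
qed

end

theorem corollary6p2:
  fixes C :: "('o, 'm) rigid_cat"
    and D :: "('p, 'n) rigid_cat"
    and F :: "('o, 'm, 'p, 'n) monoidal_functor_data"
    and jC :: "'o \<Rightarrow> 'm"
    and jD :: "'p \<Rightarrow> 'n"
  assumes "pseudo_unitary_fusion_category C"
    and "pseudo_unitary_fusion_category D"
    and "monoidal_functor C D F"
    and "linear_functor C D F"
    and "is_equivalence C D F"
    and "is_canonical_pivotal_structure C jC"
    and "is_canonical_pivotal_structure D jD"
  shows "preserves_pivotal C D F jC jD"
proof -
  interpret fusion_equivalence_pivotal C D F jC jD
    using assms
    by (simp add: fusion_equivalence_pivotal_def fusion_equivalence_pivotal_axioms_def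
        fusion_equivalence_def fusion_equivalence_axioms_def pseudo_unitary_fusion_category_def
        is_canonical_pivotal_structure_def)
  have tr: "ptrace D (FObj F S) (jD (FObj F S)) = ptrace C S (jC S)" if S: "is_simple C S" for S
  proof -
    have "S \<in> Obj C" using S by simp
    then show ?thesis
      using S assms(6,7) FObj_simple_iff FPdim_FObj by (simp add: is_canonical_pivotal_structure_def)
  qed
  show ?thesis
    unfolding preserves_pivotal_def
    using comparisons_agree[OF _ tr] by (simp add: source_comparison_def target_comparison_def)
qed

end
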